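(* For a probability measure $\nu$ on $\mathbb R$ denote by $\sigma^2(\nu)$ its variance. (1) If $\mu$ is a probability measure on $\mathbb R$ such that $F_\mu$ is univalent, then there exists an infinitesimal array $\{\mu_{n,j}\}_{1\le j\le k_n,\,1\le n}$ of probability measures on $\mathbb R$ such that $\mu_{n,1}\rhd\mu_{n,2}\rhd\cdots\rhd\mu_{n,k_n}$ converges weakly to $\mu$ as $n\to\infty$. (2) If an infinitesimal array $\{\mu_{n,j}\}_{1\le j\le k_n,\,1\le n}$ of probability measures on $\mathbb R$ satisfies the variance condition $\sup_{1\le j\le k_n}\sigma^2(\mu_{n,j})\to0$ as $n\to\infty$, and if $\mu_{n,1}\rhd\mu_{n,2}\rhd\cdots\rhd\mu_{n,k_n}$ converges weakly to a probability measure $\mu$ on $\mathbb R$, then $F_\mu$ is univalent.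
   Context: $\mathbb{C}^+=\{z\in\mathbb{C}:\operatorname{Im} z>0\}$. For a probability measure $\mu$ on $\mathbb{R}$, $G_\mu(z)=\int_{\mathbb R}\frac{1}{z-x}\mu(dx)$ and $F_\mu(z)=1/G_\mu(z)$ for $z\in\mathbb C^+$; $F_\mu$ maps $\mathbb C^+$ to $\mathbb C^+$. Univalent means holomorphic and injective on $\mathbb C^+$. The monotone convolution $\mu\rhd\nu$ is the probability measure on $\mathbb R$ with $F_{\mu\rhd\nu}=F_\mu\circ F_\nu$ (an associative operation). A family $\{\mu_{n,j}\}_{1\le j\le k_n,\,1\le n}$ of probability measures on $\mathbb R$ is an infinitesimal array if $k_n\to\infty$ as $n\to\infty$ and for every $\delta>0$, $\lim_{n\to\infty}\sup_{1\le j\le k_n}\mu_{n,j}(\mathbb R\setminus[-\delta,\delta])=0$. *)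

theory Defs
  imports "HOL-Probability.Probability"
begin

definition upper_half_plane :: "complex set" where
  "upper_half_plane = {z. Im z > 0}"

definition cauchy_transform :: "real measure \<Rightarrow> complex \<Rightarrow> complex" where
  "cauchy_transform \<mu> z = (\<integral>x. 1 / (z - complex_of_real x) \<partial>\<mu>)"

definition F_transform :: "real measure \<Rightarrow> complex \<Rightarrow> complex" where
  "F_transform \<mu> z = 1 / cauchy_transform \<mu> z"

definition univalent :: "(complex \<Rightarrow> complex) \<Rightarrow> bool" where
  "univalent f \<longleftrightarrow> f holomorphic_on upper_half_plane \<and> inj_on f upper_half_plane"

(* For probability measures on the Borel sets of the real line the described measure
   exists and is unique; for other arguments the value is unspecified. *)
definition monotone_conv :: "real measure \<Rightarrow> real measure \<Rightarrow> real measure"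
    (infixl "\<rhd>" 70) where
  "\<mu> \<rhd> \<nu> = (THE \<rho>. real_distribution \<rho> \<and>
      (\<forall>z\<in>upper_half_plane. F_transform \<rho> z = F_transform \<mu> (F_transform \<nu> z)))"

(* M 1 \<rhd> M 2 \<rhd> ... \<rhd> M k, meant for k \<ge> 1 *)
definition monotone_conv_upto :: "(nat \<Rightarrow> real measure) \<Rightarrow> nat \<Rightarrow> real measure" where
  "monotone_conv_upto M k = foldl (\<rhd>) (M 1) (map M [2..<Suc k])"

(* Rows are indexed by n \<ge> 1 and the entries of row n by 1 \<le> j \<le> k n; all other values of k
   and M are irrelevant. *)
definition infinitesimal_array :: "(nat \<Rightarrow> nat) \<Rightarrow> (nat \<Rightarrow> nat \<Rightarrow> real measure) \<Rightarrow> bool" where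
  "infinitesimal_array k M \<longleftrightarrow>
     (\<forall>n\<ge>1. k n \<ge> 1) \<and>
     (\<forall>n\<ge>1. \<forall>j\<in>{1..k n}. real_distribution (M n j)) \<and>
     filterlim k at_top sequentially \<and>
     (\<forall>\<delta>>0. (\<lambda>n. SUP j\<in>{1..k n}. measure (M n j) (UNIV - {-\<delta>..\<delta>})) \<longlonglongrightarrow> 0)"

(* The variance takes values in [0, \<infinity>]. If the mean does not exist, the inner Bochner integral
   is 0, but then the second moment, and hence the value below, is \<infinity>. *)
definition variance_of :: "real measure \<Rightarrow> ennreal" where
  "variance_of \<nu> = (\<integral>\<^sup>+x. ennreal ((x - (\<integral>y. y \<partial>\<nu>))\<^sup>2) \<partial>\<nu>)"

end

theory Submission
  imports Defs "HOL-Complex_Analysis.Complex_Analysis" "HOL-Real_Asymp.Real_Asymp"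
begin

text \<open>A holomorphic F mapping the upper half-plane to itself is the reciprocal Cauchy transform of a
  probability measure iff \<open>inf Im (F z) / Im z = 1\<close>, that is, iff its angular derivative at infinity
  is 1. This makes monotone convolution well defined.

  For the first part, normalize F by an affine map to fix \<open>\<i>\<close>; the angular derivative at infinity
  becomes some a in (0, 1]. If a < 1 then the image of F is a proper simply connected subdomain of
  the half-plane, and a third simply connected domain fits strictly in between, so F = p o q
  nontrivially; by Julia's lemma a rotation about \<open>\<i>\<close> makes the angular derivatives multiplicative.
  Montel and Hurwitz make the set of factorizations compact, and two extremal choices then yield
  F = g o h with both angular derivatives equal to sqrt a. Iterating gives \<open>2 ^ n\<close> factors with
  angular derivative \<open>a powr (1 / 2 ^ n)\<close>; after rescaling them to angular derivative 1, each takes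
  a point \<open>\<i> y\<close> of bounded height to \<open>\<i> y / b\<close> with b near 1, which forces its measure to be
  concentrated near 0. The row products are exactly \<open>\<mu>\<close>.

  For the second part, a variance at most \<open>s\<^sup>2\<close> makes F injective on \<open>Im z > s\<close>, a set that all
  reciprocal Cauchy transforms map into itself, so the row products are injective there;
  Hurwitz passes this to the limit.\<close>

section \<open>The Schwarz--Pick and Julia lemmas in the half-plane\<close>

text \<open>The reciprocal transforms themselves are not a compact family: a locally uniform limit
  can lose the behaviour at infinity, as F z = 2 z shows. With \<i> fixed instead, the injective
  maps whose angular derivative stays above a positive bound are compact. The loss is then measured
  by a number that is upper semicontinuous and equals 1 only for the identity. Cutting this number
  into equal roots makes all factors of a row close to the identity at the same time. A
  factorization through an intermediate domain is determined only up to a rotation about \<i>, and a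
  wrong rotation moves infinity to a finite boundary point and destroys the angular derivative
  altogether. Hence the work spent on choosing the rotation. Undoing the normalization is exact. If
  v is the imaginary part of F at \<i>, the angular derivative to be split is 1 / v, so the
  rescalings of the \<open>2 ^ n\<close> factors multiply to v. The remaining real translation is
  cut into \<open>2 ^ n\<close> equal point masses, which gives rows with \<open>2 * 2 ^ n\<close>
  entries.\<close>

abbreviation UHP :: "complex set" where "UHP \<equiv> upper_half_plane"

lemma UHP_iff [simp]: "z \<in> UHP \<longleftrightarrow> Im z > 0"
  by (simp add: upper_half_plane_def)

lemma open_UHP: "open UHP"
  by (simp add: upper_half_plane_def open_halfspace_Im_gt)

lemma convex_UHP: "convex UHP"
  by (simp add: upper_half_plane_def convex_halfspace_Im_gt)

lemma connected_UHP: "connected UHP"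
  by (simp add: convex_UHP convex_connected)

section \<open>Cayley maps of the half-plane onto the unit disc: w goes to 0, infinity to 1\<close>

definition cayley :: "complex \<Rightarrow> complex \<Rightarrow> complex" where
  "cayley w z = (z - w) / (z - cnj w)"

definition inv_cayley :: "complex \<Rightarrow> complex \<Rightarrow> complex" where
  "inv_cayley w \<xi> = (w - cnj w * \<xi>) / (1 - \<xi>)"

text \<open>The identity behind all hyperbolic estimates below: it trades the denominator of
  \<open>cayley w z\<close> for the numerator plus a product of heights.\<close>

lemma cmod_diff_cnj:
  "(cmod (z - cnj w))\<^sup>2 = (cmod (z - w))\<^sup>2 + 4 * Im z * Im w"
  by (simp add: cmod_power2) (simp add: power2_eq_square algebra_simps)

lemma UHP_diff_cnj_nonzero: "Im z > 0 \<Longrightarrow> Im w > 0 \<Longrightarrow> z - cnj w \<noteq> 0"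
  by (auto simp: complex_eq_iff)

lemma cmod_cayley_less_1:
  assumes "Im z > 0" "Im w > 0" shows "cmod (cayley w z) < 1"
proof -
  have "(cmod (z - w))\<^sup>2 < (cmod (z - cnj w))\<^sup>2"
    using assms by (simp add: cmod_diff_cnj)
  then have "cmod (z - w) < cmod (z - cnj w)"
    by (rule power_less_imp_less_base) simp
  then show ?thesis
    by (simp add: cayley_def norm_divide divide_less_eq)
qed

lemma Im_inv_cayley:
  assumes "\<xi> \<noteq> 1"
  shows "Im (inv_cayley w \<xi>) = Im w * (1 - (cmod \<xi>)\<^sup>2) / (cmod (1 - \<xi>))\<^sup>2"
proof -
  have "inv_cayley w \<xi> = (w - cnj w * \<xi>) * cnj (1 - \<xi>) / ((1 - \<xi>) * cnj (1 - \<xi>))"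
    using assms by (simp add: inv_cayley_def)
  also have "(1 - \<xi>) * cnj (1 - \<xi>) = complex_of_real ((cmod (1 - \<xi>))\<^sup>2)"
    by (rule complex_norm_square[symmetric])
  finally have "Im (inv_cayley w \<xi>) = Im ((w - cnj w * \<xi>) * cnj (1 - \<xi>)) / (cmod (1 - \<xi>))\<^sup>2"
    by (simp only: Im_divide_of_real)
  also have "Im ((w - cnj w * \<xi>) * cnj (1 - \<xi>)) = Im w * (1 - (cmod \<xi>)\<^sup>2)"
    by (simp add: cmod_power2) (simp add: power2_eq_square algebra_simps)
  finally show ?thesis .
qed

lemma inv_cayley_UHP:
  assumes "cmod \<xi> < 1" "Im w > 0" shows "Im (inv_cayley w \<xi>) > 0"
proof -
  have "\<xi> \<noteq> 1" using assms by auto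
  moreover have "(cmod \<xi>)\<^sup>2 < 1" using assms by (simp add: power_less_one_iff)
  ultimately show ?thesis using assms by (simp add: Im_inv_cayley)
qed

lemma cayley_inv_cayley:
  assumes "cmod \<xi> < 1" "Im w > 0" shows "cayley w (inv_cayley w \<xi>) = \<xi>"
proof -
  have "1 - \<xi> \<noteq> 0" using assms by auto
  moreover have "w - cnj w \<noteq> 0" using assms by (auto simp: complex_eq_iff)
  moreover from calculation have "inv_cayley w \<xi> - w = \<xi> * (w - cnj w) / (1 - \<xi>)"
    "inv_cayley w \<xi> - cnj w = (w - cnj w) / (1 - \<xi>)"
    by (simp_all add: inv_cayley_def field_simps)
  ultimately show ?thesis by (simp add: cayley_def)
qed

lemma inv_cayley_cayley:
  assumes "Im z > 0" "Im w > 0" shows "inv_cayley w (cayley w z) = z"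
proof -
  have 1: "z - cnj w \<noteq> 0" using assms by (rule UHP_diff_cnj_nonzero)
  have 2: "w - cnj w \<noteq> 0" using assms by (auto simp: complex_eq_iff)
  have "1 - cayley w z = (w - cnj w) / (z - cnj w)" using 1 by (simp add: cayley_def field_simps)
  moreover have "w - cnj w * cayley w z = z * (w - cnj w) / (z - cnj w)"
    using 1 by (simp add: cayley_def field_simps)
  ultimately show ?thesis using 1 2 by (simp add: inv_cayley_def)
qed

lemma cayley_holomorphic:
  assumes "Im w > 0" shows "cayley w holomorphic_on UHP"
  unfolding cayley_def[abs_def]
  by (intro holomorphic_intros) (use assms UHP_diff_cnj_nonzero in auto)

lemma inv_cayley_holomorphic: "inv_cayley w holomorphic_on ball 0 1"
  unfolding inv_cayley_def[abs_def] by (intro holomorphic_intros) auto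

lemma Schwarz_Pick_cayley:
  assumes hol: "f holomorphic_on UHP" and self: "\<And>z. Im z > 0 \<Longrightarrow> Im (f z) > 0"
    and z: "Im z > 0" and w: "Im w > 0"
  shows "cmod (cayley (f w) (f z)) \<le> cmod (cayley w z)"
proof -
  define \<phi> where "\<phi> = cayley (f w) \<circ> f \<circ> inv_cayley w"
  have "f \<circ> inv_cayley w holomorphic_on ball 0 1"
    by (rule holomorphic_on_compose_gen[OF inv_cayley_holomorphic hol])
       (use w in \<open>auto simp: inv_cayley_UHP\<close>)
  then have "\<phi> holomorphic_on ball 0 1"
    unfolding \<phi>_def comp_assoc
    by (rule holomorphic_on_compose_gen[OF _ cayley_holomorphic])
       (use w in \<open>auto simp: self inv_cayley_UHP\<close>)
  moreover have "\<phi> 0 = 0" by (simp add: \<phi>_def inv_cayley_def cayley_def)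
  moreover have "cmod (\<phi> \<xi>) < 1" if "cmod \<xi> < 1" for \<xi>
    using that unfolding \<phi>_def comp_def by (intro cmod_cayley_less_1 self inv_cayley_UHP w)
  ultimately have "cmod (\<phi> (cayley w z)) \<le> cmod (cayley w z)"
    using Schwarz_Lemma(1) cmod_cayley_less_1[OF z w] by blast
  then show ?thesis by (simp add: \<phi>_def inv_cayley_cayley z w)
qed

text \<open>Squared and expanded, the disc inequality reads A / (A + 4 B) \<le> C / (C + 4 D), and
  cross-multiplication leaves A D \<le> C B. This form without denominators can be followed to the
  boundary.\<close>

lemma Schwarz_Pick_UHP:
  assumes hol: "f holomorphic_on UHP" and self: "\<And>z. Im z > 0 \<Longrightarrow> Im (f z) > 0"
    and z: "Im z > 0" and w: "Im w > 0"
  shows "(cmod (f z - f w))\<^sup>2 * (Im z * Im w) \<le> (cmod (z - w))\<^sup>2 * (Im (f z) * Im (f w))"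
proof -
  define A B C D where "A = (cmod (f z - f w))\<^sup>2" "B = Im (f z) * Im (f w)"
    "C = (cmod (z - w))\<^sup>2" "D = Im z * Im w"
  have pos: "A \<ge> 0" "B > 0" "C \<ge> 0" "D > 0" using self z w by (auto simp: A_B_C_D_def)
  have "(cmod (cayley (f w) (f z)))\<^sup>2 \<le> (cmod (cayley w z))\<^sup>2"
    using Schwarz_Pick_cayley[OF assms] by (intro power_mono) auto
  then have "A / (A + 4 * B) \<le> C / (C + 4 * D)"
    by (simp add: cayley_def norm_divide power_divide cmod_diff_cnj A_B_C_D_def mult.assoc)
  then have "A * (C + 4 * D) \<le> C * (A + 4 * B)"
    using pos by (simp add: frac_le_eq divide_le_0_iff field_simps add_nonneg_pos)
  then show ?thesis unfolding A_B_C_D_def[symmetric] by (simp add: algebra_simps)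
qed

text \<open>A quarter of 1 - |\<open>cayley \<i> z\<close>|^2, thus closeness to the boundary as
  seen from \<i>. Unlike the height Im z it is invariant under rotations about \<i>, so the rotation
  in a factorization can be chosen after the estimates.\<close>

definition bdist :: "complex \<Rightarrow> real" where
  "bdist z = Im z / (cmod (z + \<i>))\<^sup>2"

lemma bdist_pos: "Im z > 0 \<Longrightarrow> bdist z > 0"
  unfolding bdist_def by (auto simp: complex_eq_iff intro!: divide_pos_pos)

lemma one_minus_cayley_i_sq:
  assumes "Im z > 0" shows "1 - (cmod (cayley \<i> z))\<^sup>2 = 4 * bdist z"
proof -
  have 1: "z + \<i> \<noteq> 0" using assms by (auto simp: complex_eq_iff)
  have "(cmod (cayley \<i> z))\<^sup>2 = (cmod (z - \<i>))\<^sup>2 / (cmod (z + \<i>))\<^sup>2"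
    by (simp add: cayley_def norm_divide power_divide)
  moreover have "(cmod (z + \<i>))\<^sup>2 = (cmod (z - \<i>))\<^sup>2 + 4 * Im z"
    using cmod_diff_cnj[of z \<i>] by simp
  moreover from 1 have "(cmod (z + \<i>))\<^sup>2 > 0" by simp
  then have "1 - (cmod (z - \<i>))\<^sup>2 / (cmod (z + \<i>))\<^sup>2
      = ((cmod (z + \<i>))\<^sup>2 - (cmod (z - \<i>))\<^sup>2) / (cmod (z + \<i>))\<^sup>2"
    by (simp add: diff_divide_distrib)
  ultimately show ?thesis by (simp only: bdist_def) simp
qed

lemma bdist_le_map:
  assumes hol: "f holomorphic_on UHP" and self: "\<And>z. Im z > 0 \<Longrightarrow> Im (f z) > 0"
    and "f \<i> = \<i>" and z: "Im z > 0"
  shows "bdist z \<le> bdist (f z)"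
proof -
  have "cmod (cayley \<i> (f z)) \<le> cmod (cayley \<i> z)"
    using Schwarz_Pick_cayley[OF hol self z, of \<i>] assms by simp
  then have "(cmod (cayley \<i> (f z)))\<^sup>2 \<le> (cmod (cayley \<i> z))\<^sup>2" by (intro power_mono) auto
  then show ?thesis using one_minus_cayley_i_sq[OF z] one_minus_cayley_i_sq[OF self[OF z]] by linarith
qed

text \<open>The elliptic automorphism of the half-plane about \<i> that multiplies by \<zeta> in the
  disc.\<close>

definition rot :: "complex \<Rightarrow> complex \<Rightarrow> complex" where
  "rot \<zeta> z = inv_cayley \<i> (\<zeta> * cayley \<i> z)"

lemma rot_UHP: "cmod \<zeta> = 1 \<Longrightarrow> Im z > 0 \<Longrightarrow> Im (rot \<zeta> z) > 0"
  unfolding rot_def by (intro inv_cayley_UHP) (auto simp: norm_mult cmod_cayley_less_1)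

lemma rot_holomorphic: "cmod \<zeta> = 1 \<Longrightarrow> rot \<zeta> holomorphic_on UHP"
proof -
  assume "cmod \<zeta> = 1"
  then have "inv_cayley \<i> \<circ> (\<lambda>z. \<zeta> * cayley \<i> z) holomorphic_on UHP"
    by (intro holomorphic_on_compose_gen[OF _ inv_cayley_holomorphic] holomorphic_intros cayley_holomorphic)
       (auto simp: norm_mult cmod_cayley_less_1)
  then show ?thesis by (simp add: rot_def[abs_def] comp_def)
qed

lemma cayley_rot: "cmod \<zeta> = 1 \<Longrightarrow> Im z > 0 \<Longrightarrow> cayley \<i> (rot \<zeta> z) = \<zeta> * cayley \<i> z"
  unfolding rot_def by (intro cayley_inv_cayley) (auto simp: norm_mult cmod_cayley_less_1)

lemma rot_cnj_rot: "cmod \<zeta> = 1 \<Longrightarrow> Im z > 0 \<Longrightarrow> rot (cnj \<zeta>) (rot \<zeta> z) = z"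
proof -
  assume *: "cmod \<zeta> = 1" "Im z > 0"
  have "cnj \<zeta> * \<zeta> = 1" using * complex_norm_square[of \<zeta>] by (simp add: mult.commute)
  then show ?thesis unfolding rot_def[of "cnj \<zeta>"] cayley_rot[OF *]
    using * by (simp add: mult.assoc[symmetric] inv_cayley_cayley)
qed

lemma rot_i: "rot \<zeta> \<i> = \<i>"
  by (simp add: rot_def cayley_def inv_cayley_def)

lemma bdist_rot: "cmod \<zeta> = 1 \<Longrightarrow> Im z > 0 \<Longrightarrow> bdist (rot \<zeta> z) = bdist z"
  using one_minus_cayley_i_sq[of z] one_minus_cayley_i_sq[OF rot_UHP, of \<zeta> z]
  by (simp add: cayley_rot norm_mult)

section \<open>Julia's lemma at infinity\<close>

lemma tendsto_cmod_ratio_at_infinity: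
  assumes "filterlim u at_infinity sequentially"
  shows "(\<lambda>n. (cmod (u n + a))\<^sup>2 / (cmod (u n - b))\<^sup>2) \<longlonglongrightarrow> 1"
proof -
  have inv: "(\<lambda>n. inverse (u n)) \<longlonglongrightarrow> 0"
    using tendsto_inverse_0 assms by (rule filterlim_compose)
  have "(\<lambda>n. (cmod (1 + a * inverse (u n)))\<^sup>2 / (cmod (1 - b * inverse (u n)))\<^sup>2) \<longlonglongrightarrow>
      (cmod (1 + a * 0))\<^sup>2 / (cmod (1 - b * 0))\<^sup>2"
    by (intro tendsto_intros inv) auto
  moreover have "\<forall>\<^sub>F n in sequentially. u n \<noteq> 0"
    using assms filterlim_at_infinity_imp_eventually_ne by blast
  then have "\<forall>\<^sub>F n in sequentially. (cmod (1 + a * inverse (u n)))\<^sup>2 / (cmod (1 - b * inverse (u n)))\<^sup>2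
      = (cmod (u n + a))\<^sup>2 / (cmod (u n - b))\<^sup>2"
  proof eventually_elim
    case (elim n)
    have "u n + a = u n * (1 + a * inverse (u n))" "u n - b = u n * (1 - b * inverse (u n))"
      using elim by (auto simp: field_simps)
    then show ?case using elim by (simp add: norm_mult power_mult_distrib del: right_diff_distrib)
  qed
  ultimately show ?thesis using Lim_transform_eventually by force
qed

text \<open>Schwarz--Pick for the pair u n, z gives a lower bound for Im (f z). As u n and f (u n)
  go to infinity, their distances to z and f z become comparable to those to -\<i>, so only the
  ratio of the \<open>bdist\<close> values survives.\<close>

lemma Julia_UHP:
  assumes hol: "f holomorphic_on UHP" and self: "\<And>z. Im z > 0 \<Longrightarrow> Im (f z) > 0"
    and u: "\<And>n. Im (u n) > 0" "filterlim u at_infinity sequentially"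
    and fu: "filterlim (\<lambda>n. f (u n)) at_infinity sequentially"
    and L: "(\<lambda>n. bdist (u n) / bdist (f (u n))) \<longlonglongrightarrow> L"
    and z: "Im z > 0"
  shows "L * Im z \<le> Im (f z)"
proof -
  let ?R = "\<lambda>n. bdist (u n) / bdist (f (u n)) *
      ((cmod (u n + \<i>))\<^sup>2 / (cmod (u n - z))\<^sup>2) / ((cmod (f (u n) + \<i>))\<^sup>2 / (cmod (f (u n) - f z))\<^sup>2) * Im z"
  have "?R \<longlonglongrightarrow> L * 1 / 1 * Im z"
    by (intro tendsto_intros L tendsto_cmod_ratio_at_infinity u fu) auto
  moreover have "\<forall>\<^sub>F n in sequentially. u n \<noteq> z" "\<forall>\<^sub>F n in sequentially. f (u n) \<noteq> f z"
    using u(2) fu filterlim_at_infinity_imp_eventually_ne by blast+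
  then have "\<forall>\<^sub>F n in sequentially. ?R n \<le> Im (f z)"
  proof eventually_elim
    case (elim n)
    define a b c d where "a = (cmod (u n - z))\<^sup>2" "b = (cmod (f (u n) - f z))\<^sup>2"
      "c = (cmod (u n + \<i>))\<^sup>2" "d = (cmod (f (u n) + \<i>))\<^sup>2"
    have pos: "a > 0" "b > 0" "Im (u n) > 0" "Im (f (u n)) > 0"
      using elim u(1) self by (auto simp: a_b_c_d_def)
    have "u n + \<i> \<noteq> 0" "f (u n) + \<i> \<noteq> 0" using pos by (auto simp: complex_eq_iff)
    then have pos': "c > 0" "d > 0" by (auto simp: a_b_c_d_def)
    have "b * (Im (u n) * Im z) \<le> a * (Im (f (u n)) * Im (f z))"
      using Schwarz_Pick_UHP[OF hol self u(1) z, of n] by (simp add: a_b_c_d_def)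
    then have "Im (u n) / Im (f (u n)) * b / a * Im z \<le> Im (f z)"
      using pos by (simp add: field_simps)
    also have "Im (u n) / Im (f (u n)) * b / a * Im z = ?R n"
      unfolding bdist_def a_b_c_d_def[symmetric] using pos pos' by (simp add: field_simps)
    finally show ?case .
  qed
  ultimately show ?thesis
    using tendsto_upperbound by fastforce
qed

section \<open>The angular derivative at infinity\<close>

text \<open>By the open mapping theorem a nonconstant f would cover a disc about the real value f w,
  hence points below the real axis.\<close>

lemma constant_if_Im_nonneg:
  assumes hol: "f holomorphic_on UHP" and nonneg: "\<And>z. Im z > 0 \<Longrightarrow> Im (f z) \<ge> 0"
    and w: "Im w > 0" "Im (f w) = 0" and z: "Im z > 0"
  shows "f z = f w"
proof (cases "f constant_on UHP")
  case True
  then show ?thesis using w z by (auto simp: constant_on_def)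
next
  case False
  then have "open (f ` UHP)"
    using open_mapping_thm[OF hol open_UHP connected_UHP open_UHP] by blast
  then obtain e where e: "e > 0" "ball (f w) e \<subseteq> f ` UHP"
    using w by (metis UHP_iff image_eqI open_contains_ball)
  then have "f w - \<i> * of_real (e / 2) \<in> f ` UHP"
    by (intro subsetD[OF e(2)]) (auto simp: dist_norm norm_mult)
  then obtain u where "Im u > 0" "f u = f w - \<i> * of_real (e / 2)" by force
  then have "Im (f u) = - (e / 2)" using w by simp
  with nonneg[OF \<open>Im u > 0\<close>] e show ?thesis by simp
qed

text \<open>The fixed point \<i> removes the affine freedom and makes the class locally bounded; it
  is closed under composition and contains the rotations about \<i>.\<close>

definition selfmap :: "(complex \<Rightarrow> complex) \<Rightarrow> bool" where
  "selfmap f \<longleftrightarrow> f holomorphic_on UHP \<and> inj_on f UHP \<and> (\<forall>z\<in>UHP. f z \<in> UHP) \<and> f \<i> = \<i>"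

text \<open>By the Julia--Wolff theorem this infimum is the angular derivative at infinity.\<close>

definition ang :: "(complex \<Rightarrow> complex) \<Rightarrow> real" where
  "ang f = (INF z\<in>UHP. Im (f z) / Im z)"

lemma i_in_UHP: "\<i> \<in> UHP" by simp

lemma selfmapD:
  assumes "selfmap f"
  shows "f holomorphic_on UHP" "inj_on f UHP" "\<And>z. Im z > 0 \<Longrightarrow> Im (f z) > 0" "f \<i> = \<i>"
  using assms by (auto simp: selfmap_def)

lemma ang_mult_le:
  assumes "\<And>z. Im z > 0 \<Longrightarrow> Im (f z) \<ge> 0" "Im z > 0"
  shows "ang f * Im z \<le> Im (f z)"
proof -
  have "ang f \<le> Im (f z) / Im z"
    unfolding ang_def by (rule cINF_lower) (use assms in \<open>auto intro!: bdd_belowI[of _ 0]\<close>)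
  then show ?thesis using assms by (simp add: field_simps)
qed

lemma ang_ge:
  assumes "\<And>z. Im z > 0 \<Longrightarrow> c * Im z \<le> Im (f z)"
  shows "c \<le> ang f"
  unfolding ang_def
proof (rule cINF_greatest)
  show "UHP \<noteq> {}" using i_in_UHP by blast
qed (use assms in \<open>auto simp: pos_le_divide_eq\<close>)

lemma ang_cong: "(\<And>z. Im z > 0 \<Longrightarrow> f z = g z) \<Longrightarrow> ang f = ang g"
  unfolding ang_def by (intro INF_cong) auto

lemma ang_nonneg: "selfmap f \<Longrightarrow> 0 \<le> ang f"
  using selfmapD(3)[of f] by (intro ang_ge) (simp add: less_imp_le)

lemma ang_le_1: "selfmap f \<Longrightarrow> ang f \<le> 1"
  using ang_mult_le[of f \<i>] selfmapD(3,4)[of f] by (simp add: less_imp_le)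

lemma selfmap_ang: "selfmap f \<Longrightarrow> Im z > 0 \<Longrightarrow> ang f * Im z \<le> Im (f z)"
  using selfmapD(3)[of f] by (intro ang_mult_le) (simp_all add: less_imp_le)

lemma ang_comp_ge:
  assumes "selfmap f" "selfmap g" shows "ang f * ang g \<le> ang (f \<circ> g)"
proof (rule ang_ge)
  fix z assume z: "Im z > 0"
  have "ang f * ang g * Im z \<le> ang f * Im (g z)"
    using selfmap_ang[OF assms(2) z] ang_nonneg[OF assms(1)] by (simp add: mult_left_mono mult.assoc)
  also have "\<dots> \<le> Im (f (g z))" by (rule selfmap_ang[OF assms(1) selfmapD(3)[OF assms(2) z]])
  finally show "ang f * ang g * Im z \<le> Im ((f \<circ> g) z)" by simp
qed

lemma selfmap_comp: "selfmap f \<Longrightarrow> selfmap g \<Longrightarrow> selfmap (f \<circ> g)"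
  unfolding selfmap_def
  by (auto intro!: holomorphic_on_compose_gen[where t=UHP] comp_inj_on intro: inj_on_subset)

lemma selfmap_id: "selfmap (\<lambda>z. z)"
  by (auto simp: selfmap_def)

lemma ang_id: "ang (\<lambda>z. z) = 1"
  by (intro antisym ang_le_1 ang_ge selfmap_id) auto

text \<open>f z - z has nonnegative imaginary part and vanishes at \<i>, so it vanishes
  identically.\<close>

lemma ang_eq_1_imp_id:
  assumes f: "selfmap f" and "ang f \<ge> 1" and z: "Im z > 0" shows "f z = z"
proof -
  have "f z - z = f \<i> - \<i>"
  proof (rule constant_if_Im_nonneg[where f="\<lambda>z. f z - z"])
    show "(\<lambda>z. f z - z) holomorphic_on UHP"
      by (intro holomorphic_intros selfmapD(1) f)
    show "0 \<le> Im (f z - z)" if "Im z > 0" for z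
    proof -
      have "1 * Im z \<le> ang f * Im z" using assms that by (intro mult_right_mono) auto
      also have "\<dots> \<le> Im (f z)" by (rule selfmap_ang[OF f that])
      finally show ?thesis by simp
    qed
  qed (use selfmapD(4)[OF f] z in auto)
  then show ?thesis using selfmapD(4)[OF f] by simp
qed

lemma selfmap_rot: "cmod \<zeta> = 1 \<Longrightarrow> selfmap (rot \<zeta>)"
  unfolding selfmap_def
  by (auto intro!: rot_holomorphic rot_UHP rot_i inj_on_inverseI[where g="rot (cnj \<zeta>)"] rot_cnj_rot)

lemma rot_1: "Im z > 0 \<Longrightarrow> rot 1 z = z"
  by (simp add: rot_def inv_cayley_cayley)

text \<open>A rotation with \<zeta> \<noteq> 1 sends infinity to a finite point, so it is bounded
  along the imaginary axis, where a positive angular derivative would force linear growth.\<close>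

lemma rot_eq_1_if_ang_pos:
  assumes \<zeta>: "cmod \<zeta> = 1" and pos: "ang (rot \<zeta>) > 0"
  shows "\<zeta> = 1"
proof (rule ccontr)
  assume "\<zeta> \<noteq> 1"
  define u :: "nat \<Rightarrow> complex" where "u n = \<i> * of_nat (Suc n)" for n
  have "(\<lambda>n. cayley \<i> (u n)) = (\<lambda>n. of_real (real n / (real n + 2)))"
  proof
    fix n :: nat
    have "of_nat n + (2::complex) \<noteq> 0" by (simp add: complex_eq_iff)
    moreover have "u n - \<i> = \<i> * of_nat n" "u n + \<i> = \<i> * (of_nat n + 2)"
      by (simp_all add: u_def algebra_simps)
    ultimately show "cayley \<i> (u n) = of_real (real n / (real n + 2))"
      by (simp add: cayley_def)
  qed
  moreover have "(\<lambda>n. real n / (real n + 2)) \<longlonglongrightarrow> 1" by real_asymp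
  ultimately have "(\<lambda>n. cayley \<i> (u n)) \<longlonglongrightarrow> 1"
    using tendsto_of_real[of "\<lambda>n. real n / (real n + 2)" 1 sequentially, where 'a=complex] by simp
  then have "(\<lambda>n. rot \<zeta> (u n)) \<longlonglongrightarrow> inv_cayley \<i> (\<zeta> * 1)"
    unfolding rot_def inv_cayley_def using \<open>\<zeta> \<noteq> 1\<close> by (intro tendsto_intros) auto
  then have "Bseq (\<lambda>n. Im (rot \<zeta> (u n)))"
    by (intro convergent_imp_Bseq convergentI[OF tendsto_Im])
  then obtain K where K: "\<And>n. \<bar>Im (rot \<zeta> (u n))\<bar> \<le> K" unfolding Bseq_def by auto
  obtain n where n: "real n * ang (rot \<zeta>) > K" using reals_Archimedean3[OF pos] by blast
  have "ang (rot \<zeta>) * Im (u n) \<le> Im (rot \<zeta> (u n))"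
    by (rule selfmap_ang[OF selfmap_rot[OF \<zeta>]]) (simp add: u_def)
  also have "\<dots> \<le> K" using K[of n] by linarith
  finally show False using n pos by (simp add: u_def algebra_simps)
qed

lemma filterlim_at_infinity_if_cayley:
  assumes "\<And>n. Im (u n) > 0" "(\<lambda>n. cayley \<i> (u n)) \<longlonglongrightarrow> 1"
  shows "filterlim u at_infinity sequentially"
proof -
  have nz: "u n + \<i> \<noteq> 0" for n using assms(1)[of n] by (auto simp: complex_eq_iff)
  have eq: "inverse (u n + \<i>) = (1 - cayley \<i> (u n)) / (2 * \<i>)" for n
  proof -
    have "1 - cayley \<i> (u n) = 2 * \<i> * inverse (u n + \<i>)"
      using nz[of n] by (simp add: cayley_def diff_divide_eq_iff divide_inverse[symmetric])
    then show ?thesis by (simp only: nonzero_mult_div_cancel_left) simp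
  qed
  have "(\<lambda>n. (1 - cayley \<i> (u n)) / (2 * \<i>)) \<longlonglongrightarrow> (1 - 1) / (2 * \<i>)"
    by (intro tendsto_intros assms) auto
  then have "(\<lambda>n. inverse (u n + \<i>)) \<longlonglongrightarrow> 0" by (simp add: eq)
  then have "filterlim (\<lambda>n. inverse (u n + \<i>)) (at 0) sequentially"
    using nz by (simp add: filterlim_at)
  then have "filterlim (\<lambda>n. u n + \<i>) at_infinity sequentially"
    by (simp add: filterlim_inverse_at_iff)
  then have "filterlim (\<lambda>n. -\<i> + (u n + \<i>)) at_infinity sequentially"
    by (rule tendsto_add_filterlim_at_infinity[OF tendsto_const])
  then show ?thesis by simp
qed

lemma bdist_le_inverse: "Im z > 0 \<Longrightarrow> bdist z \<le> 1 / (Im z + 1)"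
proof -
  assume z: "Im z > 0"
  have "Im z + 1 \<le> cmod (z + \<i>)" using abs_Im_le_cmod[of "z + \<i>"] by simp
  then have "(Im z + 1)\<^sup>2 \<le> (cmod (z + \<i>))\<^sup>2" using z by (intro power_mono) auto
  then have "bdist z \<le> Im z / (Im z + 1)\<^sup>2"
    unfolding bdist_def using z by (intro frac_le) auto
  also have "\<dots> \<le> (Im z + 1) / (Im z + 1)\<^sup>2" using z by (intro divide_right_mono) auto
  also have "\<dots> = 1 / (Im z + 1)" using z by (simp add: power2_eq_square)
  finally show ?thesis .
qed

text \<open>Along \<open>z\<^sub>n = \<i> n\<close> the values \<open>h z\<^sub>n\<close> tend to the boundary of the half-plane; \<open>\<zeta>\<close> is chosen to rotate a
  limit point to infinity, and Julia's lemma then bounds both angular derivatives from below.\<close>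

lemma rotate_factorization:
  assumes g: "selfmap g" and h: "selfmap h"
    and c: "c > 0" "c \<le> ang (g \<circ> h)"
  obtains \<zeta> where "cmod \<zeta> = 1" "c \<le> ang (g \<circ> rot (cnj \<zeta>)) * ang (rot \<zeta> \<circ> h)"
proof -
  define z :: "nat \<Rightarrow> complex" where "z n = \<i> * of_nat (Suc n)" for n
  define w v where "w n = h (z n)" "v n = g (w n)" for n
  \<comment> \<open>The product \<open>r n * t n\<close> telescopes to the ratio of
    \<open>bdist\<close> at z n and v n, for which both ends are known. Each factor lies in [0, 1]
    by Schwarz--Pick.\<close>
  define r t where "r n = bdist (z n) / bdist (w n)" "t n = bdist (w n) / bdist (v n)" for n
  have Imz: "Im (z n) = real n + 1" and z0: "Im (z n) > 0" for n by (auto simp: z_def)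
  have w0: "Im (w n) > 0" for n unfolding w_v_def by (intro selfmapD(3)[OF h] z0)
  have v0: "Im (v n) > 0" for n unfolding w_v_def(2) by (intro selfmapD(3)[OF g] w0)
  have vc: "c * (real n + 1) \<le> Im (v n)" for n
  proof -
    have "c * Im (z n) \<le> ang (g \<circ> h) * Im (z n)" using c z0[of n] by (intro mult_right_mono) auto
    also have "\<dots> \<le> Im (v n)"
      using selfmap_ang[OF selfmap_comp[OF g h] z0, of n] by (simp add: w_v_def)
    finally show ?thesis by (simp add: Imz)
  qed
  have zw: "bdist (z n) \<le> bdist (w n)" for n
    unfolding w_v_def by (rule bdist_le_map) (use selfmapD[OF h] z0 in simp_all)
  have wv: "bdist (w n) \<le> bdist (v n)" for n
    unfolding w_v_def(2) by (rule bdist_le_map) (use selfmapD[OF g] w0 in simp_all)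
  note pos = bdist_pos[OF z0] bdist_pos[OF w0] bdist_pos[OF v0]
  have rt01: "r n \<in> {0..1}" "t n \<in> {0..1}" for n
    using pos[of n] zw[of n] wv[of n] by (auto simp: r_t_def)
  have bv: "bdist (v n) \<le> 1 / (c * (real n + 1) + 1)" for n
  proof -
    have "1 / (Im (v n) + 1) \<le> 1 / (c * (real n + 1) + 1)"
      using vc[of n] c v0[of n] by (intro frac_le add_nonneg_pos mult_nonneg_nonneg) auto
    then show ?thesis using bdist_le_inverse[OF v0, of n] by linarith
  qed
  have bz: "bdist (z n) = (real n + 1) / (real n + 2)\<^sup>2" for n
  proof -
    have "z n + \<i> = \<i> * of_real (real n + 2)" by (simp add: z_def algebra_simps)
    then have "cmod (z n + \<i>) = real n + 2" by (simp add: norm_mult del: of_real_add)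
    then show ?thesis by (simp add: bdist_def Imz)
  qed
  have rt: "(real n + 1) / (real n + 2)\<^sup>2 * (c * (real n + 1) + 1) \<le> r n * t n" for n
  proof -
    have "c * (real n + 1) + 1 > 0" using c by (intro add_nonneg_pos mult_nonneg_nonneg) auto
    then have "c * (real n + 1) + 1 \<le> 1 / bdist (v n)" using bv[of n] pos[of n] by (simp add: field_simps)
    then have "(real n + 1) / (real n + 2)\<^sup>2 * (c * (real n + 1) + 1) \<le> bdist (z n) * (1 / bdist (v n))"
      unfolding bz by (intro mult_left_mono) auto
    then show ?thesis using pos[of n] by (simp add: r_t_def)
  qed
  \<comment> \<open>One compactness argument yields a common subsequence for both ratios and for the
    position of w n in the closed disc.\<close>
  define X where "X n = (r n, t n, cayley \<i> (w n))" for n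
  have "compact ({0..1::real} \<times> {0..1::real} \<times> cball (0::complex) 1)"
    by (intro compact_Times) auto
  moreover have "\<forall>n. X n \<in> {0..1} \<times> {0..1} \<times> cball 0 1"
    using rt01 cmod_cayley_less_1[OF w0, of \<i>] by (auto simp: X_def less_imp_le)
  ultimately obtain l s where s: "strict_mono s" and l: "(X \<circ> s) \<longlonglongrightarrow> l"
    unfolding compact_def by metis
  obtain \<rho> \<tau> \<zeta>0 where "l = (\<rho>, \<tau>, \<zeta>0)" by (cases l)
  with l have lim: "(\<lambda>n. r (s n)) \<longlonglongrightarrow> \<rho>" "(\<lambda>n. t (s n)) \<longlonglongrightarrow> \<tau>"
      "(\<lambda>n. cayley \<i> (w (s n))) \<longlonglongrightarrow> \<zeta>0"
    using tendsto_fst[OF l] tendsto_fst[OF tendsto_snd[OF l]] tendsto_snd[OF tendsto_snd[OF l]]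
    by (auto simp: X_def comp_def)
  have sub: "f \<longlonglongrightarrow> a \<Longrightarrow> (\<lambda>n. f (s n)) \<longlonglongrightarrow> a" for f :: "nat \<Rightarrow> real" and a
    using LIMSEQ_subseq_LIMSEQ[OF _ s] by (auto simp: comp_def)
  have "(\<lambda>n. (real n + 1) / (real n + 2)\<^sup>2 * (c * (real n + 1) + 1)) \<longlonglongrightarrow> c"
    using c by real_asymp
  from sub[OF this] have "c \<le> \<rho> * \<tau>"
    by (rule LIMSEQ_le[OF _ tendsto_mult[OF lim(1,2)]]) (rule exI[of _ 0], intro allI impI rt)
  \<comment> \<open>w n is at least as close to the boundary as v n, and v n goes to infinity; so
    the limit point of \<open>cayley \<i> (w n)\<close> has modulus 1.\<close>
  have "(\<lambda>n. 1 / (c * (real n + 1) + 1)) \<longlonglongrightarrow> 0" using c by real_asymp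
  then have bw0: "(\<lambda>n. bdist (w n)) \<longlonglongrightarrow> 0"
    by (rule tendsto_sandwich[OF _ _ tendsto_const, rotated 2])
       (use pos(2) order_trans[OF wv bv] in \<open>auto intro!: always_eventually less_imp_le\<close>)
  have "(\<lambda>n. 1 - (cmod (cayley \<i> (w (s n))))\<^sup>2) \<longlonglongrightarrow> 1 - (cmod \<zeta>0)\<^sup>2"
    by (intro tendsto_intros lim)
  moreover have "(\<lambda>n. 1 - (cmod (cayley \<i> (w (s n))))\<^sup>2) \<longlonglongrightarrow> 4 * 0"
    unfolding one_minus_cayley_i_sq[OF w0] by (intro tendsto_intros sub bw0)
  ultimately have "1 - (cmod \<zeta>0)\<^sup>2 = 0" using LIMSEQ_unique by fastforce
  then have \<zeta>0: "cmod \<zeta>0 = 1" by (simp add: power2_eq_1_iff) (use norm_ge_zero[of \<zeta>0] in linarith)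
  \<comment> \<open>Multiplication by this \<zeta> carries the limit point to 1, the image of
    infinity under the Cayley map.\<close>
  define \<zeta> where "\<zeta> = cnj \<zeta>0"
  have \<zeta>: "cmod \<zeta> = 1" "cmod (cnj \<zeta>) = 1" using \<zeta>0 by (auto simp: \<zeta>_def)
  define W where "W n = rot \<zeta> (w (s n))" for n
  have W0: "Im (W n) > 0" for n unfolding W_def by (intro rot_UHP \<zeta> w0)
  have "\<zeta> * \<zeta>0 = 1" using complex_norm_square[of \<zeta>0] \<zeta>0 by (simp add: \<zeta>_def mult.commute)
  then have "(\<lambda>n. cayley \<i> (W n)) \<longlonglongrightarrow> 1"
    unfolding W_def cayley_rot[OF \<zeta>(1) w0] using tendsto_mult_left[OF lim(3), of \<zeta>] by simp
  then have Winf: "filterlim W at_infinity sequentially"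
    by (intro filterlim_at_infinity_if_cayley W0)
  have Iminf: "filterlim u at_infinity sequentially"
    if "\<And>n. c * (real (s n) + 1) \<le> Im (u n)" for u
  proof (rule filterlim_norm_at_top_imp_at_infinity, rule filterlim_at_top_mono)
    have "filterlim (\<lambda>n. c * (real n + 1)) at_top sequentially" using c by real_asymp
    then show "filterlim (\<lambda>n. c * (real (s n) + 1)) at_top sequentially"
      by (rule filterlim_compose[OF _ filterlim_subseq[OF s]])
    show "\<forall>\<^sub>F n in sequentially. c * (real (s n) + 1) \<le> cmod (u n)"
      using that abs_Im_le_cmod by (intro always_eventually allI) (metis abs_ge_self order_trans)
  qed
  have c1: "c \<le> 1" using c ang_le_1[OF selfmap_comp[OF g h]] by linarith
  have zinf: "filterlim (\<lambda>n. z (s n)) at_infinity sequentially"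
  proof (rule Iminf)
    show "c * (real (s n) + 1) \<le> Im (z (s n))" for n
      using c1 mult_right_mono[of c 1 "real (s n) + 1"] by (simp add: Imz)
  qed
  have vinf: "filterlim (\<lambda>n. v (s n)) at_infinity sequentially"
    by (rule Iminf) (rule vc)
  have sh: "selfmap (rot \<zeta> \<circ> h)" by (intro selfmap_comp selfmap_rot \<zeta> h)
  have sg: "selfmap (g \<circ> rot (cnj \<zeta>))" by (intro selfmap_comp selfmap_rot \<zeta> g)
  have gW: "(g \<circ> rot (cnj \<zeta>)) (W n) = v (s n)" for n
    unfolding W_def comp_def rot_cnj_rot[OF \<zeta>(1) w0] by (simp add: w_v_def)
  have A1: "\<rho> \<le> ang (rot \<zeta> \<circ> h)"
  proof (rule ang_ge)
    show "\<rho> * Im x \<le> Im ((rot \<zeta> \<circ> h) x)" if "Im x > 0" for x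
    proof (rule Julia_UHP[where u="\<lambda>n. z (s n)"])
      show "filterlim (\<lambda>n. (rot \<zeta> \<circ> h) (z (s n))) at_infinity sequentially"
        using Winf by (simp add: W_def[abs_def] w_v_def)
      show "(\<lambda>n. bdist (z (s n)) / bdist ((rot \<zeta> \<circ> h) (z (s n)))) \<longlonglongrightarrow> \<rho>"
        using lim(1) bdist_rot[OF \<zeta>(1) w0] by (simp add: r_t_def w_v_def)
    qed (fact selfmapD[OF sh] z0 zinf that)+
  qed
  have A2: "\<tau> \<le> ang (g \<circ> rot (cnj \<zeta>))"
  proof (rule ang_ge)
    show "\<tau> * Im x \<le> Im ((g \<circ> rot (cnj \<zeta>)) x)" if "Im x > 0" for x
    proof (rule Julia_UHP[where u=W])
      show "filterlim (\<lambda>n. (g \<circ> rot (cnj \<zeta>)) (W n)) at_infinity sequentially"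
        unfolding gW by (rule vinf)
      show "(\<lambda>n. bdist (W n) / bdist ((g \<circ> rot (cnj \<zeta>)) (W n))) \<longlonglongrightarrow> \<tau>"
        unfolding gW using lim(2) bdist_rot[OF \<zeta>(1) w0] by (simp add: r_t_def W_def)
    qed (fact selfmapD[OF sg] W0 Winf that)+
  qed
  have "c \<le> \<tau> * \<rho>" using \<open>c \<le> \<rho> * \<tau>\<close> by (simp add: mult.commute)
  also have "\<dots> \<le> ang (g \<circ> rot (cnj \<zeta>)) * ang (rot \<zeta> \<circ> h)"
  proof (intro mult_mono A1 A2)
    show "0 \<le> \<rho>" by (rule LIMSEQ_le_const[OF lim(1)]) (use rt01 in auto)
  qed (rule ang_nonneg[OF sg])
  finally show ?thesis using that \<zeta> by blast
qed

section \<open>Intermediate simply connected domains\<close>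

text \<open>Enlarge E by a small disc around a boundary point p inside the unit disc, and fill the holes.
  If this filled the whole unit disc, then Sura-Bura's theorem would separate the complement of E near p
  from the exterior of the disc, although the complement of E is connected.\<close>

lemma disc_insert_domain:
  fixes E :: "complex set"
  assumes E: "open E" "connected E" "E \<noteq> {}" "connected (- E)" "E \<subset> ball 0 1"
  obtains D where "open D" "simply_connected D" "E \<subset> D" "D \<subset> ball 0 1"
proof -
  obtain p where p: "p \<in> ball 0 1" "p \<in> frontier E"
  proof -
    have "ball 0 1 \<inter> frontier E \<noteq> {}"
      by (rule connected_Int_frontier) (use E in auto)
    then show ?thesis using that by blast
  qed
  obtain r where r: "r > 0" "cball p r \<subseteq> ball 0 1"
    using p(1) open_contains_cball open_ball by blast
  define B W K where "B = ball p r" "W = E \<union> B" "K = - ball (0::complex) 1"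
  have pE: "p \<notin> E" using p(2) E(1) by (simp add: frontier_def interior_open)
  have "B \<inter> E \<noteq> {}"
    using p(2) r(1) unfolding B_W_K_def frontier_def
    by (metis DiffD1 IntI centre_in_ball empty_iff open_Int_closure_eq_empty open_ball)
  then have W: "open W" "connected W" "W \<subseteq> ball 0 1"
    using E r ball_subset_cball[of p r] unfolding B_W_K_def
    by (auto intro!: connected_Un)
  have K: "connected K" "closed K" "K \<noteq> {}" "K \<subseteq> - W"
  proof -
    show "connected K" unfolding B_W_K_def
      by (rule connected_complement_bounded_convex) auto
    show "K \<noteq> {}" unfolding B_W_K_def using not_bounded_UNIV[where 'a=complex] bounded_ball by (metis Compl_empty_eq double_complement)
  qed (use W in \<open>auto simp: B_W_K_def\<close>)
  \<comment> \<open>C is the unbounded part of the complement of W; its complement D is W with the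
    holes filled, and is simply connected because C is connected.\<close>
  obtain C where C: "C \<in> components (- W)" "K \<subseteq> C"
    using exists_component_superset[of K "- W"] K by blast
  have CW: "C \<subseteq> - W" using C by (rule_tac in_components_subset)
  have "closed C" using closed_components[OF _ C(1)] W by auto
  define D where "D = - C"
  have D: "open D" "connected D" "W \<subseteq> D" "D \<subseteq> ball 0 1"
    using \<open>closed C\<close> component_complement_connected[OF W(2) C(1)] CW C(2)
    by (auto simp: D_def B_W_K_def)
  have "simply_connected D"
    using D in_components_connected[OF C(1)] bounded_subset[OF bounded_ball D(4)]
    by (simp add: simply_connected_iff_simple D_def)
  have "p \<in> D" using D(3) r(1) by (auto simp: B_W_K_def)
  have "D \<noteq> ball 0 1"
  proof
    assume "D = ball 0 1"
    then have CK: "C = K" by (auto simp: D_def B_W_K_def)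
    \<comment> \<open>Cutting the complement of W down to the closed disc makes it compact, as
      Sura-Bura requires. If C is only the exterior K, the component of T through the unit circle is
      the circle itself.\<close>
    define T A where "T = cball 0 1 - W" "A = sphere (0::complex) 1"
    have T: "compact T" "A \<subseteq> T" using W unfolding T_A_def by (auto intro: compact_diff)
    have A: "compact A" "connected A" "A \<noteq> {}"
    proof -
      show "compact A" unfolding T_A_def by simp
      show "connected A" unfolding T_A_def by (rule connected_sphere) simp
      show "A \<noteq> {}" unfolding T_A_def by simp
    qed
    obtain C' where C': "C' \<in> components T" "A \<subseteq> C'"
      using exists_component_superset[of A T] A T by blast
    have C'T: "C' \<subseteq> T" using C'(1) by (rule in_components_subset)
    have "C' \<subseteq> C"
    proof (rule components_maximal[OF C(1)])
      show "connected C'" using C'(1) by (rule in_components_connected)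
      show "C' \<subseteq> - W" using C'T by (auto simp: T_A_def)
      have "(1::complex) \<in> C \<inter> C'" using C'(2) CK by (auto simp: T_A_def B_W_K_def)
      then show "C \<inter> C' \<noteq> {}" by blast
    qed
    have "C' = A"
    proof
      have "C' \<subseteq> (- ball 0 1) \<inter> cball 0 1"
        using \<open>C' \<subseteq> C\<close> C'T unfolding CK B_W_K_def T_A_def by blast
      also have "\<dots> = A" by (auto simp: T_A_def)
      finally show "C' \<subseteq> A" .
    qed (rule C'(2))
    \<comment> \<open>The component A of T has a clopen neighbourhood Q in T that misses the closed
      disc about p.\<close>
    obtain Q where Q: "openin (top_of_set T) Q" "compact Q" "A \<subseteq> Q" "Q \<subseteq> - cball p r"
    proof (rule Sura_Bura_clopen_subset[of T C' "- cball p r"])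
      show "locally compact T" using T compact_imp_closed closed_imp_locally_compact by blast
      show "C' \<subseteq> - cball p r" using r(2) \<open>C' = A\<close> by (auto simp: T_A_def)
    qed (use C' A \<open>C' = A\<close> that in auto)
    have QT: "Q \<subseteq> T" using openin_imp_subset[OF Q(1)] by simp
    \<comment> \<open>The closed sets \<open>Q \<union> K\<close> and R cover \<open>- E\<close> and
      do not meet there: the exterior touches T only in A, which lies in Q, and Q avoids the closed
      disc about p. The first contains K, the second p, against connectedness of
      \<open>- E\<close>.\<close>
    define R where "R = (T - Q) \<union> (- E \<inter> cball p r)"
    have "closed (T - Q)"
      using Q(1) T(1) by (meson closedin_closed_trans closedin_diff closedin_self compact_imp_closed)
    then have clR: "closed R" unfolding R_def using E(1) by (intro closed_Un closed_Int) auto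
    have cl: "closed (Q \<union> K)" using Q K compact_imp_closed by blast
    have cov: "- E \<subseteq> (Q \<union> K) \<union> R"
    proof
      fix x assume x: "x \<in> - E"
      show "x \<in> (Q \<union> K) \<union> R"
      proof (cases "x \<in> K")
        case False
        then have "x \<in> ball 0 1" by (simp add: B_W_K_def)
        then have "x \<in> cball 0 1" by auto
        then show ?thesis using x ball_subset_cball[of p r] by (auto simp: R_def T_A_def B_W_K_def)
      qed auto
    qed
    have dis: "(Q \<union> K) \<inter> R \<inter> - E = {}"
      using Q(3,4) r(2) by (auto simp: R_def T_A_def B_W_K_def)
    have pR: "p \<in> R \<inter> - E" using pE r(1) by (auto simp: R_def)
    have KE: "K \<inter> - E \<noteq> {}" using K E(5) by (auto simp: B_W_K_def)
    have "(Q \<union> K) \<inter> - E = {} \<or> R \<inter> - E = {}"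
      by (rule connected_closedD[OF E(4) dis cov cl clR])
    then show False
    proof
      assume "(Q \<union> K) \<inter> - E = {}"
      then show False using KE by (simp add: Int_Un_distrib2)
    next
      assume "R \<inter> - E = {}"
      then show False using pR by simp
    qed
  qed
  then have "D \<subset> ball 0 1" using D by blast
  moreover have "E \<subset> D" using D(3) \<open>p \<in> D\<close> pE by (auto simp: B_W_K_def)
  ultimately show ?thesis using that D \<open>simply_connected D\<close> by blast
qed

lemma selfmap_if_inverse:
  assumes k: "k holomorphic_on UHP" and self: "\<And>z. Im z > 0 \<Longrightarrow> Im (k z) > 0"
    and inv: "\<And>z. Im z > 0 \<Longrightarrow> f (k z) = z" and "k \<i> = \<i>"
  shows "selfmap k"
  using assms unfolding selfmap_def by (auto intro!: inj_on_inverseI[where g=f])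

text \<open>With inverse k, the composition \<open>s \<circ> k\<close> is the identity. Rotating its
  factors makes both angular derivatives 1, hence s is a rotation, and a positive angular derivative
  leaves only the trivial one.\<close>

lemma surj_selfmap_ang:
  assumes s: "selfmap s" and onto: "UHP \<subseteq> s ` UHP" and pos: "ang s > 0"
  shows "ang s = 1"
proof -
  obtain k where k: "k holomorphic_on s ` UHP" "\<And>z. z \<in> UHP \<Longrightarrow> k (s z) = z"
    using holomorphic_has_inverse[OF selfmapD(1)[OF s] open_UHP selfmapD(2)[OF s]] by metis
  have sk: "s (k z) = z \<and> k z \<in> UHP" if "z \<in> UHP" for z
  proof -
    obtain w where w: "z = s w" "w \<in> UHP" using subsetD[OF onto \<open>z \<in> UHP\<close>] by blast
    then show ?thesis using k(2)[OF w(2)] w by simp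
  qed
  have kk: "selfmap k"
    by (rule selfmap_if_inverse[where f=s])
       (use sk k(2)[OF i_in_UHP] holomorphic_on_subset[OF k(1) onto] selfmapD(4)[OF s] in auto)
  have "ang (s \<circ> k) = 1" using sk ang_id by (subst ang_cong[where g="\<lambda>z. z"]) auto
  then obtain \<zeta> where \<zeta>: "cmod \<zeta> = 1" "1 \<le> ang (s \<circ> rot (cnj \<zeta>)) * ang (rot \<zeta> \<circ> k)"
    using rotate_factorization[OF s kk, of 1] by auto
  have sm: "selfmap (s \<circ> rot (cnj \<zeta>))" "selfmap (rot \<zeta> \<circ> k)"
    using s kk \<zeta>(1) by (simp_all add: selfmap_comp selfmap_rot)
  have "1 \<le> ang (s \<circ> rot (cnj \<zeta>))"
    using \<zeta>(2) mult_left_mono[OF ang_le_1[OF sm(2)] ang_nonneg[OF sm(1)]] by simp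
  then have 1: "(s \<circ> rot (cnj \<zeta>)) z = z" if "Im z > 0" for z
    using ang_eq_1_imp_id[OF sm(1) _ that] by blast
  have 2: "s z = rot \<zeta> z" if "Im z > 0" for z
    using 1[OF rot_UHP[OF \<zeta>(1) that]] rot_cnj_rot[OF \<zeta>(1) that] by simp
  then have "ang s = ang (rot \<zeta>)" by (rule ang_cong)
  with pos have "\<zeta> = 1" using rot_eq_1_if_ang_pos[OF \<zeta>(1)] by simp
  then have "ang s = ang (\<lambda>z. z)" using 2 by (intro ang_cong) (simp add: rot_1)
  then show ?thesis by (simp add: ang_id)
qed

lemma rot_image_UHP: "cmod \<zeta> = 1 \<Longrightarrow> rot \<zeta> ` UHP = UHP"
proof (intro equalityI subsetI)
  assume \<zeta>: "cmod \<zeta> = 1"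
  show "z \<in> UHP" if "z \<in> rot \<zeta> ` UHP" for z using that \<zeta> by (auto simp: rot_UHP)
  show "z \<in> rot \<zeta> ` UHP" if "z \<in> UHP" for z
  proof
    show "z = rot \<zeta> (rot (cnj \<zeta>) z)" using rot_cnj_rot[of "cnj \<zeta>" z] \<zeta> that by simp
    show "rot (cnj \<zeta>) z \<in> UHP" using \<zeta> that by (simp add: rot_UHP)
  qed
qed

text \<open>The domain D lies strictly between the image of s, seen in the disc, and the disc
  itself. Both inclusions have to be strict: \<open>ang P = 1\<close> would make P the identity and
  D the whole disc, while \<open>ang Q = 1\<close> would make Q the identity and D equal to
  E.\<close>

lemma split_selfmap:
  assumes s: "selfmap s" and ang: "0 < ang s" "ang s < 1"
  obtains p q where "selfmap p" "selfmap q" "\<And>z. Im z > 0 \<Longrightarrow> s z = p (q z)"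
    "ang p * ang q = ang s" "ang p < 1" "ang q < 1"
proof -
  define f where "f = cayley \<i> \<circ> s"
  define E where "E = f ` UHP"
  have f_hol: "f holomorphic_on UHP"
    unfolding f_def using selfmapD[OF s]
    by (intro holomorphic_on_compose_gen[OF _ cayley_holomorphic]) auto
  have cay_inj: "inj_on (cayley \<i>) UHP"
    by (rule inj_on_inverseI[where g="inv_cayley \<i>"]) (simp add: inv_cayley_cayley)
  have f_inj: "inj_on f UHP"
    unfolding f_def using selfmapD[OF s]
    by (intro comp_inj_on selfmapD(2)[OF s] inj_on_subset[OF cay_inj]) auto
  obtain k where k: "k holomorphic_on E" "\<And>z. z \<in> UHP \<Longrightarrow> k (f z) = z"
    using holomorphic_has_inverse[OF f_hol open_UHP f_inj] unfolding E_def by metis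
  have f_ball: "f z \<in> ball 0 1" if "Im z > 0" for z
    unfolding f_def using selfmapD(3)[OF s that] by (simp add: cmod_cayley_less_1)
  have E_open: "open E" unfolding E_def by (rule open_mapping_thm3[OF f_hol open_UHP f_inj])
  have E_conn: "connected E" unfolding E_def
    by (rule connected_continuous_image[OF holomorphic_on_imp_continuous_on[OF f_hol] connected_UHP])
  have E_sub: "E \<subseteq> ball 0 1" unfolding E_def using f_ball by auto
  have f_i: "f \<i> = 0" using selfmapD(4)[OF s] by (simp add: f_def cayley_def)
  then have E0: "0 \<in> E" unfolding E_def by (metis i_in_UHP image_eqI)
  have inv_ball: "inv_cayley \<i> \<xi> \<in> UHP" if "\<xi> \<in> ball 0 1" for \<xi>
    using that by (simp add: inv_cayley_UHP)
  have "simply_connected E"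
    unfolding simply_connected_eq_biholomorphic_to_disc[OF E_open]
  proof (intro disjI2 exI conjI ballI)
    show "cayley \<i> \<circ> k holomorphic_on E"
      by (intro holomorphic_on_compose_gen[OF k(1) cayley_holomorphic]) (auto simp: E_def k)
    show "f \<circ> inv_cayley \<i> holomorphic_on ball 0 1"
      using inv_ball by (intro holomorphic_on_compose_gen[OF inv_cayley_holomorphic f_hol]) auto
  qed (auto simp: E_def k cmod_cayley_less_1 inv_cayley_cayley inv_cayley_UHP cayley_inv_cayley)
  then have E_compl: "connected (- E)"
    using simply_connected_iff_simple[OF E_open] bounded_subset[OF bounded_ball E_sub] by blast
  have E_ne: "E \<noteq> ball 0 1"
  proof
    assume E: "E = ball 0 1"
    have "UHP \<subseteq> s ` UHP"
    proof
      fix z assume z: "z \<in> UHP"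
      then have "cayley \<i> z \<in> E" using E by (simp add: cmod_cayley_less_1)
      then obtain w where w: "w \<in> UHP" "cayley \<i> z = cayley \<i> (s w)" unfolding E_def f_def by auto
      then have "z = s w" using cay_inj z selfmapD(3)[OF s] by (auto simp: inj_on_def)
      then show "z \<in> s ` UHP" using w by blast
    qed
    from surj_selfmap_ang[OF s this] ang show False by simp
  qed
  obtain D where D: "open D" "simply_connected D" "E \<subset> D" "D \<subset> ball 0 1"
    using disc_insert_domain[OF E_open E_conn _ E_compl] E0 E_sub E_ne by blast
  have "D \<noteq> {}" "D \<noteq> UNIV" using D E0 not_bounded_UNIV[where 'a=complex] bounded_ball[of "0::complex" 1]
    by auto
  then obtain F G where FG: "F holomorphic_on D" "G holomorphic_on ball 0 1"
      "\<And>z. z \<in> D \<Longrightarrow> F z \<in> ball 0 1 \<and> G (F z) = z" "\<And>z. z \<in> ball 0 1 \<Longrightarrow> G z \<in> D \<and> F (G z) = z"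
    using D(2) unfolding simply_connected_eq_biholomorphic_to_disc[OF D(1)] by metis
  define w where "w = inv_cayley \<i> (F 0)"
  have "0 \<in> D" using E0 D by blast
  then have F0: "F 0 \<in> ball 0 1" "G (F 0) = 0" using FG(3) by auto
  then have w: "Im w > 0" unfolding w_def using inv_ball by auto
  \<comment> \<open>The Riemann map F of D sends 0 to some point of the disc, which w represents in
    the half-plane. The affine map A takes \<i> to w, so that p fixes \<i>.\<close>
  define A where "A z = of_real (Re w) + of_real (Im w) * z" for z :: complex
  have A: "A holomorphic_on UHP" "\<And>z. Im z > 0 \<Longrightarrow> Im (A z) > 0" "A \<i> = w"
    using w by (auto simp: A_def[abs_def] complex_eq_iff intro!: holomorphic_intros)
  define p where "p = inv_cayley \<i> \<circ> G \<circ> cayley \<i> \<circ> A"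
  define pinv where "pinv x = (inv_cayley \<i> (F (cayley \<i> x)) - of_real (Re w)) / of_real (Im w)" for x
  have cayA: "cayley \<i> (A z) \<in> ball 0 1" if "Im z > 0" for z
    using A(2)[OF that] by (simp add: cmod_cayley_less_1)
  have Gball: "G \<xi> \<in> ball 0 1" if "\<xi> \<in> ball 0 1" for \<xi> using FG(4)[OF that] D(4) by blast
  have p_cay: "cayley \<i> (p z) = G (cayley \<i> (A z))" if "Im z > 0" for z
    unfolding p_def using Gball[OF cayA[OF that]] by (simp add: cayley_inv_cayley)
  have pinv: "pinv (p z) = z" if "Im z > 0" for z
  proof -
    have "inv_cayley \<i> (F (cayley \<i> (p z))) = A z"
      unfolding p_cay[OF that] using FG(4)[OF cayA[OF that]] A(2)[OF that] by (simp add: inv_cayley_cayley)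
    then show ?thesis using w by (simp add: pinv_def A_def)
  qed
  have p: "selfmap p"
    unfolding selfmap_def
  proof (intro conjI ballI)
    have "cayley \<i> \<circ> A holomorphic_on UHP"
      by (rule holomorphic_on_compose_gen[OF A(1) cayley_holomorphic]) (use A(2) in auto)
    then have "G \<circ> (cayley \<i> \<circ> A) holomorphic_on UHP"
      by (rule holomorphic_on_compose_gen[OF _ FG(2)]) (use cayA in auto)
    then have "inv_cayley \<i> \<circ> (G \<circ> (cayley \<i> \<circ> A)) holomorphic_on UHP"
      by (rule holomorphic_on_compose_gen[OF _ inv_cayley_holomorphic]) (use Gball cayA in auto)
    then show "p holomorphic_on UHP" by (simp only: p_def comp_assoc)
    show "inj_on p UHP" by (rule inj_on_inverseI[where g=pinv]) (simp add: pinv)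
    show "p z \<in> UHP" if "z \<in> UHP" for z
      unfolding p_def comp_def using that by (intro inv_ball Gball cayA) simp
    show "p \<i> = \<i>"
      unfolding p_def comp_def A(3) w_def using F0 by (simp add: cayley_inv_cayley) (simp add: inv_cayley_def)
  qed
  have p_image: "x \<in> p ` UHP" if x: "Im x > 0" "cayley \<i> x \<in> D" for x
  proof -
    define y where "y = inv_cayley \<i> (F (cayley \<i> x))"
    have "y \<in> UHP" unfolding y_def using FG(3)[OF x(2)] inv_ball by blast
    have cy: "cayley \<i> y = F (cayley \<i> x)"
      unfolding y_def using FG(3)[OF x(2)] by (simp add: cayley_inv_cayley)
    define z where "z = (y - of_real (Re w)) / of_real (Im w)"
    have "A z = y" using w by (simp add: A_def z_def)
    moreover have "z \<in> UHP" using w \<open>y \<in> UHP\<close> by (simp add: z_def Im_divide_of_real)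
    moreover have "p z = x" unfolding p_def comp_def \<open>A z = y\<close> cy
      using FG(3)[OF x(2)] x by (simp add: inv_cayley_cayley)
    ultimately show ?thesis by blast
  qed
  obtain h where h: "h holomorphic_on p ` UHP" "\<And>z. z \<in> UHP \<Longrightarrow> h (p z) = z"
    using holomorphic_has_inverse[OF selfmapD(1)[OF p] open_UHP selfmapD(2)[OF p]] by metis
  have s_in: "s z \<in> p ` UHP" if "z \<in> UHP" for z
  proof (rule p_image)
    show "Im (s z) > 0" using selfmapD(3)[OF s] that by simp
    have "cayley \<i> (s z) \<in> E" unfolding E_def f_def using that by auto
    then show "cayley \<i> (s z) \<in> D" using D(3) by blast
  qed
  define q where "q = h \<circ> s"
  have pq: "p (q z) = s z" and q_in: "q z \<in> UHP" if "z \<in> UHP" for z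
    using s_in[OF that] h(2) by (auto simp: q_def)
  have q: "selfmap q"
    unfolding selfmap_def
  proof (intro conjI ballI)
    show "q holomorphic_on UHP" unfolding q_def
      by (rule holomorphic_on_compose_gen[OF selfmapD(1)[OF s] h(1)]) (use s_in in auto)
    show "inj_on q UHP" using pq selfmapD(2)[OF s] by (metis inj_on_def)
    show "q \<i> = \<i>" using h(2)[OF i_in_UHP] selfmapD(4)[OF s] selfmapD(4)[OF p] by (simp add: q_def)
  qed (rule q_in)
  have "ang (p \<circ> q) = ang s" by (rule ang_cong) (simp add: pq)
  then obtain \<zeta> where \<zeta>: "cmod \<zeta> = 1" "ang s \<le> ang (p \<circ> rot (cnj \<zeta>)) * ang (rot \<zeta> \<circ> q)"
    using rotate_factorization[OF p q ang(1)] by auto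
  define P Q where "P = p \<circ> rot (cnj \<zeta>)" "Q = rot \<zeta> \<circ> q"
  have PQ: "selfmap P" "selfmap Q" unfolding P_Q_def using p q \<zeta>(1) by (simp_all add: selfmap_comp selfmap_rot)
  have sPQ: "s z = P (Q z)" if "Im z > 0" for z
    using that q_in[of z] by (simp add: P_Q_def rot_cnj_rot \<zeta>(1) pq)
  \<comment> \<open>Supermultiplicativity always gives this inequality; the choice of \<zeta>
    supplied the opposite one.\<close>
  have "ang P * ang Q \<le> ang (P \<circ> Q)" by (rule ang_comp_ge[OF PQ])
  also have "\<dots> = ang s" by (rule ang_cong) (simp add: sPQ)
  finally have "ang P * ang Q = ang s" using \<zeta>(2) unfolding P_Q_def by (rule antisym)
  have P_image: "P ` UHP = p ` UHP"
    using rot_image_UHP[of "cnj \<zeta>"] \<zeta>(1) by (simp only: P_Q_def image_comp[symmetric] complex_mod_cnj)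
  have p_D: "cayley \<i> (p z) \<in> D" if "Im z > 0" for z
    unfolding p_cay[OF that] using FG(4)[OF cayA[OF that]] by blast
  have "ang P < 1"
  proof (rule ccontr)
    assume "\<not> ang P < 1"
    then have id: "P z = z" if "Im z > 0" for z using ang_eq_1_imp_id[OF PQ(1) _ that] by simp
    have "\<xi> \<in> D" if "\<xi> \<in> ball 0 1" for \<xi>
    proof -
      have "inv_cayley \<i> \<xi> \<in> P ` UHP" using id[of "inv_cayley \<i> \<xi>"] inv_ball[OF that] by (intro image_eqI[where x="inv_cayley \<i> \<xi>"]) simp_all
      then obtain z where z: "z \<in> UHP" and eq: "inv_cayley \<i> \<xi> = p z" unfolding P_image by blast
      have "cayley \<i> (inv_cayley \<i> \<xi>) \<in> D" unfolding eq using p_D z by simp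
      then show ?thesis using that by (simp add: cayley_inv_cayley)
    qed
    then show False using D(4) by blast
  qed
  moreover have "ang Q < 1"
  proof (rule ccontr)
    assume "\<not> ang Q < 1"
    then have id: "Q z = z" if "Im z > 0" for z using ang_eq_1_imp_id[OF PQ(2) _ that] by simp
    have sP: "s z = P z" if "Im z > 0" for z using sPQ[OF that] unfolding id[OF that] .
    have "\<xi> \<in> E" if "\<xi> \<in> D" for \<xi>
    proof -
      have \<xi>: "\<xi> \<in> ball 0 1" using that D(4) by blast
      have "inv_cayley \<i> \<xi> \<in> p ` UHP"
      proof (rule p_image)
        show "Im (inv_cayley \<i> \<xi>) > 0" using inv_ball[OF \<xi>] by simp
        show "cayley \<i> (inv_cayley \<i> \<xi>) \<in> D" using \<xi> that by (simp add: cayley_inv_cayley)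
      qed
      then obtain z where z: "z \<in> UHP" and "inv_cayley \<i> \<xi> = P z" unfolding P_image[symmetric] by blast
      then have eq: "inv_cayley \<i> \<xi> = s z" using sP by simp
      have "f z = cayley \<i> (inv_cayley \<i> \<xi>)" unfolding f_def comp_def eq ..
      also have "\<dots> = \<xi>" using \<xi> by (simp add: cayley_inv_cayley)
      finally show ?thesis using z unfolding E_def by blast
    qed
    then show False using D(3) by blast
  qed
  ultimately show ?thesis using that PQ sPQ \<open>ang P * ang Q = ang s\<close> by blast
qed

section \<open>Factorization into maps with large angular derivative\<close>

text \<open>Schwarz--Pick against the fixed point \<i> confines f z to a hyperbolic disc about \<i>
  that depends on z only. This is the local boundedness for Montel.\<close>

lemma selfmap_norm_le:
  assumes f: "selfmap f" and z: "Im z > 0"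
  shows "cmod (f z) \<le> (cmod (z - \<i>))\<^sup>2 / Im z + 2"
proof -
  define q where "q = (cmod (z - \<i>))\<^sup>2 / Im z"
  have fz: "Im (f z) > 0" by (rule selfmapD(3)[OF f z])
  have "(cmod (f z - \<i>))\<^sup>2 * Im z \<le> (cmod (z - \<i>))\<^sup>2 * Im (f z)"
    using Schwarz_Pick_UHP[OF selfmapD(1,3)[OF f] z, of \<i>] selfmapD(4)[OF f] by simp
  then have "(cmod (f z - \<i>))\<^sup>2 \<le> q * Im (f z)" using z by (simp add: q_def field_simps)
  moreover have "(cmod (f z - \<i>))\<^sup>2 = (cmod (f z))\<^sup>2 - 2 * Im (f z) + 1"
    by (simp add: cmod_power2) (simp add: power2_eq_square algebra_simps)
  ultimately have "(cmod (f z))\<^sup>2 \<le> (q + 2) * Im (f z)" by (simp add: algebra_simps)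
  also have "\<dots> \<le> (q + 2) * cmod (f z)"
    using z abs_Im_le_cmod[of "f z"] by (intro mult_left_mono) (auto simp: q_def)
  finally have "cmod (f z) * cmod (f z) \<le> (q + 2) * cmod (f z)" by (simp add: power2_eq_square)
  moreover have "cmod (f z) > 0" using fz by auto
  ultimately show ?thesis by (simp add: q_def)
qed

lemma ang_limit:
  assumes fs: "\<And>n. selfmap (fs n)" and lim: "\<And>z. Im z > 0 \<Longrightarrow> (\<lambda>n. fs n z) \<longlonglongrightarrow> f z"
    and ang: "(\<lambda>n. ang (fs n)) \<longlonglongrightarrow> \<alpha>"
  shows "\<alpha> \<le> ang f"
proof (rule ang_ge)
  fix z assume z: "Im z > 0"
  have "(\<lambda>n. ang (fs n) * Im z) \<longlonglongrightarrow> \<alpha> * Im z" "(\<lambda>n. Im (fs n z)) \<longlonglongrightarrow> Im (f z)"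
    by (intro tendsto_intros ang lim z)+
  then show "\<alpha> * Im z \<le> Im (f z)"
    by (rule LIMSEQ_le) (use selfmap_ang[OF fs z] in blast)
qed

text \<open>The lower bound c excludes degenerate limits: it keeps the limit g inside the half-plane
  and makes it nonconstant, as Hurwitz demands.\<close>

lemma selfmap_subsequence:
  assumes fs: "\<And>n. selfmap (fs n)" and c: "c > 0" "\<And>n. c \<le> ang (fs n)"
  obtains g r where "selfmap g" "strict_mono (r :: nat \<Rightarrow> nat)"
    "\<And>z. Im z > 0 \<Longrightarrow> (\<lambda>n. fs (r n) z) \<longlonglongrightarrow> g z"
    "\<And>K. compact K \<Longrightarrow> K \<subseteq> UHP \<Longrightarrow> uniform_limit K (fs \<circ> r) g sequentially"
proof -
  obtain g r where g: "g holomorphic_on UHP" "strict_mono (r :: nat \<Rightarrow> nat)"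
    "\<And>z. z \<in> UHP \<Longrightarrow> ((\<lambda>n. fs (r n) z) \<longlongrightarrow> g z) sequentially"
    "\<And>K. compact K \<Longrightarrow> K \<subseteq> UHP \<Longrightarrow> uniform_limit K (fs \<circ> r) g sequentially"
  proof (rule Montel[of UHP "range fs" fs])
    show "\<exists>B. \<forall>h\<in>range fs. \<forall>z\<in>K. cmod (h z) \<le> B" if K: "compact K" "K \<subseteq> UHP" for K
    proof -
      have "continuous_on K (\<lambda>z. (cmod (z - \<i>))\<^sup>2 / Im z + 2)"
        using K(2) by (intro continuous_intros) auto
      then have "bounded ((\<lambda>z. (cmod (z - \<i>))\<^sup>2 / Im z + 2) ` K)"
        using K(1) by (intro compact_imp_bounded compact_continuous_image)
      then obtain B where B: "\<And>z. z \<in> K \<Longrightarrow> \<bar>(cmod (z - \<i>))\<^sup>2 / Im z + 2\<bar> \<le> B"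
        unfolding bounded_real by blast
      have "cmod (fs n z) \<le> B" if z: "z \<in> K" for n z
      proof -
        have "Im z > 0" using K(2) z by auto
        then show ?thesis using selfmap_norm_le[OF fs, of z n] B[OF z] by linarith
      qed
      then show ?thesis by blast
    qed
  qed (use selfmapD(1)[OF fs] open_UHP in auto)
  have Im_g: "c * Im z \<le> Im (g z)" if z: "Im z > 0" for z
  proof (rule LIMSEQ_le_const[OF tendsto_Im[OF g(3)]])
    have "c * Im z \<le> Im (fs (r n) z)" for n
      using mult_right_mono[OF c(2), of "Im z" "r n"] selfmap_ang[OF fs z, of "r n"] z by linarith
    then show "\<exists>N. \<forall>n\<ge>N. c * Im z \<le> Im (fs (r n) z)" by blast
  qed (use z in simp)
  have g_i: "g \<i> = \<i>"
    using g(3)[OF i_in_UHP] selfmapD(4)[OF fs] by (simp add: tendsto_const_iff)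
  have nonconst: "\<not> g constant_on UHP"
  proof
    assume "g constant_on UHP"
    then have const: "g z = \<i>" if "Im z > 0" for z
      using that g_i i_in_UHP unfolding constant_on_def by (metis UHP_iff)
    \<comment> \<open>Then c y = 1 + c exceeds Im \<i> = 1, which a map with constant value \<i>
      cannot satisfy.\<close>
    define y where "y = 1 / c + 1"
    have "y > 0" "c * y > 1" using c(1) by (auto simp: y_def field_simps intro: add_pos_pos)
    then show False using Im_g[of "\<i> * of_real y"] const[of "\<i> * of_real y"] by simp
  qed
  have "inj_on g UHP"
    by (rule Hurwitz_injective[where \<F>="fs \<circ> r"])
       (use g nonconst selfmapD(1,2)[OF fs] open_UHP connected_UHP in \<open>auto simp: comp_def\<close>)
  moreover have "Im (g z) > 0" if "Im z > 0" for z
    using Im_g[OF that] mult_pos_pos[OF c(1) that] by linarith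
  ultimately have "selfmap g" using g(1) g_i by (simp add: selfmap_def)
  then show ?thesis using that g by auto
qed

text \<open>For limits of compositions of two convergent sequences of maps: the argument moves
  together with the outer map, so pointwise convergence of the latter would not suffice.\<close>

lemma uniform_limit_tendsto_compose:
  fixes f :: "nat \<Rightarrow> complex \<Rightarrow> complex"
  assumes ul: "\<And>K. compact K \<Longrightarrow> K \<subseteq> S \<Longrightarrow> uniform_limit K f g sequentially"
    and S: "open S" "continuous_on S g" and w: "w \<longlonglongrightarrow> w0" "w0 \<in> S"
  shows "(\<lambda>n. f n (w n)) \<longlonglongrightarrow> g w0"
proof -
  obtain e where e: "e > 0" "cball w0 e \<subseteq> S" using S(1) w(2) open_contains_cball by blast
  have ev: "\<forall>\<^sub>F n in sequentially. w n \<in> cball w0 e"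
    using tendstoD[OF w(1) e(1)] by eventually_elim (simp add: dist_commute)
  have "uniform_limit (cball w0 e) f g sequentially" using e(2) by (intro ul) auto
  then have "(\<lambda>n. dist (f n (w n)) (g (w n))) \<longlonglongrightarrow> 0"
    unfolding tendsto_iff uniform_limit_iff dist_real_def
  proof (intro allI impI)
    fix \<epsilon> :: real assume *: "\<forall>\<epsilon>>0. \<forall>\<^sub>F n in sequentially. \<forall>x\<in>cball w0 e. dist (f n x) (g x) < \<epsilon>" "\<epsilon> > 0"
    from ev *(1)[rule_format, OF *(2)]
    show "\<forall>\<^sub>F n in sequentially. \<bar>dist (f n (w n)) (g (w n)) - 0\<bar> < \<epsilon>"
      by eventually_elim simp
  qed
  then have "(\<lambda>n. f n (w n) - g (w n)) \<longlonglongrightarrow> 0"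
    unfolding dist_norm by (rule tendsto_norm_zero_cancel)
  moreover have "(\<lambda>n. g (w n)) \<longlonglongrightarrow> g w0"
    using S w by (simp add: continuous_on_eq_continuous_at isCont_tendsto_compose)
  ultimately show ?thesis by (rule Lim_transform[rotated])
qed

text \<open>If \<open>ang f > 0\<close>, the last conjunct excludes spurious splittings through a
  nontrivial rotation, whose angular derivative is 0.\<close>

definition factors :: "(complex \<Rightarrow> complex) \<Rightarrow> (complex \<Rightarrow> complex) \<Rightarrow> (complex \<Rightarrow> complex) \<Rightarrow> bool" where
  "factors f g h \<longleftrightarrow> selfmap g \<and> selfmap h \<and> (\<forall>z\<in>UHP. f z = g (h z)) \<and> ang g * ang h = ang f"

lemma factorsD:
  assumes "factors f g h"
  shows "selfmap g" "selfmap h" "\<And>z. Im z > 0 \<Longrightarrow> f z = g (h z)" "ang g * ang h = ang f"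
  using assms by (auto simp: factors_def)

lemma factors_ang_bounds:
  assumes "factors f g h" "ang f > 0"
  shows "ang f \<le> ang g" "ang g \<le> 1" "ang f \<le> ang h" "ang h \<le> 1" "ang g > 0" "ang h > 0"
proof -
  note F = factorsD[OF assms(1)]
  note A = ang_nonneg[OF F(1)] ang_nonneg[OF F(2)] ang_le_1[OF F(1)] ang_le_1[OF F(2)]
  show g: "ang f \<le> ang g" using F(4) mult_left_mono[OF A(4) A(1)] by simp
  show h: "ang f \<le> ang h" using F(4) mult_right_mono[OF A(3) A(2)] by simp
  show "ang g \<le> 1" "ang h \<le> 1" by (fact A)+
  show "ang g > 0" "ang h > 0" using g h assms(2) by linarith+
qed

lemma factors_compI:
  assumes "selfmap g" "selfmap h" "\<And>z. Im z > 0 \<Longrightarrow> f z = g (h z)" "ang f \<le> ang g * ang h"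
  shows "factors f g h"
proof -
  have "ang g * ang h \<le> ang (g \<circ> h)" by (rule ang_comp_ge[OF assms(1,2)])
  also have "\<dots> = ang f" by (rule ang_cong) (simp add: assms(3))
  finally show ?thesis using assms by (auto simp: factors_def)
qed

text \<open>For the limit of a sequence of factorizations, semicontinuity only gives lower bounds for both
  angular derivatives; equality follows since their product cannot exceed \<open>ang f\<close>.\<close>

lemma compact_factor_angs:
  assumes f: "ang f > 0"
  shows "compact {ang g |g h. factors f g h}" (is "compact ?A")
  unfolding compact_eq_bounded_closed
proof
  have "?A \<subseteq> {0..1}" using factors_ang_bounds(2,5)[OF _ f] by (fastforce intro: less_imp_le)
  then show "bounded ?A" by (rule bounded_subset[OF bounded_closed_interval])
  show "closed ?A"
    unfolding closed_sequential_limits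
  proof (intro allI impI, elim conjE)
    fix x \<alpha> assume "\<forall>n. x n \<in> ?A" and x: "x \<longlonglongrightarrow> \<alpha>"
    then have "\<forall>n. \<exists>g h. x n = ang g \<and> factors f g h" by blast
    then obtain g h where gh: "\<And>n. x n = ang (g n)" "\<And>n. factors f (g n) (h n)" by metis
    note F = factorsD[OF gh(2)] and bd = factors_ang_bounds[OF gh(2) f]
    obtain G r where G: "selfmap G" "strict_mono r"
      "\<And>z. Im z > 0 \<Longrightarrow> (\<lambda>n. g (r n) z) \<longlonglongrightarrow> G z"
      "\<And>K. compact K \<Longrightarrow> K \<subseteq> UHP \<Longrightarrow> uniform_limit K (g \<circ> r) G sequentially"
      using selfmap_subsequence[of g, OF F(1) f bd(1)] by metis
    obtain H s where H: "selfmap H" "strict_mono s"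
      "\<And>z. Im z > 0 \<Longrightarrow> (\<lambda>n. h (r (s n)) z) \<longlonglongrightarrow> H z"
      using selfmap_subsequence[of "\<lambda>n. h (r n)", OF F(2) f bd(3)] by metis
    have rs: "strict_mono (\<lambda>n. r (s n))" using strict_mono_o[OF G(2) H(2)] by (simp add: comp_def)
    have fGH: "f z = G (H z)" if z: "Im z > 0" for z
    proof -
      have ul: "uniform_limit K (\<lambda>n. g (r (s n))) G sequentially" if "compact K" "K \<subseteq> UHP" for K
        using filterlim_compose[OF G(4)[OF that] filterlim_subseq[OF H(2)]] by (simp add: comp_def)
      have "(\<lambda>n. g (r (s n)) (h (r (s n)) z)) \<longlonglongrightarrow> G (H z)"
        by (rule uniform_limit_tendsto_compose[OF ul open_UHP])
           (use H(3)[OF z] selfmapD(3)[OF H(1) z] holomorphic_on_imp_continuous_on[OF selfmapD(1)[OF G(1)]] in auto)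
      then show ?thesis using F(3)[OF z] by (simp add: LIMSEQ_const_iff)
    qed
    have ag: "(\<lambda>n. ang (g n)) \<longlonglongrightarrow> \<alpha>" using x by (simp add: gh(1)[symmetric])
    have \<alpha>: "ang f \<le> \<alpha>" by (rule LIMSEQ_le_const[OF ag]) (use bd(1) in blast)
    \<comment> \<open>The cofactor's angular derivative is a continuous function of that of g, so it
      converges along with it.\<close>
    have "ang h = ang f / ang g" if "factors f g h" for g h
      using factorsD(4)[OF that] factors_ang_bounds(5)[OF that f] by (simp add: field_simps)
    then have "ang (h n) = ang f / ang (g n)" for n using gh(2) by blast
    then have ah: "(\<lambda>n. ang (h n)) \<longlonglongrightarrow> ang f / \<alpha>"
      using \<alpha> f by (auto intro!: tendsto_intros ag)
    have "\<alpha> \<le> ang G"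
      by (rule ang_limit[where fs="\<lambda>n. g (r n)"])
         (use F(1) G(3) LIMSEQ_subseq_LIMSEQ[OF ag G(2)] in \<open>auto simp: comp_def\<close>)
    moreover have "ang f / \<alpha> \<le> ang H"
      by (rule ang_limit[where fs="\<lambda>n. h (r (s n))"])
         (use F(2) H(3) LIMSEQ_subseq_LIMSEQ[OF ah rs] in \<open>auto simp: comp_def\<close>)
    moreover have pos: "\<alpha> > 0" "ang f / \<alpha> > 0" using \<alpha> f by auto
    ultimately have le: "\<alpha> * (ang f / \<alpha>) \<le> ang G * ang H" by (intro mult_mono) auto
    have fac: "factors f G H"
      by (rule factors_compI[OF G(1) H(1) fGH]) (use le pos in auto)
    have "ang G * (ang f / \<alpha>) \<le> ang G * ang H"
      using \<open>ang f / \<alpha> \<le> ang H\<close> ang_nonneg[OF G(1)] by (rule mult_left_mono)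
    also have "\<dots> = ang f" by (rule factorsD(4)[OF fac])
    finally have "ang G \<le> \<alpha>" using pos f by (simp add: field_simps)
    then have "\<alpha> = ang G" using \<open>\<alpha> \<le> ang G\<close> by simp
    then show "\<alpha> \<in> ?A" using fac by blast
  qed
qed

lemma factors_id: "selfmap f \<Longrightarrow> factors f (\<lambda>z. z) f" "selfmap f \<Longrightarrow> factors f f (\<lambda>z. z)"
  by (auto simp: factors_def selfmap_id ang_id)

text \<open>Among the left factors g with \<open>ang g \<ge> sqrt (ang f)\<close> take a smallest one, and then split off
  the largest admissible left factor s of the cofactor. If s were nontrivial it could be split
  further, contradicting one of the two extremal choices.\<close>

lemma sqrt_factorization:
  assumes f: "selfmap f" "ang f > 0"
  obtains g h where "factors f g h" "ang g = sqrt (ang f)" "ang h = sqrt (ang f)"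
proof -
  define t where "t = sqrt (ang f)"
  have t: "t > 0" "t \<le> 1" "t * t = ang f" "ang f \<le> t"
  proof -
    show "t > 0" "t \<le> 1" "t * t = ang f" using f ang_le_1[OF f(1)] by (auto simp: t_def)
    then show "ang f \<le> t" using mult_left_mono[of t 1 t] by simp
  qed
  have "compact ({ang g |g h. factors f g h} \<inter> {t..})"
    by (intro compact_Int_closed compact_factor_angs f) auto
  moreover have "1 \<in> {ang g |g h. factors f g h} \<inter> {t..}"
    using factors_id(1)[OF f(1)] ang_id t by force
  ultimately obtain g h where gh: "factors f g h" "t \<le> ang g"
    and min: "\<And>g' h'. factors f g' h' \<Longrightarrow> t \<le> ang g' \<Longrightarrow> ang g \<le> ang g'"
    using compact_attains_inf[of "{ang g |g h. factors f g h} \<inter> {t..}"] by blast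
  note bd = factors_ang_bounds[OF gh(1) f(2)] and F = factorsD[OF gh(1)]
  \<comment> \<open>The bound on \<open>ang s\<close> means \<open>ang g * ang s \<le> t\<close>:
    appending s to g reaches or crosses the threshold t. h itself qualifies, as
    \<open>ang g * ang h = t * t \<le> t\<close>.\<close>
  have "compact ({ang s |s k. factors h s k} \<inter> {..t / ang g})"
    by (intro compact_Int_closed compact_factor_angs bd) auto
  moreover have "ang h \<le> t / ang g" using F(4) bd t by (simp add: field_simps)
  then have "ang h \<in> {ang s |s k. factors h s k} \<inter> {..t / ang g}"
    using factors_id(2)[OF F(2)] by blast
  ultimately obtain s k where sk: "factors h s k" "ang s \<le> t / ang g"
    and max: "\<And>s' k'. factors h s' k' \<Longrightarrow> ang s' \<le> t / ang g \<Longrightarrow> ang s' \<le> ang s"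
    using compact_attains_sup[of "{ang s |s k. factors h s k} \<inter> {..t / ang g}"] by blast
  note bd' = factors_ang_bounds[OF sk(1) bd(6)] and F' = factorsD[OF sk(1)]
  have "\<not> ang s < 1"
  proof
    assume "ang s < 1"
    then obtain p q where pq: "selfmap p" "selfmap q" "\<And>z. Im z > 0 \<Longrightarrow> s z = p (q z)"
      "ang p * ang q = ang s" "ang p < 1" "ang q < 1"
      using split_selfmap[OF F'(1) bd'(5)] by metis
    have pos: "ang p > 0" "ang q > 0"
      using bd'(5) ang_nonneg[OF pq(1)] ang_nonneg[OF pq(2)] unfolding pq(4)[symmetric]
      by (auto simp: zero_less_mult_iff)
    have hz: "h z = p (q (k z))" if "Im z > 0" for z
      using F'(3)[OF that] pq(3)[OF selfmapD(3)[OF F'(2) that]] by simp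
    have ge: "ang g * ang p \<le> ang (g \<circ> p)" "ang q * ang k \<le> ang (q \<circ> k)"
      by (intro ang_comp_ge F pq F')+
    have sm: "selfmap (g \<circ> p)" "selfmap (q \<circ> k)" by (intro selfmap_comp F pq F')+
    have "ang f = (ang g * ang p) * (ang q * ang k)"
      unfolding F(4)[symmetric] F'(4)[symmetric] pq(4)[symmetric] by (simp only: mult_ac)
    also have "\<dots> \<le> ang (g \<circ> p) * ang (q \<circ> k)"
      by (intro mult_mono ge) (use pos bd bd' in \<open>auto intro: ang_nonneg sm\<close>)
    finally have fac: "factors f (g \<circ> p) (q \<circ> k)"
      by (intro factors_compI sm) (use F(3) hz in auto)
    have "ang h = ang p * (ang q * ang k)" unfolding F'(4)[symmetric] pq(4)[symmetric] by (simp only: mult_ac)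
    also have "\<dots> \<le> ang p * ang (q \<circ> k)" using pos by (intro mult_left_mono ge) auto
    finally have fac': "factors h p (q \<circ> k)"
      by (intro factors_compI sm pq) (use hz in auto)
    \<comment> \<open>Either p alone already crosses the threshold, and then it beats the maximal s
      since \<open>ang q < 1\<close>; or \<open>g \<circ> p\<close> stays above it, and then it
      beats the minimal g since \<open>ang p < 1\<close>.\<close>
    show False
    proof (cases "ang p \<le> t / ang g")
      case True
      then have "ang p \<le> ang s" by (rule max[OF fac'])
      also have "\<dots> < ang p"
        using mult_strict_left_mono[OF pq(6) pos(1)] unfolding pq(4) by simp
      finally show False by simp
    next
      case False
      then have "t \<le> ang g * ang p" using bd(5) by (simp add: field_simps)
      then have "ang g \<le> ang (g \<circ> p)" using ge(1) by (intro min[OF fac]) linarith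
      moreover have "ang (g \<circ> p) \<le> ang g * ang p"
      proof -
        have "ang (g \<circ> p) * (ang q * ang k) \<le> ang (g \<circ> p) * ang (q \<circ> k)"
          by (intro mult_left_mono ge ang_nonneg sm)
        also have "\<dots> = (ang g * ang p) * (ang q * ang k)"
          using factorsD(4)[OF fac] \<open>ang f = (ang g * ang p) * (ang q * ang k)\<close> by simp
        finally show ?thesis using pos bd' by simp
      qed
      ultimately show False using pq(5) bd(5) mult_strict_left_mono[of "ang p" 1 "ang g"] by linarith
    qed
  qed
  then have "ang s = 1" using bd'(2) by simp
  then have "ang g \<le> t" using sk(2) bd(5) by (simp add: field_simps)
  then have "ang g = t" using gh(2) by simp
  moreover from this have "ang h = t" using F(4) t(1) by (simp flip: t(3))
  ultimately show ?thesis using that gh(1) by (simp add: t_def)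
qed

lemma foldr_comp_append: "foldr (\<circ>) (xs @ ys) id = foldr (\<circ>) xs id \<circ> foldr (\<circ>) ys id"
  by (induction xs) (auto simp: comp_assoc)

lemma power_two_factorization:
  assumes "selfmap f" "ang f > 0"
  shows "\<exists>hs. length hs = 2 ^ m \<and> (\<forall>h\<in>set hs. selfmap h \<and> ang h = ang f powr (1 / 2 ^ m)) \<and>
    (\<forall>z\<in>UHP. f z = foldr (\<circ>) hs id z)"
  using assms
proof (induction m arbitrary: f)
  case 0
  then show ?case by (intro exI[of _ "[f]"]) auto
next
  case (Suc m)
  obtain g h where gh: "factors f g h" "ang g = sqrt (ang f)" "ang h = sqrt (ang f)"
    using sqrt_factorization[OF Suc.prems] by blast
  note F = factorsD[OF gh(1)]
  have pos: "ang g > 0" "ang h > 0" using gh Suc.prems by auto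
  have pw: "sqrt (ang f) powr (1 / 2 ^ m) = ang f powr (1 / 2 ^ Suc m)"
    using Suc.prems by (simp add: powr_half_sqrt[symmetric] powr_powr)
  obtain xs ys where xs: "length xs = 2 ^ m" "\<forall>h\<in>set xs. selfmap h \<and> ang h = ang f powr (1 / 2 ^ Suc m)"
      "\<forall>z\<in>UHP. g z = foldr (\<circ>) xs id z"
    and ys: "length ys = 2 ^ m" "\<forall>h\<in>set ys. selfmap h \<and> ang h = ang f powr (1 / 2 ^ Suc m)"
      "\<forall>z\<in>UHP. h z = foldr (\<circ>) ys id z"
    using Suc.IH[OF F(1) pos(1)] Suc.IH[OF F(2) pos(2)] unfolding gh(2,3) pw by blast
  have fz: "f z = foldr (\<circ>) (xs @ ys) id z" if "z \<in> UHP" for z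
  proof -
    have "h z \<in> UHP" using selfmapD(3)[OF F(2)] that by simp
    then show ?thesis
      using xs(3) ys(3) F(3)[of z] that unfolding foldr_comp_append comp_def by simp
  qed
  show ?case
  proof (intro exI[of _ "xs @ ys"] conjI)
    show "\<forall>z\<in>UHP. f z = foldr (\<circ>) (xs @ ys) id z" using fz by blast
  qed (use xs ys in auto)
qed

section \<open>Cauchy transforms of finite measures\<close>

lemma cmod_kernel_ge: "Im z > 0 \<Longrightarrow> Im z \<le> cmod (z - complex_of_real x)"
  using abs_Im_le_cmod[of "z - complex_of_real x"] by simp

lemma kernel_nonzero: "Im z > 0 \<Longrightarrow> z - complex_of_real x \<noteq> 0"
  by (auto simp: complex_eq_iff)

lemma cmod_inverse_kernel_le: "Im z > 0 \<Longrightarrow> cmod (1 / (z - complex_of_real x)) \<le> 1 / Im z"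
  using cmod_kernel_ge[of z x] by (simp add: norm_divide frac_le)

lemma Im_kernel: "Im (1 / (z - complex_of_real x)) = - Im z * (cmod (1 / (z - complex_of_real x)))\<^sup>2"
  by (simp add: Im_divide cmod_power2 norm_divide power_divide)


context finite_borel_measure
begin

lemmas [measurable_cong] = M_is_borel

lemma space_M_UNIV: "space M = UNIV"
  using sets_eq_imp_space_eq[OF M_is_borel] by simp

lemma integrable_kernel: "Im z > 0 \<Longrightarrow> integrable M (\<lambda>x. 1 / (z - complex_of_real x))"
  by (rule integrable_const_bound[where B="1 / Im z"]) (auto simp: cmod_inverse_kernel_le)

lemma integrable_kernel_sq: "Im z > 0 \<Longrightarrow> integrable M (\<lambda>x. (cmod (1 / (z - complex_of_real x)))\<^sup>2)"
proof (rule integrable_const_bound[where B="(1 / Im z)\<^sup>2"])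
  assume z: "Im z > 0"
  have "(cmod (1 / (z - complex_of_real x)))\<^sup>2 \<le> (1 / Im z)\<^sup>2" for x
    using cmod_inverse_kernel_le[OF z] by (intro power_mono) auto
  then show "AE x in M. norm ((cmod (1 / (z - complex_of_real x)))\<^sup>2) \<le> (1 / Im z)\<^sup>2"
    by simp
qed measurable

lemma integrable_kernel_product:
  assumes "Im z > 0" "Im w > 0"
  shows "integrable M (\<lambda>x. 1 / (z - complex_of_real x) * (1 / (w - complex_of_real x)))"
proof (rule integrable_const_bound[where B="1 / Im z * (1 / Im w)"])
  show "AE x in M. cmod (1 / (z - complex_of_real x) * (1 / (w - complex_of_real x))) \<le> 1 / Im z * (1 / Im w)"
    using cmod_inverse_kernel_le assms unfolding norm_mult by (intro AE_I2 mult_mono) auto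
qed measurable

lemma cmod_cauchy_le:
  assumes z: "Im z > 0" shows "cmod (cauchy_transform M z) \<le> measure M UNIV / Im z"
proof -
  have "cmod (cauchy_transform M z) \<le> (\<integral>x. cmod (1 / (z - complex_of_real x)) \<partial>M)"
    unfolding cauchy_transform_def by (rule integral_norm_bound)
  also have "\<dots> \<le> (\<integral>x. 1 / Im z \<partial>M)"
    using integrable_norm[OF integrable_kernel[OF z]] cmod_inverse_kernel_le[OF z]
    by (intro integral_mono) auto
  finally show ?thesis by (simp add: space_M_UNIV)
qed

lemma Im_cauchy:
  assumes z: "Im z > 0"
  shows "Im (cauchy_transform M z) = - Im z * (\<integral>x. (cmod (1 / (z - complex_of_real x)))\<^sup>2 \<partial>M)"
proof -
  have "Im (cauchy_transform M z) = (\<integral>x. Im (1 / (z - complex_of_real x)) \<partial>M)"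
    unfolding cauchy_transform_def by (rule integral_Im[symmetric, OF integrable_kernel[OF z]])
  also have "\<dots> = (\<integral>x. - Im z * (cmod (1 / (z - complex_of_real x)))\<^sup>2 \<partial>M)"
    by (simp only: Im_kernel)
  also have "\<dots> = - Im z * (\<integral>x. (cmod (1 / (z - complex_of_real x)))\<^sup>2 \<partial>M)"
    by (rule integral_mult_right_zero)
  finally show ?thesis .
qed

lemma cauchy_diff:
  assumes z: "Im z > 0" and w: "Im w > 0"
  shows "cauchy_transform M z - cauchy_transform M w =
    (w - z) * (\<integral>x. 1 / (z - complex_of_real x) * (1 / (w - complex_of_real x)) \<partial>M)"
proof -
  have "cauchy_transform M z - cauchy_transform M w =
      (\<integral>x. 1 / (z - complex_of_real x) - 1 / (w - complex_of_real x) \<partial>M)"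
    unfolding cauchy_transform_def by (simp add: integrable_kernel z w)
  also have "\<dots> = (\<integral>x. (w - z) * (1 / (z - complex_of_real x) * (1 / (w - complex_of_real x))) \<partial>M)"
    using kernel_nonzero[OF z] kernel_nonzero[OF w]
    by (intro Bochner_Integration.integral_cong) (auto simp: field_simps)
  also have "\<dots> = (w - z) * (\<integral>x. 1 / (z - complex_of_real x) * (1 / (w - complex_of_real x)) \<partial>M)"
    by (rule integral_mult_right_zero)
  finally show ?thesis .
qed

lemma cmod_integral_le_const:
  fixes f :: "real \<Rightarrow> complex"
  assumes "f \<in> borel_measurable borel" "\<And>x. cmod (f x) \<le> B"
  shows "cmod (\<integral>x. f x \<partial>M) \<le> B * measure M UNIV"
proof -
  have [measurable]: "f \<in> borel_measurable M" using assms(1) by simp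
  have int: "integrable M f" by (rule integrable_const_bound[where B=B]) (use assms in auto)
  have "cmod (\<integral>x. f x \<partial>M) \<le> (\<integral>x. cmod (f x) \<partial>M)" by (rule integral_norm_bound)
  also have "\<dots> \<le> (\<integral>x. B \<partial>M)"
    using assms(2) by (intro integral_mono integrable_norm int) auto
  finally show ?thesis by (simp add: space_M_UNIV mult.commute)
qed

text \<open>By the resolvent identity the difference quotient is minus the integral of a product of
  two kernels; it remains to let w tend to z in that integral, where the kernels are
  bounded.\<close>

lemma cauchy_has_derivative:
  assumes z: "Im z > 0"
  shows "(cauchy_transform M has_field_derivative
    - (\<integral>x. 1 / (z - complex_of_real x) * (1 / (z - complex_of_real x)) \<partial>M)) (at z)"
proof -
  define k where "k w x = 1 / (w - complex_of_real x)" for w x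
  have [measurable]: "k w \<in> borel_measurable borel" for w unfolding k_def[abs_def] by measurable
  define Q where "Q w = (\<integral>x. k w x * k z x \<partial>M)" for w
  have k_le: "cmod (k w x) \<le> 1 / Im w" if "Im w > 0" for w x
    unfolding k_def by (rule cmod_inverse_kernel_le[OF that])
  have k_int: "integrable M (\<lambda>x. k w x * k z x)" if "Im w > 0" for w
    unfolding k_def using integrable_kernel_product[OF that z] .
  have Q_diff: "cmod (Q w - Q z) \<le> cmod (z - w) * (1 / Im w * (1 / Im z) * (1 / Im z)) * measure M UNIV"
    if w: "Im w > 0" for w
  proof -
    have "Q w - Q z = (\<integral>x. k w x * k z x - k z x * k z x \<partial>M)"
      unfolding Q_def by (simp add: k_int w z)
    also have "\<dots> = (\<integral>x. (z - w) * (k w x * k z x * k z x) \<partial>M)"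
    proof (intro Bochner_Integration.integral_cong refl)
      fix x
      have "k w x - k z x = (z - w) * (k w x * k z x)"
        using kernel_nonzero[OF z] kernel_nonzero[OF w] unfolding k_def by (simp add: field_simps)
      then show "k w x * k z x - k z x * k z x = (z - w) * (k w x * k z x * k z x)"
        by (simp only: left_diff_distrib[symmetric] mult.assoc)
    qed
    finally have eq: "Q w - Q z = (\<integral>x. (z - w) * (k w x * k z x * k z x) \<partial>M)" .
    have "cmod ((z - w) * (k w x * k z x * k z x))
        \<le> cmod (z - w) * (1 / Im w * (1 / Im z) * (1 / Im z))" for x
      unfolding norm_mult using z w by (intro mult_mono k_le mult_nonneg_nonneg) auto
    then show ?thesis unfolding eq by (intro cmod_integral_le_const) auto
  qed
  have "((\<lambda>w. cmod (z - w) * (1 / Im w * (1 / Im z) * (1 / Im z)) * measure M UNIV) \<longlongrightarrow>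
      cmod (z - z) * (1 / Im z * (1 / Im z) * (1 / Im z)) * measure M UNIV) (at z)"
    using z by (intro tendsto_intros) auto
  then have lim0: "((\<lambda>w. cmod (z - w) * (1 / Im w * (1 / Im z) * (1 / Im z)) * measure M UNIV) \<longlongrightarrow> 0) (at z)"
    by simp
  have ev: "\<forall>\<^sub>F w in at z. w \<in> UHP"
    using z open_UHP by (intro eventually_at_in_open') auto
  have "((\<lambda>w. Q w - Q z) \<longlongrightarrow> 0) (at z)"
    by (rule Lim_null_comparison[OF _ lim0]) (use ev in eventually_elim, use Q_diff in simp)
  then have "(Q \<longlongrightarrow> Q z) (at z)" by (simp add: LIM_zero_iff)
  then have "((\<lambda>w. - Q w) \<longlongrightarrow> - Q z) (at z)" by (rule tendsto_minus)
  moreover have "\<forall>\<^sub>F w in at z. - Q w = (cauchy_transform M w - cauchy_transform M z) / (w - z)"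
    using ev eventually_neq_at_within[of z z UNIV]
  proof eventually_elim
    case (elim w)
    have "cauchy_transform M w - cauchy_transform M z = (z - w) * Q w"
      unfolding Q_def k_def using elim z by (intro cauchy_diff) auto
    then show ?case using elim by (simp add: field_simps)
  qed
  ultimately have "((\<lambda>w. (cauchy_transform M w - cauchy_transform M z) / (w - z)) \<longlongrightarrow> - Q z) (at z)"
    by (rule Lim_transform_eventually)
  then show ?thesis by (simp add: has_field_derivative_iff Q_def k_def)
qed

lemma cauchy_holomorphic: "cauchy_transform M holomorphic_on UHP"
  unfolding holomorphic_on_open[OF open_UHP] by (intro ballI exI, rule cauchy_has_derivative) simp

text \<open>Cauchy--Schwarz against the constant function, obtained by expanding the integral of |m
  f - A|^2. The total mass m stays general, because the measures built from shifts are known to be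
  probabilities only later.\<close>

lemma cmod_cauchy_sq_le:
  assumes z: "Im z > 0"
  shows "(cmod (cauchy_transform M z))\<^sup>2 \<le>
    measure M UNIV * (\<integral>x. (cmod (1 / (z - complex_of_real x)))\<^sup>2 \<partial>M)"
proof -
  define f where "f x = 1 / (z - complex_of_real x)" for x
  define A m B where "A = cauchy_transform M z" "m = measure M UNIV" "B = (\<integral>x. (cmod (f x))\<^sup>2 \<partial>M)"
  have int: "integrable M f" "integrable M (\<lambda>x. (cmod (f x))\<^sup>2)"
    unfolding f_def using integrable_kernel[OF z] integrable_kernel_sq[OF z] by auto
  have A: "A = (\<integral>x. f x \<partial>M)" by (simp add: A_m_B_def f_def cauchy_transform_def)
  have expand: "(cmod (of_real m * f x - A))\<^sup>2 = m\<^sup>2 * (cmod (f x))\<^sup>2 - 2 * m * Re (f x * cnj A) + (cmod A)\<^sup>2" for x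
    by (simp add: cmod_power2) (simp add: power2_eq_square algebra_simps)
  define P R where "P x = (cmod (f x))\<^sup>2" "R x = Re (f x * cnj A)" for x
  have intP: "integrable M P" "integrable M R" using int by (simp_all add: P_R_def[abs_def])
  have "0 \<le> (\<integral>x. (cmod (of_real m * f x - A))\<^sup>2 \<partial>M)" by simp
  also have "\<dots> = (\<integral>x. m\<^sup>2 * P x - 2 * m * R x + (cmod A)\<^sup>2 \<partial>M)"
    unfolding expand P_R_def ..
  also have "\<dots> = m\<^sup>2 * (\<integral>x. P x \<partial>M) - 2 * m * (\<integral>x. R x \<partial>M) + m * (cmod A)\<^sup>2"
    using intP by (simp add: space_M_UNIV A_m_B_def(2))
  also have "(\<integral>x. P x \<partial>M) = B" by (simp add: P_R_def A_m_B_def)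
  also have "(\<integral>x. R x \<partial>M) = (\<integral>x. Re (f x * cnj A) \<partial>M)" by (simp only: P_R_def)
  also have "(\<integral>x. Re (f x * cnj A) \<partial>M) = Re (\<integral>x. f x * cnj A \<partial>M)"
    using int by (intro integral_Re) simp
  also have "(\<integral>x. f x * cnj A \<partial>M) = A * cnj A" using int by (simp add: A)
  also have "Re (A * cnj A) = (cmod A)\<^sup>2" by (simp add: complex_norm_square[symmetric] flip: of_real_power)
  finally have *: "0 \<le> m * (m * B - (cmod A)\<^sup>2)" by (simp add: power2_eq_square algebra_simps)
  show ?thesis
  proof (cases "m = 0")
    case True
    then have "cmod A = 0" using cmod_cauchy_le[OF z] by (simp add: A_m_B_def)
    then show ?thesis by (simp add: A_m_B_def integral_nonneg)
  next
    case False
    then have "m > 0" by (simp add: A_m_B_def less_le)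
    with * show ?thesis by (simp add: zero_le_mult_iff A_m_B_def f_def)
  qed
qed

text \<open>The imaginary part of 1/G is Im z times the second moment of the kernel over |G|^2, and
  Cauchy--Schwarz bounds this quotient below by 1/m.\<close>

lemma Im_inverse_cauchy_ge:
  assumes z: "Im z > 0" and nz: "cauchy_transform M z \<noteq> 0"
  shows "Im z \<le> measure M UNIV * Im (1 / cauchy_transform M z)"
proof -
  define B where "B = (\<integral>x. (cmod (1 / (z - complex_of_real x)))\<^sup>2 \<partial>M)"
  have pos: "(cmod (cauchy_transform M z))\<^sup>2 > 0" using nz by simp
  have "Im (1 / cauchy_transform M z) = Im z * B / (cmod (cauchy_transform M z))\<^sup>2"
    by (simp add: Im_divide Im_cauchy[OF z] cmod_power2 B_def)
  then have "measure M UNIV * Im (1 / cauchy_transform M z) =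
      Im z * (measure M UNIV * B / (cmod (cauchy_transform M z))\<^sup>2)" by simp
  moreover have "1 \<le> measure M UNIV * B / (cmod (cauchy_transform M z))\<^sup>2"
    using cmod_cauchy_sq_le[OF z] pos by (simp add: le_divide_eq B_def)
  ultimately show ?thesis using z mult_left_mono[of 1 _ "Im z"] by fastforce
qed

text \<open>The nontangential condition with C is what supplies a dominating constant: |w / (w - x)|
  \<le> |w| / Im w \<le> C.\<close>

lemma cauchy_asymptotics:
  assumes w: "filterlim (\<lambda>n. Im (w n)) at_top sequentially" "\<And>n. Im (w n) > 0"
    and C: "\<And>n. cmod (w n) \<le> C * Im (w n)"
  shows "(\<lambda>n. w n * cauchy_transform M (w n)) \<longlonglongrightarrow> of_real (measure M UNIV)"
proof -
  have "(\<lambda>n. \<integral>x. w n / (w n - complex_of_real x) \<partial>M) \<longlonglongrightarrow> (\<integral>x. 1 \<partial>M)"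
  proof (rule integral_dominated_convergence[where w="\<lambda>_. C"])
    have lim: "(\<lambda>n. w n / (w n - complex_of_real x)) \<longlonglongrightarrow> 1" for x
    proof -
      have "(\<lambda>n. \<bar>x\<bar> * inverse (Im (w n))) \<longlonglongrightarrow> \<bar>x\<bar> * 0"
        by (intro tendsto_intros tendsto_inverse_0_at_top w)
      then have "(\<lambda>n. \<bar>x\<bar> / Im (w n)) \<longlonglongrightarrow> 0" by (simp add: divide_inverse)
      then have "(\<lambda>n. w n / (w n - complex_of_real x) - 1) \<longlonglongrightarrow> 0"
      proof (rule Lim_null_comparison[rotated], intro always_eventually allI)
        fix n
        have "w n / (w n - complex_of_real x) - 1 = x * (1 / (w n - complex_of_real x))"
          using kernel_nonzero[OF w(2), of n x] by (simp add: field_simps)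
        then have "cmod (w n / (w n - complex_of_real x) - 1) = \<bar>x\<bar> * cmod (1 / (w n - complex_of_real x))"
          by (simp only: norm_mult norm_of_real)
        also have "\<dots> \<le> \<bar>x\<bar> * (1 / Im (w n))"
          by (intro mult_left_mono cmod_inverse_kernel_le w) auto
        finally show "cmod (w n / (w n - complex_of_real x) - 1) \<le> \<bar>x\<bar> / Im (w n)" by simp
      qed
      then show ?thesis by (simp add: LIM_zero_iff)
    qed
    then show "AE x in M. (\<lambda>n. w n / (w n - complex_of_real x)) \<longlonglongrightarrow> 1" by simp
    show "AE x in M. cmod (w n / (w n - complex_of_real x)) \<le> C" for n
    proof (rule AE_I2)
      fix x
      have "cmod (w n / (w n - complex_of_real x)) = cmod (w n) * cmod (1 / (w n - complex_of_real x))"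
        by (simp add: norm_divide)
      also have "\<dots> \<le> C * Im (w n) * (1 / Im (w n))"
        using w(2)[of n] order_trans[OF norm_ge_zero C[of n]]
        by (intro mult_mono C cmod_inverse_kernel_le) auto
      also have "\<dots> = C" using w(2)[of n] by simp
      finally show "cmod (w n / (w n - complex_of_real x)) \<le> C" .
    qed
  qed auto
  moreover have "(\<integral>x. w n / (w n - complex_of_real x) \<partial>M) = w n * cauchy_transform M (w n)" for n
    unfolding cauchy_transform_def by (simp flip: integral_mult_right_zero)
  ultimately show ?thesis by (simp add: space_M_UNIV scaleR_conv_of_real)
qed

section \<open>Monotonicity on the imaginary axis and tail estimates\<close>

lemma cmod_kernel_imag_sq: "(cmod (1 / (\<i> * of_real y - complex_of_real x)))\<^sup>2 = 1 / (y\<^sup>2 + x\<^sup>2)"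
  by (simp add: norm_divide power_divide cmod_power2 add.commute)

lemma Im_cauchy_imag:
  "y > 0 \<Longrightarrow> Im (cauchy_transform M (\<i> * of_real y)) = - y * (\<integral>x. 1 / (y\<^sup>2 + x\<^sup>2) \<partial>M)"
  using Im_cauchy[of "\<i> * of_real y"] by (simp add: cmod_kernel_imag_sq)

lemma integrable_imag: "y > 0 \<Longrightarrow> integrable M (\<lambda>x. 1 / (y\<^sup>2 + x\<^sup>2))"
  using integrable_kernel_sq[of "\<i> * of_real y"] by (simp add: cmod_kernel_imag_sq)

text \<open>Up to sign the two sides are integrals of t^2 / (t^2 + x^2), which increases with t. It
  carries a tail estimate from one height to all greater ones.\<close>

lemma imag_cauchy_mono:
  assumes "0 < s" "s \<le> t"
  shows "t * Im (cauchy_transform M (\<i> * of_real t)) \<le> s * Im (cauchy_transform M (\<i> * of_real s))"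
proof -
  have "(\<integral>x. s\<^sup>2 * (1 / (s\<^sup>2 + x\<^sup>2)) \<partial>M) \<le> (\<integral>x. t\<^sup>2 * (1 / (t\<^sup>2 + x\<^sup>2)) \<partial>M)"
  proof (intro integral_mono integrable_mult_right integrable_imag)
    fix x
    have "s\<^sup>2 * x\<^sup>2 \<le> t\<^sup>2 * x\<^sup>2" using assms by (intro mult_right_mono power_mono) auto
    moreover have "s\<^sup>2 + x\<^sup>2 > 0" "t\<^sup>2 + x\<^sup>2 > 0" using assms by (auto intro: add_pos_nonneg)
    ultimately show "s\<^sup>2 * (1 / (s\<^sup>2 + x\<^sup>2)) \<le> t\<^sup>2 * (1 / (t\<^sup>2 + x\<^sup>2))"
      by (simp add: field_simps)
  qed (use assms in auto)
  then have "s\<^sup>2 * (\<integral>x. 1 / (s\<^sup>2 + x\<^sup>2) \<partial>M) \<le> t\<^sup>2 * (\<integral>x. 1 / (t\<^sup>2 + x\<^sup>2) \<partial>M)"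
    by (simp only: integral_mult_right_zero)
  then show ?thesis using assms by (simp add: Im_cauchy_imag) (simp add: power2_eq_square mult.assoc)
qed

end

text \<open>A Chebyshev bound: 1 + y Im G(\<i> y) is the integral of x^2 / (y^2 + x^2), and outside
  [-d, d] this integrand is at least d^2 / (y^2 + d^2), the reciprocal of the constant in
  front.\<close>

lemma (in real_distribution) tail_le:
  assumes y: "y > 0" and d: "d > 0"
  shows "measure M (UNIV - {-d..d}) \<le> (1 + y\<^sup>2 / d\<^sup>2) * (1 + y * Im (cauchy_transform M (\<i> * of_real y)))"
proof -
  have eq: "1 - y\<^sup>2 * (1 / (y\<^sup>2 + x\<^sup>2)) = x\<^sup>2 / (y\<^sup>2 + x\<^sup>2)" for x
  proof -
    have "y\<^sup>2 + x\<^sup>2 \<noteq> 0" using y by (simp add: add_pos_nonneg less_imp_neq[symmetric])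
    then show ?thesis by (simp add: field_simps)
  qed
  have int: "integrable M (\<lambda>x. 1 - y\<^sup>2 * (1 / (y\<^sup>2 + x\<^sup>2)))"
    by (intro Bochner_Integration.integrable_diff integrable_const integrable_mult_right integrable_imag y)
  have "measure M (UNIV - {-d..d}) = (\<integral>x. indicat_real (UNIV - {-d..d}) x \<partial>M)"
    by simp
  also have "\<dots> \<le> (\<integral>x. (1 + y\<^sup>2 / d\<^sup>2) * (1 - y\<^sup>2 * (1 / (y\<^sup>2 + x\<^sup>2))) \<partial>M)"
  proof (intro integral_mono integrable_mult_right int)
    fix x
    show "indicat_real (UNIV - {-d..d}) x \<le> (1 + y\<^sup>2 / d\<^sup>2) * (1 - y\<^sup>2 * (1 / (y\<^sup>2 + x\<^sup>2)))"
    proof (cases "x \<in> {-d..d}")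
      case True
      then show ?thesis unfolding eq by simp
    next
      case False
      then have "d \<le> \<bar>x\<bar>" by auto
      then have "d\<^sup>2 \<le> x\<^sup>2" using d by (simp add: abs_le_square_iff[symmetric])
      then have "y\<^sup>2 * d\<^sup>2 \<le> y\<^sup>2 * x\<^sup>2" by (intro mult_left_mono) auto
      moreover have "d\<^sup>2 * (y\<^sup>2 + x\<^sup>2) > 0" using y d by (intro mult_pos_pos add_pos_nonneg) auto
      ultimately have "1 \<le> ((d\<^sup>2 + y\<^sup>2) * x\<^sup>2) / (d\<^sup>2 * (y\<^sup>2 + x\<^sup>2))"
        by (subst le_divide_eq_1_pos) (simp_all add: algebra_simps)
      moreover have "1 + y\<^sup>2 / d\<^sup>2 = (d\<^sup>2 + y\<^sup>2) / d\<^sup>2" using d by (simp add: add_divide_distrib)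
      ultimately have "1 \<le> (1 + y\<^sup>2 / d\<^sup>2) * (x\<^sup>2 / (y\<^sup>2 + x\<^sup>2))" by (simp only: times_divide_times_eq)
      then show ?thesis using False unfolding eq by simp
    qed
  next
    show "integrable M (indicat_real (UNIV - {-d..d}))"
      by (rule integrable_const_bound[where B=1]) auto
  qed
  also have "\<dots> = (1 + y\<^sup>2 / d\<^sup>2) * (\<integral>x. 1 - y\<^sup>2 * (1 / (y\<^sup>2 + x\<^sup>2)) \<partial>M)"
    by (rule integral_mult_right_zero)
  also have "(\<integral>x. 1 - y\<^sup>2 * (1 / (y\<^sup>2 + x\<^sup>2)) \<partial>M) = 1 - y\<^sup>2 * (\<integral>x. 1 / (y\<^sup>2 + x\<^sup>2) \<partial>M)"
    using prob_space integrable_mult_right[OF integrable_imag[OF y], of "y\<^sup>2"]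
    by (subst Bochner_Integration.integral_diff) (simp_all del: times_divide_eq_right)
  also have "\<dots> = 1 + y * Im (cauchy_transform M (\<i> * of_real y))"
    using y by (simp add: Im_cauchy_imag power2_eq_square)
  finally show ?thesis .
qed

section \<open>Uniqueness\<close>

lemma integrable_inverse_1_plus_sq: "integrable lborel (\<lambda>x::real. 1 / (1 + x\<^sup>2))"
  and integral_inverse_1_plus_sq: "(\<integral>x. 1 / (1 + x\<^sup>2) \<partial>(lborel :: real measure)) = pi"
proof -
  have [simp]: "einterval (-\<infinity>) \<infinity> = UNIV" by (auto simp: einterval_def)
  show "integrable lborel (\<lambda>x::real. 1 / (1 + x\<^sup>2))"
    using integrable_inverse_1_plus_square by (simp add: set_integrable_def divide_inverse)
  show "(\<integral>x. 1 / (1 + x\<^sup>2) \<partial>(lborel :: real measure)) = pi"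
    using LBINT_inverse_1_plus_square
    by (simp add: interval_lebesgue_integral_def set_lebesgue_integral_def divide_inverse)
qed

lemma poisson_kernel_affine:
  assumes "(\<epsilon>::real) > 0"
  shows "\<epsilon> / (\<epsilon>\<^sup>2 + ((u + \<epsilon> * s) - u)\<^sup>2) = inverse \<epsilon> * (1 / (1 + s\<^sup>2))"
proof -
  have "\<epsilon>\<^sup>2 + ((u + \<epsilon> * s) - u)\<^sup>2 = \<epsilon> * \<epsilon> * (1 + s\<^sup>2)" by (simp add: power2_eq_square algebra_simps)
  then show ?thesis using assms by (simp only:) (simp add: divide_simps)
qed

lemma integral_poisson_affine:
  fixes \<phi> :: "real \<Rightarrow> complex"
  assumes \<epsilon>: "\<epsilon> > 0"
  shows "(\<integral>x. \<phi> x * of_real (\<epsilon> / (\<epsilon>\<^sup>2 + (x - u)\<^sup>2)) \<partial>lborel) = (\<integral>s. \<phi> (u + \<epsilon> * s) * of_real (1 / (1 + s\<^sup>2)) \<partial>lborel)"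
proof -
  have "(\<integral>x. \<phi> x * of_real (\<epsilon> / (\<epsilon>\<^sup>2 + (x - u)\<^sup>2)) \<partial>lborel) =
      \<bar>\<epsilon>\<bar> *\<^sub>R (\<integral>s. \<phi> (u + \<epsilon> * s) * of_real (\<epsilon> / (\<epsilon>\<^sup>2 + ((u + \<epsilon> * s) - u)\<^sup>2)) \<partial>lborel)"
    using \<epsilon> by (intro lborel_integral_real_affine) simp
  also have "\<dots> = \<bar>\<epsilon>\<bar> *\<^sub>R (\<integral>s. inverse \<epsilon> *\<^sub>R (\<phi> (u + \<epsilon> * s) * of_real (1 / (1 + s\<^sup>2))) \<partial>lborel)"
    unfolding poisson_kernel_affine[OF \<epsilon>] of_real_mult scaleR_conv_of_real by (simp only: mult_ac)
  also have "\<dots> = (\<integral>s. \<phi> (u + \<epsilon> * s) * of_real (1 / (1 + s\<^sup>2)) \<partial>lborel)"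
    using \<epsilon> by (subst integral_scaleR_right) simp
  finally show ?thesis .
qed

lemma integrable_poisson: "\<epsilon> > 0 \<Longrightarrow> integrable lborel (\<lambda>x::real. \<epsilon> / (\<epsilon>\<^sup>2 + (x - u)\<^sup>2))"
proof -
  assume \<epsilon>: "\<epsilon> > 0"
  have "integrable lborel (\<lambda>s. \<epsilon> / (\<epsilon>\<^sup>2 + ((u + \<epsilon> * s) - u)\<^sup>2))"
    unfolding poisson_kernel_affine[OF \<epsilon>]
    by (intro integrable_mult_right integrable_inverse_1_plus_sq)
  then show ?thesis using \<epsilon> lborel_integrable_real_affine_iff[of \<epsilon> "\<lambda>x. \<epsilon> / (\<epsilon>\<^sup>2 + (x - u)\<^sup>2)" u] by simp
qed

lemma integral_poisson: "\<epsilon> > 0 \<Longrightarrow> (\<integral>x. \<epsilon> / (\<epsilon>\<^sup>2 + (x - u)\<^sup>2) \<partial>lborel) = pi"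
proof -
  assume \<epsilon>: "\<epsilon> > 0"
  have "complex_of_real (\<integral>x. \<epsilon> / (\<epsilon>\<^sup>2 + (x - u)\<^sup>2) \<partial>lborel)
      = (\<integral>x. 1 * of_real (\<epsilon> / (\<epsilon>\<^sup>2 + (x - u)\<^sup>2)) \<partial>lborel)"
    by (simp only: mult_1_left integral_complex_of_real)
  also have "\<dots> = (\<integral>s. 1 * of_real (1 / (1 + s\<^sup>2)) \<partial>lborel)" by (rule integral_poisson_affine[OF \<epsilon>])
  also have "\<dots> = complex_of_real pi"
    by (simp only: mult_1_left integral_complex_of_real integral_inverse_1_plus_sq)
  finally show ?thesis by (simp only: of_real_eq_iff)
qed

lemma Im_cauchy_kernel: "- Im (1 / (Complex x \<epsilon> - complex_of_real t)) = \<epsilon> / (\<epsilon>\<^sup>2 + (x - t)\<^sup>2)"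
  by (simp add: Im_divide add.commute)

text \<open>The boundary values of the Cauchy transform at height \<open>\<epsilon>\<close> are the density of the convolution with
  a Cauchy distribution, whose characteristic function factors.\<close>

lemma (in real_distribution) char_times_cauchy:
  assumes \<epsilon>: "\<epsilon> > 0"
  shows "(\<integral>x. iexp (\<theta> * x) * of_real (- Im (cauchy_transform M (Complex x \<epsilon>))) \<partial>lborel) =
    char M \<theta> * (\<integral>s. iexp (\<theta> * \<epsilon> * s) * of_real (1 / (1 + s\<^sup>2)) \<partial>lborel)"
proof -
  define k where "k t x = iexp (\<theta> * x) * complex_of_real (\<epsilon> / (\<epsilon>\<^sup>2 + (x - t)\<^sup>2))" for t x
  interpret P: pair_sigma_finite M lborel
    by unfold_locales
  have k_norm: "norm (k t x) = \<epsilon> / (\<epsilon>\<^sup>2 + (x - t)\<^sup>2)" for t x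
    using \<epsilon> by (simp only: k_def norm_mult norm_of_real norm_exp_i_times) simp
  have k_meas: "(\<lambda>(t, x). k t x) \<in> borel_measurable (M \<Otimes>\<^sub>M lborel)"
    unfolding k_def by measurable
  have "integrable (M \<Otimes>\<^sub>M lborel) (\<lambda>(t, x). k t x)"
  proof (rule P.Fubini_integrable[OF k_meas])
    show "integrable M (\<lambda>t. \<integral>x. norm (case (t, x) of (t, x) \<Rightarrow> k t x) \<partial>lborel)"
      by (simp add: k_norm integral_poisson \<epsilon>)
    have "integrable lborel (k t)" for t
      using integrable_poisson[OF \<epsilon>, of t]
      by (rule Bochner_Integration.integrable_bound) (use \<epsilon> in \<open>simp_all add: k_norm, simp_all add: k_def[abs_def]\<close>)
    then show "AE t in M. integrable lborel (\<lambda>x. case (t, x) of (t, x) \<Rightarrow> k t x)" by simp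
  qed
  then have fub: "(\<integral>x. (\<integral>t. k t x \<partial>M) \<partial>lborel) = (\<integral>t. (\<integral>x. k t x \<partial>lborel) \<partial>M)"
    by (rule P.Fubini_integral)
  have "(\<integral>x. iexp (\<theta> * x) * of_real (- Im (cauchy_transform M (Complex x \<epsilon>))) \<partial>lborel) =
      (\<integral>x. (\<integral>t. k t x \<partial>M) \<partial>lborel)"
  proof (intro Bochner_Integration.integral_cong refl)
    fix x
    have z: "Im (Complex x \<epsilon>) > 0" using \<epsilon> by simp
    have "Im (cauchy_transform M (Complex x \<epsilon>)) = (\<integral>t. Im (1 / (Complex x \<epsilon> - complex_of_real t)) \<partial>M)"
      unfolding cauchy_transform_def by (rule integral_Im[symmetric, OF integrable_kernel[OF z]])
    then have "- Im (cauchy_transform M (Complex x \<epsilon>)) = (\<integral>t. \<epsilon> / (\<epsilon>\<^sup>2 + (x - t)\<^sup>2) \<partial>M)"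
      by (simp only: Im_cauchy_kernel flip: Bochner_Integration.integral_minus)
    then show "iexp (\<theta> * x) * of_real (- Im (cauchy_transform M (Complex x \<epsilon>))) = (\<integral>t. k t x \<partial>M)"
      unfolding k_def by (simp only: integral_mult_right_zero integral_complex_of_real)
  qed
  also have "\<dots> = (\<integral>t. iexp (\<theta> * t) * (\<integral>s. iexp (\<theta> * \<epsilon> * s) * of_real (1 / (1 + s\<^sup>2)) \<partial>lborel) \<partial>M)"
    unfolding fub
  proof (intro Bochner_Integration.integral_cong refl)
    fix t
    have "(\<integral>x. k t x \<partial>lborel) = (\<integral>s. iexp (\<theta> * (t + \<epsilon> * s)) * of_real (1 / (1 + s\<^sup>2)) \<partial>lborel)"
      unfolding k_def by (rule integral_poisson_affine[OF \<epsilon>])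
    also have "\<dots> = (\<integral>s. iexp (\<theta> * t) * (iexp (\<theta> * \<epsilon> * s) * of_real (1 / (1 + s\<^sup>2))) \<partial>lborel)"
    proof (intro Bochner_Integration.integral_cong refl)
      fix s
      have "iexp (\<theta> * (t + \<epsilon> * s)) = iexp (\<theta> * t) * iexp (\<theta> * \<epsilon> * s)"
        by (simp add: exp_add[symmetric] algebra_simps)
      then show "iexp (\<theta> * (t + \<epsilon> * s)) * of_real (1 / (1 + s\<^sup>2)) =
          iexp (\<theta> * t) * (iexp (\<theta> * \<epsilon> * s) * of_real (1 / (1 + s\<^sup>2)))"
        by (simp only: mult.assoc)
    qed
    finally show "(\<integral>x. k t x \<partial>lborel) = iexp (\<theta> * t) * (\<integral>s. iexp (\<theta> * \<epsilon> * s) * of_real (1 / (1 + s\<^sup>2)) \<partial>lborel)"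
      by (simp only: integral_mult_right_zero)
  qed
  finally show ?thesis by (simp add: char_def)
qed

text \<open>The integral equals pi exp (-|\<theta>| / (n + 1)), but uniqueness only asks that it be
  nonzero for some n, which the limit pi provides without evaluating it.\<close>

lemma poisson_char_limit:
  "(\<lambda>n. \<integral>s. iexp (\<theta> * (1 / real (Suc n)) * s) * of_real (1 / (1 + s\<^sup>2)) \<partial>lborel) \<longlonglongrightarrow> complex_of_real pi"
proof -
  have "(\<lambda>n. \<integral>s. iexp (\<theta> * (1 / real (Suc n)) * s) * of_real (1 / (1 + s\<^sup>2)) \<partial>lborel)
      \<longlonglongrightarrow> (\<integral>s. complex_of_real (1 / (1 + s\<^sup>2)) \<partial>lborel)"
  proof (rule integral_dominated_convergence[OF _ _ integrable_inverse_1_plus_sq])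
    have "(\<lambda>n. iexp (\<theta> * (1 / real (Suc n)) * s) * complex_of_real (1 / (1 + s\<^sup>2)))
        \<longlonglongrightarrow> iexp (\<theta> * 0 * s) * complex_of_real (1 / (1 + s\<^sup>2))" for s
      by (intro tendsto_intros LIMSEQ_Suc lim_1_over_n)
    then show "AE s in lborel. (\<lambda>n. iexp (\<theta> * (1 / real (Suc n)) * s) * complex_of_real (1 / (1 + s\<^sup>2)))
        \<longlonglongrightarrow> complex_of_real (1 / (1 + s\<^sup>2))" by simp
    show "AE s in lborel. cmod (iexp (\<theta> * (1 / real (Suc n)) * s) * complex_of_real (1 / (1 + s\<^sup>2))) \<le> 1 / (1 + s\<^sup>2)" for n
      by (intro AE_I2) (simp only: norm_mult norm_of_real norm_exp_i_times, simp)
  qed auto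
  then show ?thesis by (simp only: integral_complex_of_real integral_inverse_1_plus_sq)
qed

lemma F_transform_unique:
  assumes \<mu>: "real_distribution \<mu>" and \<nu>: "real_distribution \<nu>"
    and eq: "\<And>z. Im z > 0 \<Longrightarrow> F_transform \<mu> z = F_transform \<nu> z"
  shows "\<mu> = \<nu>"
proof (rule Levy_uniqueness[OF \<mu> \<nu>], rule ext)
  fix \<theta>
  interpret m: real_distribution \<mu> by fact
  interpret n: real_distribution \<nu> by fact
  have G: "cauchy_transform \<mu> z = cauchy_transform \<nu> z" if "Im z > 0" for z
    using eq[OF that] by (simp add: F_transform_def divide_inverse)
  define c where "c n = (\<integral>s. iexp (\<theta> * (1 / real (Suc n)) * s) * complex_of_real (1 / (1 + s\<^sup>2)) \<partial>lborel)" for n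
  have "c \<longlonglongrightarrow> complex_of_real pi" unfolding c_def by (rule poisson_char_limit)
  then have "\<forall>\<^sub>F n in sequentially. c n \<noteq> 0" by (rule tendsto_imp_eventually_ne) simp
  then obtain n where n: "c n \<noteq> 0" by (auto dest: eventually_happens)
  have pos: "1 / real (Suc n) > 0" by simp
  have "char \<mu> \<theta> * c n = char \<nu> \<theta> * c n"
    unfolding c_def m.char_times_cauchy[OF pos, symmetric] n.char_times_cauchy[OF pos, symmetric]
    by (intro Bochner_Integration.integral_cong refl) (simp add: G)
  then show "char \<mu> \<theta> = char \<nu> \<theta>" using n by simp
qed

section \<open>Representation of reciprocal Cauchy transforms\<close>

text \<open>Cauchy's theorem for (g \<zeta> - g \<i>) / (\<zeta>^2 + 1) on large half-discs.
  Subtracting g \<i> makes \<i> removable, and e \<le> 1 keeps the other pole -\<i> outside the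
  domain. The arc contributes O(1/R), because g is bounded.\<close>

lemma poisson_at_i:
  fixes g :: "complex \<Rightarrow> complex"
  assumes e: "0 < e" "e \<le> 1" and hol: "g holomorphic_on {z. Im z > - e}"
    and B: "\<And>z. Im z \<ge> 0 \<Longrightarrow> cmod (g z) \<le> B"
  shows "integrable lborel (\<lambda>x. g (complex_of_real x) * of_real (1 / (1 + x\<^sup>2)))" (is ?int)
    and "(\<integral>x. g (complex_of_real x) * of_real (1 / (1 + x\<^sup>2)) \<partial>lborel) = pi * g \<i>" (is ?eq)
proof -
  define S where "S = {z. Im z > - e}"
  have S: "open S" "convex S" unfolding S_def
    by (simp_all add: open_halfspace_Im_gt convex_halfspace_Im_gt)
  define \<psi> where "\<psi> \<zeta> = (if \<zeta> = \<i> then deriv g \<i> else (g \<zeta> - g \<i>) / (\<zeta> - \<i>)) / (\<zeta> + \<i>)" for \<zeta>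
  have S_ne: "\<zeta> + \<i> \<noteq> 0" if "\<zeta> \<in> S" for \<zeta>
    using that e by (auto simp: S_def complex_eq_iff)
  have \<psi>_hol: "\<psi> holomorphic_on S"
    unfolding \<psi>_def[abs_def] using hol S S_ne
    by (intro holomorphic_on_divide pole_lemma_open holomorphic_intros) (auto simp: S_def)
  have \<psi>_eq: "\<psi> \<zeta> = (g \<zeta> - g \<i>) / (\<zeta>\<^sup>2 + 1)" if "\<zeta> \<noteq> \<i>" for \<zeta>
  proof -
    have "(\<zeta> - \<i>) * (\<zeta> + \<i>) = \<zeta>\<^sup>2 + 1" by (simp add: power2_eq_square algebra_simps)
    then show ?thesis using that by (simp add: \<psi>_def)
  qed
  have B0: "B \<ge> 0" using order_trans[OF norm_ge_zero B[of \<i>]] by simp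
  define u where "u x = (g (complex_of_real x) - g \<i>) * of_real (1 / (1 + x\<^sup>2))" for x
  have \<psi>_real: "\<psi> (complex_of_real x) = u x" for x
  proof -
    have "complex_of_real x \<noteq> \<i>" by (auto simp: complex_eq_iff)
    then show ?thesis by (simp add: \<psi>_eq u_def add.commute)
  qed
  have g_cont: "continuous_on UNIV (\<lambda>x. g (complex_of_real x))"
    using e by (intro continuous_on_compose2[OF holomorphic_on_imp_continuous_on[OF hol]] continuous_intros) auto
  have [measurable]: "(\<lambda>x. g (complex_of_real x)) \<in> borel_measurable borel"
    by (rule borel_measurable_continuous_onI[OF g_cont])
  show int: ?int
  proof (rule Bochner_Integration.integrable_bound)
    show "integrable lborel (\<lambda>x. B * (1 / (1 + x\<^sup>2)) :: real)"
      by (intro integrable_mult_right integrable_inverse_1_plus_sq)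
    show "AE x in lborel. norm (g (complex_of_real x) * of_real (1 / (1 + x\<^sup>2))) \<le> norm (B * (1 / (1 + x\<^sup>2)))"
    proof (rule AE_I2)
      fix x :: real
      have "cmod (g (complex_of_real x)) * (1 / (1 + x\<^sup>2)) \<le> B * (1 / (1 + x\<^sup>2))"
        using B[of "complex_of_real x"] by (intro mult_right_mono) auto
      then show "norm (g (complex_of_real x) * of_real (1 / (1 + x\<^sup>2))) \<le> norm (B * (1 / (1 + x\<^sup>2)))"
        using B0 unfolding norm_mult norm_of_real by simp
    qed
  qed measurable
  have k_int: "integrable lborel (\<lambda>x. complex_of_real (1 / (1 + x\<^sup>2)))"
    using integrable_inverse_1_plus_sq by (rule integrable_of_real)
  have u_int: "integrable lborel u"
    unfolding u_def left_diff_distrib by (intro Bochner_Integration.integrable_diff int integrable_mult_right k_int)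
  have bound: "cmod (integral {-R..R} u) \<le> 2 * B / (R\<^sup>2 - 1) * R * pi" if R: "R > 1" for R
  proof -
    define L A where "L = linepath (complex_of_real (-R)) (of_real R)" "A = part_circlepath 0 R 0 pi"
    have arc: "\<zeta> \<in> sphere 0 R \<and> Im \<zeta> \<ge> 0" if \<zeta>: "\<zeta> \<in> path_image A" for \<zeta>
    proof -
      have "\<zeta> \<in> sphere 0 R" using \<zeta> path_image_part_circlepath_subset[of 0 pi R 0] R by (auto simp: L_A_def)
      moreover obtain t where t: "t \<in> {0..1}" "\<zeta> = A t" using \<zeta> by (auto simp: path_image_def)
      have "Im \<zeta> = R * sin (pi * t)"
        unfolding t by (simp add: L_A_def part_circlepath_def linepath_def Im_exp mult.commute)
      moreover have "pi * t \<le> pi * 1" using t by (intro mult_left_mono) auto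
      then have "sin (pi * t) \<ge> 0" using t by (intro sin_ge_zero) auto
      ultimately show ?thesis using R by simp
    qed
    have inS: "path_image L \<subseteq> S" "path_image A \<subseteq> S"
    proof -
      show "path_image L \<subseteq> S" using e unfolding S_def L_A_def(1) by (auto simp: closed_segment_def)
      show "path_image A \<subseteq> S"
      proof
        fix x assume "x \<in> path_image A"
        then show "x \<in> S" using arc[of x] e by (simp add: S_def)
      qed
    qed
    have valid: "valid_path L" "valid_path A" by (simp_all add: L_A_def)
    have ends: "pathfinish L = pathstart A" "pathfinish A = pathstart L"
      by (simp_all add: L_A_def)
    have ints: "\<psi> contour_integrable_on L" "\<psi> contour_integrable_on A"
      using contour_integrable_holomorphic_simple[OF \<psi>_hol S(1)] valid inS by auto
    have "(\<psi> has_contour_integral 0) (L +++ A)"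
      by (rule Cauchy_theorem_convex_simple[OF \<psi>_hol S(2)])
         (use valid inS ends in \<open>auto simp: path_image_join\<close>)
    then have "contour_integral L \<psi> + contour_integral A \<psi> = 0"
      using contour_integral_join[OF ints valid] ends by (simp add: contour_integral_unique)
    moreover have "contour_integral L \<psi> = integral {-R..R} u"
      using contour_integral_linepath_Reals_eq[of "complex_of_real (-R)" "of_real R" \<psi>] R
      by (simp add: L_A_def \<psi>_real)
    ultimately have "cmod (integral {-R..R} u) = cmod (contour_integral A \<psi>)"
      by (metis add_eq_0_iff norm_minus_cancel)
    also have "\<dots> \<le> 2 * B / (R\<^sup>2 - 1) * R * \<bar>pi - 0\<bar>"
      unfolding L_A_def(2)
    proof (rule contour_integral_bound_part_circlepath)
      show "\<psi> contour_integrable_on part_circlepath 0 R 0 pi" using ints by (simp add: L_A_def)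
      have R2: "R\<^sup>2 - 1 > 0" using R by (simp add: one_less_power)
      then show "0 \<le> 2 * B / (R\<^sup>2 - 1)" using B0 by simp
      fix \<zeta> assume "\<zeta> \<in> path_image (part_circlepath 0 R 0 pi)"
      then have \<zeta>: "cmod \<zeta> = R" "Im \<zeta> \<ge> 0" using arc by (auto simp: L_A_def)
      then have "\<zeta> \<noteq> \<i>" using R by auto
      have "cmod (g \<zeta> - g \<i>) \<le> 2 * B"
        using norm_triangle_ineq4[of "g \<zeta>" "g \<i>"] B[of \<zeta>] B[of \<i>] \<zeta> by simp
      moreover have "R\<^sup>2 - 1 \<le> cmod (\<zeta>\<^sup>2 + 1)"
        using norm_diff_ineq[of "\<zeta>\<^sup>2" 1] \<zeta> by (simp add: norm_power)
      ultimately show "cmod (\<psi> \<zeta>) \<le> 2 * B / (R\<^sup>2 - 1)"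
        unfolding \<psi>_eq[OF \<open>\<zeta> \<noteq> \<i>\<close>] norm_divide using R2 B0 by (intro frac_le) auto
    qed (use R in auto)
    finally show ?thesis by simp
  qed
  define I where "I n = (\<integral>x. indicator {- real n..real n} x *\<^sub>R u x \<partial>lborel)" for n
  have I_eq: "I n = integral {- real n..real n} u" for n
    unfolding I_def
    using set_borel_integral_eq_integral(2)[of "{- real n..real n}" u]
      integrable_mult_indicator[OF _ u_int, of "{- real n..real n}"]
    by (simp add: set_integrable_def set_lebesgue_integral_def)
  have "I \<longlonglongrightarrow> (\<integral>x. u x \<partial>lborel)"
    unfolding I_def
  proof (rule integral_dominated_convergence[OF _ _ integrable_norm[OF u_int]])
    show "u \<in> borel_measurable lborel" using u_int by (rule borel_measurable_integrable)
    then show "(\<lambda>x. indicator {- real n..real n} x *\<^sub>R u x) \<in> borel_measurable lborel" for n by measurable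
    have "(\<lambda>n. indicator {- real n..real n} x *\<^sub>R u x) \<longlonglongrightarrow> u x" for x
    proof (rule tendsto_eventually)
      obtain N where "\<bar>x\<bar> \<le> real N" using real_arch_simple by blast
      then show "\<forall>\<^sub>F n in sequentially. indicator {- real n..real n} x *\<^sub>R u x = u x"
        by (intro eventually_sequentiallyI[of N]) (auto simp: indicator_def)
    qed
    then show "AE x in lborel. (\<lambda>n. indicator {- real n..real n} x *\<^sub>R u x) \<longlonglongrightarrow> u x" by simp
  qed (auto simp: indicator_def)
  moreover have "I \<longlonglongrightarrow> 0"
  proof (rule Lim_null_comparison)
    show "\<forall>\<^sub>F n in sequentially. norm (I n) \<le> 2 * B / ((real n)\<^sup>2 - 1) * real n * pi"
      using eventually_gt_at_top[of 1]
    proof eventually_elim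
      case (elim n)
      then show ?case using bound[of "real n"] by (simp only: I_eq)
    qed
    show "(\<lambda>n. 2 * B / ((real n)\<^sup>2 - 1) * real n * pi) \<longlonglongrightarrow> 0" by real_asymp
  qed
  ultimately have "(\<integral>x. u x \<partial>lborel) = 0" using LIMSEQ_unique by blast
  moreover have "(\<integral>x. u x \<partial>lborel) = (\<integral>x. g (complex_of_real x) * of_real (1 / (1 + x\<^sup>2)) \<partial>lborel)
      - (\<integral>x. g \<i> * of_real (1 / (1 + x\<^sup>2)) \<partial>lborel)"
    unfolding u_def left_diff_distrib by (intro Bochner_Integration.integral_diff int integrable_mult_right k_int)
  moreover have "(\<integral>x. g \<i> * of_real (1 / (1 + x\<^sup>2)) \<partial>lborel) = g \<i> * pi"
    by (simp only: integral_mult_right_zero integral_complex_of_real integral_inverse_1_plus_sq)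
  ultimately show ?eq by (simp add: mult.commute)
qed

lemma poisson_UHP:
  fixes g :: "complex \<Rightarrow> complex"
  assumes e: "0 < e" and hol: "g holomorphic_on {z. Im z > - e}"
    and B: "\<And>z. Im z \<ge> 0 \<Longrightarrow> cmod (g z) \<le> B" and z: "Im z > 0"
  shows "(\<integral>x. g (complex_of_real x) * of_real (Im z / ((Im z)\<^sup>2 + (x - Re z)\<^sup>2)) \<partial>lborel) = pi * g z"
proof -
  define h where "h \<zeta> = g (of_real (Re z) + of_real (Im z) * \<zeta>)" for \<zeta>
  \<comment> \<open>The affine substitution that sends \<i> to z divides the strip width e by Im z;
    the cap 1 meets the hypothesis of \<open>poisson_at_i\<close>.\<close>
  define d where "d = min 1 (e / Im z)"
  have d: "0 < d" "d \<le> 1" using e z by (auto simp: d_def)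
  have "(g \<circ> (\<lambda>\<zeta>. of_real (Re z) + of_real (Im z) * \<zeta>)) holomorphic_on {\<zeta>. Im \<zeta> > - d}"
  proof (rule holomorphic_on_compose_gen[OF _ hol])
    show "(\<lambda>\<zeta>. of_real (Re z) + of_real (Im z) * \<zeta>) ` {\<zeta>. - d < Im \<zeta>} \<subseteq> {z. - e < Im z}"
    proof clarsimp
      fix \<zeta> assume "- d < Im \<zeta>"
      then have "Im z * (- (e / Im z)) < Im z * Im \<zeta>"
        using z by (intro mult_strict_left_mono) (auto simp: d_def)
      then show "- e < Im z * Im \<zeta>" using z by simp
    qed
  qed (intro holomorphic_intros)
  then have h_hol: "h holomorphic_on {\<zeta>. Im \<zeta> > - d}" by (simp add: h_def[abs_def] comp_def)
  have h_B: "cmod (h \<zeta>) \<le> B" if "Im \<zeta> \<ge> 0" for \<zeta>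
    unfolding h_def using that z by (intro B) simp
  have "(\<integral>x. g (complex_of_real x) * of_real (Im z / ((Im z)\<^sup>2 + (x - Re z)\<^sup>2)) \<partial>lborel) =
      (\<integral>s. h (complex_of_real s) * of_real (1 / (1 + s\<^sup>2)) \<partial>lborel)"
    unfolding integral_poisson_affine[OF z] h_def by simp
  also have "\<dots> = pi * h \<i>" by (rule poisson_at_i(2)[OF d h_hol h_B])
  also have "h \<i> = g z" by (simp add: h_def complex_eq[symmetric] mult.commute)
  finally show ?thesis .
qed

text \<open>After the shift, 1/F extends holomorphically and boundedly across the real axis, so
  Stieltjes inversion is explicit: -Im g / pi on the axis is the density. The Poisson formula
  matches imaginary parts; hence the transforms differ by a real constant.\<close>

lemma shifted_inverse_is_cauchy:
  assumes hol: "F holomorphic_on UHP" and Im_F: "\<And>z. Im z > 0 \<Longrightarrow> Im z \<le> Im (F z)" and \<epsilon>: "\<epsilon> > 0"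
  obtains M where "finite_borel_measure M"
    "\<And>z. Im z > 0 \<Longrightarrow> cauchy_transform M z = 1 / F (z + \<i> * of_real \<epsilon>)"
proof -
  define g where "g z = 1 / F (z + \<i> * of_real \<epsilon>)" for z
  define S where "S = {z. Im z > - \<epsilon>}"
  have F_ge: "Im z + \<epsilon> \<le> Im (F (z + \<i> * of_real \<epsilon>))" if "z \<in> S" for z
    using that Im_F[of "z + \<i> * of_real \<epsilon>"] by (simp add: S_def)
  have F_norm: "Im z + \<epsilon> \<le> cmod (F (z + \<i> * of_real \<epsilon>))" if "z \<in> S" for z
    using F_ge[OF that] abs_Im_le_cmod[of "F (z + \<i> * of_real \<epsilon>)"] by linarith
  have F_pos: "Im z + \<epsilon> > 0" if "z \<in> S" for z using that by (simp add: S_def)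
  have F_ne: "F (z + \<i> * of_real \<epsilon>) \<noteq> 0" if "z \<in> S" for z
    using F_norm[OF that] F_pos[OF that] by auto
  have g_norm: "cmod (g z) \<le> 1 / (Im z + \<epsilon>)" if "z \<in> S" for z
    unfolding g_def norm_divide norm_one using F_norm[OF that] F_pos[OF that] by (intro frac_le) auto
  have Im_g: "Im (g z) \<le> 0" if "z \<in> S" for z
    using F_ge[OF that] F_pos[OF that] by (simp add: g_def Im_divide divide_nonpos_nonneg)
  have "F \<circ> (\<lambda>z. z + \<i> * of_real \<epsilon>) holomorphic_on S"
    by (rule holomorphic_on_compose_gen[OF _ hol]) (auto simp: S_def intro!: holomorphic_intros)
  then have "(\<lambda>z. 1 / (F \<circ> (\<lambda>z. z + \<i> * of_real \<epsilon>)) z) holomorphic_on S"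
    by (rule holomorphic_on_divide[OF holomorphic_on_const]) (simp add: F_ne)
  then have g_hol: "g holomorphic_on S" by (simp add: g_def[abs_def])
  have g_B: "cmod (g z) \<le> 1 / \<epsilon>" if "Im z \<ge> 0" for z
  proof -
    have "cmod (g z) \<le> 1 / (Im z + \<epsilon>)" using that \<epsilon> by (intro g_norm) (simp add: S_def)
    also have "\<dots> \<le> 1 / \<epsilon>" using that \<epsilon> by (intro frac_le) auto
    finally show ?thesis .
  qed
  have g_cont: "continuous_on UNIV (\<lambda>x. g (complex_of_real x))"
    using \<epsilon> by (intro continuous_on_compose2[OF holomorphic_on_imp_continuous_on[OF g_hol]] continuous_intros)
      (auto simp: S_def)
  have [measurable]: "(\<lambda>x. g (complex_of_real x)) \<in> borel_measurable borel"
    by (rule borel_measurable_continuous_onI[OF g_cont])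
  define p where "p x = - Im (g (complex_of_real x)) / pi" for x
  have p_meas [measurable]: "p \<in> borel_measurable borel" unfolding p_def[abs_def] by measurable
  have p_nonneg: "p x \<ge> 0" for x
    using Im_g[of "complex_of_real x"] \<epsilon>
    unfolding p_def by (intro divide_nonneg_nonneg) (simp_all add: S_def)
  have poisson: "integrable lborel (\<lambda>x. p x * (Im z / ((Im z)\<^sup>2 + (x - Re z)\<^sup>2)))"
    "(\<integral>x. p x * (Im z / ((Im z)\<^sup>2 + (x - Re z)\<^sup>2)) \<partial>lborel) = - Im (g z)" if z: "Im z > 0" for z
  proof -
    define k where "k x = Im z / ((Im z)\<^sup>2 + (x - Re z)\<^sup>2)" for x
    have k: "integrable lborel k" "k x \<ge> 0" for x
      unfolding k_def[abs_def] using integrable_poisson[OF z, of "Re z"] z by auto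
    have int: "integrable lborel (\<lambda>x. g (complex_of_real x) * of_real (k x))"
    proof (rule Bochner_Integration.integrable_bound)
      show "integrable lborel (\<lambda>x. (1 / \<epsilon>) * k x)" by (intro integrable_mult_right k)
      show "AE x in lborel. norm (g (complex_of_real x) * of_real (k x)) \<le> norm ((1 / \<epsilon>) * k x)"
      proof (rule AE_I2)
        fix x
        have "cmod (g (complex_of_real x)) * k x \<le> (1 / \<epsilon>) * k x" by (intro mult_right_mono g_B k) simp
        then show "norm (g (complex_of_real x) * of_real (k x)) \<le> norm ((1 / \<epsilon>) * k x)"
          using k(2)[of x] \<epsilon> by (simp add: norm_mult)
      qed
      show "(\<lambda>x. g (complex_of_real x) * of_real (k x)) \<in> borel_measurable lborel"
        unfolding k_def by measurable
    qed
    have Im_eq: "Im (g (complex_of_real x) * of_real (k x)) = - pi * (p x * k x)" for x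
      by (simp add: p_def)
    have "integrable lborel (\<lambda>x. - pi * (p x * k x))" using int unfolding Im_eq[symmetric] by (rule integrable_Im)
    then have "integrable lborel (\<lambda>x. (- 1 / pi) * (- pi * (p x * k x)))" by (rule integrable_mult_right)
    moreover have "(- 1 / pi) * (- pi * (p x * k x)) = p x * k x" for x by simp
    ultimately show "integrable lborel (\<lambda>x. p x * (Im z / ((Im z)\<^sup>2 + (x - Re z)\<^sup>2)))"
      by (simp only: k_def)
    have "(\<integral>x. - pi * (p x * k x) \<partial>lborel) = Im (\<integral>x. g (complex_of_real x) * of_real (k x) \<partial>lborel)"
      unfolding Im_eq[symmetric] by (rule integral_Im[OF int])
    also have "\<dots> = Im (pi * g z)"
      unfolding k_def using poisson_UHP[OF \<epsilon> g_hol[unfolded S_def] g_B z] by simp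
    finally have "- pi * (\<integral>x. p x * k x \<partial>lborel) = pi * Im (g z)"
      by (simp only: integral_mult_right_zero) simp
    then have "pi * (\<integral>x. p x * k x \<partial>lborel) = pi * (- Im (g z))" by simp
    then have "(\<integral>x. p x * k x \<partial>lborel) = - Im (g z)" by (subst (asm) mult_left_cancel) simp_all
    then show "(\<integral>x. p x * (Im z / ((Im z)\<^sup>2 + (x - Re z)\<^sup>2)) \<partial>lborel) = - Im (g z)"
      by (simp only: k_def)
  qed
  \<comment> \<open>Fatou for the weights N^2 / (N^2 + x^2), which increase to 1: the weighted
    integral is -N Im g(\<i> N), and |g(\<i> N)| \<le> 1/N.\<close>
  have p_le_1: "(\<integral>\<^sup>+x. ennreal (p x) \<partial>lborel) \<le> 1"
  proof -
    define N where "N n = real (Suc n)" for n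
    define f where "f n x = p x * ((N n)\<^sup>2 / ((N n)\<^sup>2 + x\<^sup>2))" for n x
    have [measurable]: "f n \<in> borel_measurable borel" for n unfolding f_def[abs_def] by measurable
    have f_nonneg: "f n x \<ge> 0" for n x using p_nonneg by (simp add: f_def)
    have f_le: "(\<integral>\<^sup>+x. ennreal (f n x) \<partial>lborel) \<le> 1" for n
    proof -
      have N: "N n > 0" by (simp add: N_def)
      have f_eq: "f n = (\<lambda>x. N n * (p x * (N n / ((N n)\<^sup>2 + (x - 0)\<^sup>2))))"
        by (auto simp: f_def power2_eq_square)
      have int: "integrable lborel (f n)" "(\<integral>x. f n x \<partial>lborel) = N n * (- Im (g (\<i> * of_real (N n))))"
        using poisson[of "\<i> * of_real (N n)"] N unfolding f_eq by (auto simp del: diff_0_right times_divide_eq_right)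
      have "- Im (g (\<i> * of_real (N n))) \<le> cmod (g (\<i> * of_real (N n)))"
        using abs_Im_le_cmod[of "g (\<i> * of_real (N n))"] by linarith
      also have "\<dots> \<le> 1 / (N n + \<epsilon>)" using g_norm[of "\<i> * of_real (N n)"] N \<epsilon> by (simp add: S_def)
      also have "\<dots> \<le> 1 / N n" using N \<epsilon> by (intro frac_le) auto
      finally have "N n * (- Im (g (\<i> * of_real (N n)))) \<le> N n * (1 / N n)" using N by (intro mult_left_mono) auto
      then have "(\<integral>x. f n x \<partial>lborel) \<le> 1" using N int(2) by simp
      then show ?thesis using f_nonneg by (subst nn_integral_eq_integral[OF int(1)]) auto
    qed
    have lim: "(\<lambda>n. ennreal (f n x)) \<longlonglongrightarrow> ennreal (p x)" for x
    proof -
      have "(\<lambda>n. (real (Suc n))\<^sup>2 / ((real (Suc n))\<^sup>2 + x\<^sup>2)) \<longlonglongrightarrow> 1" by real_asymp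
      then have "(\<lambda>n. f n x) \<longlonglongrightarrow> p x * 1" unfolding f_def N_def by (rule tendsto_mult_left)
      then show ?thesis by (intro tendsto_ennrealI) simp
    qed
    have "(\<integral>\<^sup>+x. ennreal (p x) \<partial>lborel) = (\<integral>\<^sup>+x. liminf (\<lambda>n. ennreal (f n x)) \<partial>lborel)"
      using lim_imp_Liminf[OF _ lim] by simp
    also have "\<dots> \<le> liminf (\<lambda>n. \<integral>\<^sup>+x. ennreal (f n x) \<partial>lborel)"
      by (rule nn_integral_liminf) simp
    also have "\<dots> \<le> limsup (\<lambda>n. \<integral>\<^sup>+x. ennreal (f n x) \<partial>lborel)" by (rule Liminf_le_Limsup) simp
    also have "\<dots> \<le> 1" by (rule Limsup_bounded) (use f_le in simp)
    finally show ?thesis .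
  qed
  define M where "M = density lborel (\<lambda>x. ennreal (p x))"
  have M: "finite_borel_measure M"
  proof (intro finite_borel_measure.intro finite_measureI finite_borel_measure_axioms.intro)
    show "emeasure M (space M) \<noteq> \<infinity>"
      using p_le_1 by (auto simp: M_def emeasure_density top_unique)
  qed (simp add: M_def)
  interpret M: finite_borel_measure M by fact
  have Im_eq: "Im (cauchy_transform M z) = Im (g z)" if z: "Im z > 0" for z
  proof -
    have "Im (cauchy_transform M z) = (\<integral>x. Im (1 / (z - complex_of_real x)) \<partial>M)"
      unfolding cauchy_transform_def by (rule integral_Im[symmetric, OF M.integrable_kernel[OF z]])
    also have "\<dots> = (\<integral>x. p x *\<^sub>R Im (1 / (z - complex_of_real x)) \<partial>lborel)"
      unfolding M_def by (rule integral_density) (use p_nonneg in auto)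
    also have "\<dots> = (\<integral>x. - (p x * (Im z / ((Im z)\<^sup>2 + (x - Re z)\<^sup>2))) \<partial>lborel)"
    proof (intro Bochner_Integration.integral_cong refl)
      fix x
      have "- Im (1 / (z - complex_of_real x)) = Im z / ((Im z)\<^sup>2 + (x - Re z)\<^sup>2)"
        using Im_cauchy_kernel[of "Re z" "Im z" x] by (simp add: power2_commute)
      then show "p x *\<^sub>R Im (1 / (z - complex_of_real x)) = - (p x * (Im z / ((Im z)\<^sup>2 + (x - Re z)\<^sup>2)))"
        by (metis minus_equation_iff mult_minus_right real_scaleR_def)
    qed
    also have "\<dots> = Im (g z)" using poisson[OF z] by simp
    finally show ?thesis .
  qed
  define m where "m = measure M UNIV"
  \<comment> \<open>The constant D vanishes because both transforms decay like 1/y along the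
    imaginary axis.\<close>
  define D where "D z = cauchy_transform M z - g z" for z
  have D_hol: "D holomorphic_on UHP"
    unfolding D_def[abs_def] using \<epsilon>
    by (intro holomorphic_on_diff M.cauchy_holomorphic holomorphic_on_subset[OF g_hol]) (auto simp: S_def)
  have D_const: "D z = D \<i>" if "Im z > 0" for z
    by (rule constant_if_Im_nonneg[OF D_hol]) (use Im_eq that in \<open>auto simp: D_def\<close>)
  have "cmod (D \<i>) \<le> (m + 1) / real (Suc n)" for n
  proof -
    define z where "z = \<i> * of_real (real (Suc n))"
    have z: "Im z = real (Suc n)" "Im z > 0" by (simp_all add: z_def)
    have "cmod (g z) \<le> 1 / (Im z + \<epsilon>)" using z \<epsilon> by (intro g_norm) (simp add: S_def)
    also have "\<dots> \<le> 1 / Im z" using z \<epsilon> by (intro frac_le) auto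
    finally have "cmod (D z) \<le> m / Im z + 1 / Im z"
      using norm_triangle_ineq4[of "cauchy_transform M z" "g z"] M.cmod_cauchy_le[OF z(2)]
      by (simp add: D_def m_def)
    then show ?thesis using D_const[OF z(2)] z by (simp add: add_divide_distrib)
  qed
  moreover have "(\<lambda>n. (m + 1) / real (Suc n)) \<longlonglongrightarrow> 0" by real_asymp
  ultimately have "cmod (D \<i>) \<le> 0" by (intro LIMSEQ_le_const) auto
  then have "cauchy_transform M z = g z" if "Im z > 0" for z using D_const[OF that] by (simp add: D_def)
  then show ?thesis using that[OF M] by (simp add: g_def)
qed

text \<open>All the measures obtained from the shifts by \<open>\<epsilon>\<close> have the same mass m, the limit of \<open>y / \<bar>F (\<i> y)\<bar>\<close>.
  By Cauchy--Schwarz \<open>Im z / m \<le> Im (F z)\<close>, so m = 1, and tightness provides a limit as \<open>\<epsilon> \<longlongrightarrow> 0\<close>.\<close>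

lemma F_representation:
  assumes hol: "F holomorphic_on UHP" and Im_F: "\<And>z. Im z > 0 \<Longrightarrow> Im z \<le> Im (F z)" and ang: "ang F \<le> 1"
  obtains \<rho> where "real_distribution \<rho>" "\<And>z. Im z > 0 \<Longrightarrow> F_transform \<rho> z = F z"
proof -
  define \<epsilon> where "\<epsilon> k = 1 / (real k + 2)" for k
  have \<epsilon>: "0 < \<epsilon> k" "\<epsilon> k \<le> 1 / 2" for k by (auto simp: \<epsilon>_def field_simps)
  have F_ne: "F z \<noteq> 0" if "Im z > 0" for z using Im_F[OF that] that by auto
  have "\<exists>M. finite_borel_measure M \<and>
      (\<forall>z. Im z > 0 \<longrightarrow> cauchy_transform M z = 1 / F (z + \<i> * of_real (\<epsilon> k)))" for k
    using shifted_inverse_is_cauchy[OF hol Im_F \<epsilon>(1)[of k]] by metis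
  then obtain M where M: "\<And>k. finite_borel_measure (M k)"
    and M_eq: "\<And>k z. Im z > 0 \<Longrightarrow> cauchy_transform (M k) z = 1 / F (z + \<i> * of_real (\<epsilon> k))"
    by metis
  have lim_mass: "(\<lambda>n. real (Suc n) * cmod (1 / F (\<i> * of_real (real (Suc n))))) \<longlonglongrightarrow> measure (M k) UNIV" for k
  proof -
    interpret M: finite_borel_measure "M k" by (rule M)
    \<comment> \<open>Evaluating M k lower by \<epsilon> k compensates the shift: the values are
      those of 1/F at \<i> (n + 1), whatever k is. Hence all masses agree.\<close>
    define w where "w n = \<i> * of_real (real (Suc n) - \<epsilon> k)" for n
    have w: "Im (w n) = real (Suc n) - \<epsilon> k" "cmod (w n) = real (Suc n) - \<epsilon> k" "Im (w n) > 0" for n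
      using \<epsilon>[of k] by (auto simp: w_def norm_mult simp del: of_real_diff)
    have "(\<lambda>n. w n * cauchy_transform (M k) (w n)) \<longlonglongrightarrow> of_real (measure (M k) UNIV)"
    proof (rule M.cauchy_asymptotics[where C=1])
      show "filterlim (\<lambda>n. Im (w n)) at_top sequentially" unfolding w(1) by real_asymp
    qed (use w in auto)
    moreover have "cauchy_transform (M k) (w n) = 1 / F (\<i> * of_real (real (Suc n)))" for n
      unfolding M_eq[OF w(3)] by (simp add: w_def algebra_simps)
    ultimately have "(\<lambda>n. w n * (1 / F (\<i> * of_real (real (Suc n))))) \<longlonglongrightarrow> of_real (measure (M k) UNIV)"
      by simp
    from tendsto_norm[OF this]
    have 1: "(\<lambda>n. (real (Suc n) - \<epsilon> k) * cmod (1 / F (\<i> * of_real (real (Suc n))))) \<longlonglongrightarrow> measure (M k) UNIV"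
      by (simp only: norm_mult w(2)) simp
    have 2: "(\<lambda>n. real (Suc n) / (real (Suc n) - \<epsilon> k)) \<longlonglongrightarrow> 1" by real_asymp
    have "real (Suc n) / (real (Suc n) - \<epsilon> k) * ((real (Suc n) - \<epsilon> k) * c) = real (Suc n) * c" for n c
      using w(3)[of n] unfolding w(1) by simp
    then show ?thesis using tendsto_mult[OF 2 1] by (simp only:) simp
  qed
  define m where "m = measure (M 0) UNIV"
  have mass: "measure (M k) UNIV = m" for k
    unfolding m_def by (rule LIMSEQ_unique[OF lim_mass lim_mass])
  have "m \<le> 1"
    unfolding m_def
  proof (rule LIMSEQ_le_const2[OF lim_mass], intro exI allI impI)
    fix n
    have "real (Suc n) \<le> cmod (F (\<i> * of_real (real (Suc n))))"
      using Im_F[of "\<i> * of_real (real (Suc n))"] abs_Im_le_cmod[of "F (\<i> * of_real (real (Suc n)))"] by simp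
    then show "real (Suc n) * cmod (1 / F (\<i> * of_real (real (Suc n)))) \<le> 1"
      by (simp add: norm_divide divide_le_eq)
  qed
  have shift_lim: "(\<lambda>k. F (z + \<i> * of_real (\<epsilon> k))) \<longlonglongrightarrow> F z" if z: "Im z > 0" for z
  proof -
    have cont: "isCont F z"
      using holomorphic_on_imp_continuous_on[OF hol] z open_UHP by (simp add: continuous_on_eq_continuous_at)
    have "\<epsilon> \<longlonglongrightarrow> 0" unfolding \<epsilon>_def by real_asymp
    then have "(\<lambda>k. z + \<i> * of_real (\<epsilon> k)) \<longlonglongrightarrow> z + \<i> * of_real 0" by (intro tendsto_intros)
    then have "(\<lambda>k. z + \<i> * of_real (\<epsilon> k)) \<longlonglongrightarrow> z" by simp
    then show ?thesis by (rule isCont_tendsto_compose[OF cont])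
  qed
  have Im_le: "Im z \<le> m * Im (F z)" if z: "Im z > 0" for z
  proof (rule LIMSEQ_le_const)
    show "(\<lambda>k. m * Im (F (z + \<i> * of_real (\<epsilon> k)))) \<longlonglongrightarrow> m * Im (F z)"
      by (intro tendsto_intros shift_lim z)
    have "Im z \<le> m * Im (F (z + \<i> * of_real (\<epsilon> k)))" for k
    proof -
      interpret M: finite_borel_measure "M k" by (rule M)
      have "F (z + \<i> * of_real (\<epsilon> k)) \<noteq> 0" using z \<epsilon>(1)[of k] by (intro F_ne) simp
      then show ?thesis using M.Im_inverse_cauchy_ge[OF z] by (simp add: M_eq[OF z] mass)
    qed
    then show "\<exists>N. \<forall>k\<ge>N. Im z \<le> m * Im (F (z + \<i> * of_real (\<epsilon> k)))" by blast
  qed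
  have "m > 0"
  proof (rule ccontr)
    assume "\<not> m > 0"
    then have "m = 0" using measure_nonneg[of "M 0" UNIV] unfolding m_def by linarith
    then show False using Im_le[of \<i>] by simp
  qed
  have "1 / m \<le> ang F"
    by (rule ang_ge) (use Im_le \<open>m > 0\<close> in \<open>simp add: field_simps\<close>)
  then have "1 / m \<le> 1" using ang by linarith
  then have "m \<ge> 1" using \<open>m > 0\<close> by (simp add: divide_le_eq)
  with \<open>m \<le> 1\<close> have "m = 1" by simp
  have M_dist: "real_distribution (M k)" for k
  proof -
    interpret M: finite_borel_measure "M k" by (rule M)
    have "emeasure (M k) (space (M k)) = 1"
      using mass[of k] \<open>m = 1\<close> by (simp add: M.emeasure_eq_measure M.space_M_UNIV)
    then have "prob_space (M k)" by (rule prob_spaceI)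
    then show ?thesis using M.M_is_borel
      by (simp add: real_distribution_def real_distribution_axioms_def)
  qed
  interpret M: real_distribution "M k" for k by (rule M_dist)
  have tail: "\<exists>y>0. \<forall>k. measure (M k) (UNIV - {-y..y}) < \<eta>" if \<eta>: "\<eta> > 0" for \<eta>
  proof -
    define c where "c t = cauchy_transform (M 0) (\<i> * of_real t)" for t
    have L: "(\<lambda>n. (\<i> * of_real (real (Suc n))) * c (real (Suc n))) \<longlonglongrightarrow> of_real (measure (M 0) UNIV)"
      unfolding c_def
    proof (rule M.cauchy_asymptotics[where C=1])
      show "filterlim (\<lambda>n. Im (\<i> * of_real (real (Suc n)))) at_top sequentially"
        by simp real_asymp
    qed (simp_all add: norm_mult del: of_nat_Suc)
    have "(\<lambda>n. real (Suc n) * Im (c (real (Suc n)))) \<longlonglongrightarrow> - 1"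
      using tendsto_minus[OF tendsto_Re[OF L]] mass[of 0] \<open>m = 1\<close> by (simp del: of_nat_Suc)
    then have "\<forall>\<^sub>F n in sequentially. real (Suc n) * Im (c (real (Suc n))) < - 1 + \<eta> / 2"
      using \<eta> by (intro order_tendstoD(2)) auto
    then obtain n where n: "real (Suc n) * Im (c (real (Suc n))) < - 1 + \<eta> / 2"
      by (auto dest: eventually_happens)
    \<comment> \<open>Since \<open>\<epsilon> 0 = 1 / 2\<close>, the transform of M k at height y
      equals that of M 0 at height s + \<epsilon> k, between s and y. So one estimate for M 0 at s
      serves every k. The tail bound with d = y carries the factor 2, whence \<eta> / 2
      above.\<close>
    define s y where "s = real (Suc n)" "y = s + 1 / 2"
    have s: "s > 0" "y > 0" by (simp_all add: s_y_def)
    have "measure (M k) (UNIV - {-y..y}) < \<eta>" for k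
    proof -
      define t where "t = s + \<epsilon> k"
      have t: "s \<le> t" "t \<le> y" "t > 0" using \<epsilon>[of k] s by (auto simp: t_def s_y_def)
      have "cauchy_transform (M k) (\<i> * of_real y) = 1 / F (\<i> * of_real y + \<i> * of_real (\<epsilon> k))"
        using s by (intro M_eq) simp
      also have "\<i> * of_real y + \<i> * of_real (\<epsilon> k) = \<i> * of_real t + \<i> * of_real (\<epsilon> 0)"
        by (simp add: t_def s_y_def(2) \<epsilon>_def[of 0] algebra_simps)
      also have "1 / F (\<i> * of_real t + \<i> * of_real (\<epsilon> 0)) = c t"
        unfolding c_def using t by (intro M_eq[symmetric]) simp
      finally have "cauchy_transform (M k) (\<i> * of_real y) = c t" .
      then have "measure (M k) (UNIV - {-y..y}) \<le> (1 + y\<^sup>2 / y\<^sup>2) * (1 + y * Im (c t))"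
        using M.tail_le[OF s(2) s(2), of k] by simp
      also have "\<dots> = 2 * (1 + y * Im (c t))" using s by simp
      also have "Im (c t) \<le> 0" unfolding c_def using M.Im_cauchy_imag[OF t(3), of 0] t
        by (simp add: mult_nonneg_nonneg integral_nonneg_AE)
      then have "y * Im (c t) \<le> t * Im (c t)" using t by (intro mult_right_mono_neg)
      also have "t * Im (c t) \<le> s * Im (c s)" unfolding c_def by (rule M.imag_cauchy_mono[OF s(1) t(1)])
      also have "\<dots> < - 1 + \<eta> / 2" using n by (simp only: s_y_def)
      finally show ?thesis by simp
    qed
    then show ?thesis using s by blast
  qed
  have "tight M"
    unfolding tight_def
  proof (intro conjI allI impI)
    fix \<eta> :: real assume "\<eta> > 0"
    then obtain y where y: "y > 0" "\<And>k. measure (M k) (UNIV - {-y..y}) < \<eta>" using tail by blast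
    \<comment> \<open>Tightness is stated with half-open intervals; the left end moves so that -y is
      included.\<close>
    have "measure (M k) {-y-1<..y} > 1 - \<eta>" for k
    proof -
      have "measure (M k) (UNIV - {-y..y}) = 1 - measure (M k) {-y..y}"
        using M.prob_compl[of "{-y..y}" k] by simp
      moreover have "measure (M k) {-y..y} \<le> measure (M k) {-y-1<..y}"
        by (rule M.finite_measure_mono) auto
      ultimately show ?thesis using y(2)[of k] by linarith
    qed
    then show "\<exists>a b. a < b \<and> (\<forall>k. measure (M k) {a<..b} > 1 - \<eta>)"
      using y(1) by (intro exI[of _ "-y-1"] exI[of _ y]) auto
  qed (rule M_dist)
  then obtain r \<rho> where r: "strict_mono (r :: nat \<Rightarrow> nat)" "real_distribution \<rho>" "weak_conv_m (M \<circ> r) \<rho>"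
    using tight_imp_convergent_subsubsequence[of M id] by (auto simp: strict_mono_def)
  have "F_transform \<rho> z = F z" if z: "Im z > 0" for z
  proof -
    have "(\<lambda>n. cauchy_transform (M (r n)) z) \<longlonglongrightarrow> cauchy_transform \<rho> z"
      unfolding cauchy_transform_def
      using weak_conv_imp_integral_bdd_continuous_conv[of "M \<circ> r" \<rho> "\<lambda>x. 1 / (z - complex_of_real x)" "1 / Im z"]
        r M_dist cmod_inverse_kernel_le[OF z] kernel_nonzero[OF z] by simp
    moreover have "(\<lambda>n. 1 / F (z + \<i> * of_real (\<epsilon> (r n)))) \<longlonglongrightarrow> 1 / F z"
      using LIMSEQ_subseq_LIMSEQ[OF shift_lim[OF z] r(1)] F_ne[OF z]
      by (intro tendsto_intros) (auto simp: comp_def)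
    ultimately have "cauchy_transform \<rho> z = 1 / F z"
      by (simp add: M_eq[OF z] LIMSEQ_unique)
    then show ?thesis by (simp add: F_transform_def)
  qed
  then show ?thesis using that r(2) by blast
qed

section \<open>Monotone convolution\<close>

context real_distribution
begin

lemma measure_UNIV [simp]: "measure M UNIV = 1"
  using prob_space by simp

lemma cauchy_nonzero:
  assumes z: "Im z > 0" shows "cauchy_transform M z \<noteq> 0"
proof
  assume "cauchy_transform M z = 0"
  then have "(\<integral>x. (cmod (1 / (z - complex_of_real x)))\<^sup>2 \<partial>M) = 0" using Im_cauchy[OF z] z by simp
  then have "AE x in M. (cmod (1 / (z - complex_of_real x)))\<^sup>2 = 0"
    using integral_nonneg_eq_0_iff_AE[OF integrable_kernel_sq[OF z]] by simp
  then have "AE x in M. False" using kernel_nonzero[OF z] by simp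
  then show False by simp
qed

lemma F_holomorphic: "F_transform M holomorphic_on UHP"
  unfolding F_transform_def[abs_def]
  by (intro holomorphic_on_divide holomorphic_on_const cauchy_holomorphic) (simp add: cauchy_nonzero)

lemma Im_F_ge: "Im z > 0 \<Longrightarrow> Im z \<le> Im (F_transform M z)"
  using Im_inverse_cauchy_ge[OF _ cauchy_nonzero, of z] by (simp add: F_transform_def)

lemma Im_F_pos: "Im z > 0 \<Longrightarrow> Im (F_transform M z) > 0"
  using Im_F_ge[of z] by linarith

lemma F_asymptotics:
  assumes w: "filterlim (\<lambda>n. Im (w n)) at_top sequentially" "\<And>n. Im (w n) > 0"
    and C: "\<And>n. cmod (w n) \<le> C * Im (w n)"
  shows "(\<lambda>n. F_transform M (w n) / w n) \<longlonglongrightarrow> 1"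
proof -
  have "(\<lambda>n. 1 / (w n * cauchy_transform M (w n))) \<longlonglongrightarrow> 1 / of_real (measure M UNIV)"
    by (intro tendsto_intros cauchy_asymptotics[OF w C]) simp
  then show ?thesis by (simp add: F_transform_def mult.commute)
qed

end

text \<open>On the imaginary axis Im (f (\<i> y)) / y is the real part of f (\<i> y) / (\<i> y), so
  one sequence of points bounds the infimum.\<close>

lemma ang_le_1_if_asymptotic:
  assumes "\<And>z. Im z > 0 \<Longrightarrow> Im (f z) \<ge> 0"
    and lim: "(\<lambda>n. f (\<i> * of_real (real (Suc n))) / (\<i> * of_real (real (Suc n)))) \<longlonglongrightarrow> 1"
  shows "ang f \<le> 1"
proof (rule LIMSEQ_le_const)
  show "(\<lambda>n. Re (f (\<i> * of_real (real (Suc n))) / (\<i> * of_real (real (Suc n))))) \<longlonglongrightarrow> 1"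
    using tendsto_Re[OF lim] by simp
  have "ang f \<le> Re (f (\<i> * of_real (real (Suc n))) / (\<i> * of_real (real (Suc n))))" for n
  proof -
    have "ang f * Im (\<i> * of_real (real (Suc n))) \<le> Im (f (\<i> * of_real (real (Suc n))))"
      by (rule ang_mult_le[OF assms(1)]) simp_all
    then have "ang f \<le> Im (f (\<i> * of_real (real (Suc n)))) / real (Suc n)"
      by (subst le_divide_eq) (simp del: of_nat_Suc)
    also have "\<dots> = Re (f (\<i> * of_real (real (Suc n))) / (\<i> * of_real (real (Suc n))))"
      by (simp only: divide_divide_eq_left[symmetric] Re_divide_of_real) (simp add: Re_divide)
    finally show ?thesis .
  qed
  then show "\<exists>N. \<forall>n\<ge>N. ang f \<le> Re (f (\<i> * of_real (real (Suc n))) / (\<i> * of_real (real (Suc n))))"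
    by blast
qed

lemma imag_axis_at_top: "filterlim (\<lambda>n. Im (\<i> * of_real (real (Suc n)))) at_top sequentially"
  by simp real_asymp

lemma ang_F_transform:
  assumes "real_distribution \<mu>" shows "ang (F_transform \<mu>) = 1"
proof (rule antisym)
  interpret real_distribution \<mu> by fact
  show "ang (F_transform \<mu>) \<le> 1"
    by (rule ang_le_1_if_asymptotic)
       (use Im_F_pos in \<open>simp add: less_imp_le\<close>,
        rule F_asymptotics[where C=1, OF imag_axis_at_top], simp_all add: norm_mult del: of_nat_Suc)
  show "1 \<le> ang (F_transform \<mu>)" by (rule ang_ge) (simp add: Im_F_ge)
qed

text \<open>The bound Im z \<le> Im (F z) is immediate for the composition. The substance is
  \<open>ang F \<le> 1\<close>, since the outer asymptotics have to be used at the moving points v n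
  rather than on the imaginary axis.\<close>

lemma monotone_conv_exists:
  assumes "real_distribution \<mu>" "real_distribution \<nu>"
  obtains \<rho> where "real_distribution \<rho>"
    "\<And>z. Im z > 0 \<Longrightarrow> F_transform \<rho> z = F_transform \<mu> (F_transform \<nu> z)"
proof -
  interpret m: real_distribution \<mu> by fact
  interpret n: real_distribution \<nu> by fact
  define F where "F = F_transform \<mu> \<circ> F_transform \<nu>"
  have "F holomorphic_on UHP"
    unfolding F_def by (rule holomorphic_on_compose_gen[OF n.F_holomorphic m.F_holomorphic]) (auto simp: n.Im_F_pos)
  moreover have Im_F: "Im z \<le> Im (F z)" if "Im z > 0" for z
    using n.Im_F_ge[OF that] m.Im_F_ge[OF n.Im_F_pos[OF that]] by (simp add: F_def)
  moreover have "ang F \<le> 1"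
  proof (rule ang_le_1_if_asymptotic)
    define w where "w n = \<i> * of_real (real (Suc n))" for n
    define v where "v n = F_transform \<nu> (w n)" for n
    have w: "Im (w n) > 0" "cmod (w n) \<le> 1 * Im (w n)" "w n \<noteq> 0" for n
      by (simp_all add: w_def norm_mult del: of_nat_Suc)
    have wlim: "filterlim (\<lambda>n. Im (w n)) at_top sequentially"
      unfolding w_def by (rule imag_axis_at_top)
    have vw: "(\<lambda>n. v n / w n) \<longlonglongrightarrow> 1"
      unfolding v_def by (rule n.F_asymptotics[OF wlim w(1,2)])
    have Im_v: "Im (w n) \<le> Im (v n)" "Im (v n) > 0" for n
      unfolding v_def using n.Im_F_ge[OF w(1)] n.Im_F_pos[OF w(1)] by auto
    \<comment> \<open>v n / w n converges, hence is bounded, and Im (v n) \<ge> Im (w n) = |w n|; so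
      v n goes to infinity nontangentially.\<close>
    obtain K where K: "\<And>n. cmod (v n / w n) \<le> K"
      using convergent_imp_Bseq[OF convergentI[OF vw]] unfolding Bseq_def by blast
    have "cmod (v n) \<le> K * Im (v n)" for n
    proof -
      have "cmod (v n) = cmod (v n / w n) * cmod (w n)" using w(3)[of n] by (simp add: norm_divide)
      also have "\<dots> \<le> K * Im (v n)"
        using K[of n] w(2)[of n] Im_v[of n] order_trans[OF norm_ge_zero K[of n]] by (intro mult_mono) auto
      finally show ?thesis .
    qed
    moreover have "filterlim (\<lambda>n. Im (v n)) at_top sequentially"
      by (rule filterlim_at_top_mono[OF wlim]) (simp add: Im_v)
    ultimately have "(\<lambda>n. F_transform \<mu> (v n) / v n) \<longlonglongrightarrow> 1"
      using m.F_asymptotics[of v K] Im_v(2) by blast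
    from tendsto_mult[OF this vw] have "(\<lambda>n. F_transform \<mu> (v n) / v n * (v n / w n)) \<longlonglongrightarrow> 1" by simp
    moreover have "v n \<noteq> 0" for n using Im_v(2)[of n] by auto
    ultimately show "(\<lambda>n. F (\<i> * of_real (real (Suc n))) / (\<i> * of_real (real (Suc n)))) \<longlonglongrightarrow> 1"
      unfolding w_def[symmetric] F_def comp_def v_def[symmetric] by simp
    show "0 \<le> Im (F z)" if "Im z > 0" for z using Im_F[OF that] that by linarith
  qed
  ultimately obtain \<rho> where "real_distribution \<rho>" "\<And>z. Im z > 0 \<Longrightarrow> F_transform \<rho> z = F z"
    using F_representation by blast
  then show ?thesis using that by (simp add: F_def)
qed

lemma monotone_conv:
  assumes "real_distribution \<mu>" "real_distribution \<nu>"
  shows real_distribution_monotone_conv: "real_distribution (\<mu> \<rhd> \<nu>)"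
    and F_monotone_conv: "Im z > 0 \<Longrightarrow> F_transform (\<mu> \<rhd> \<nu>) z = F_transform \<mu> (F_transform \<nu> z)"
proof -
  have "\<exists>!\<rho>. real_distribution \<rho> \<and>
      (\<forall>z\<in>UHP. F_transform \<rho> z = F_transform \<mu> (F_transform \<nu> z))"
  proof (rule ex_ex1I)
    show "\<exists>\<rho>. real_distribution \<rho> \<and> (\<forall>z\<in>UHP. F_transform \<rho> z = F_transform \<mu> (F_transform \<nu> z))"
      using monotone_conv_exists[OF assms] by (metis UHP_iff)
    show "\<rho> = \<rho>'"
      if "real_distribution \<rho> \<and> (\<forall>z\<in>UHP. F_transform \<rho> z = F_transform \<mu> (F_transform \<nu> z))"
        "real_distribution \<rho>' \<and> (\<forall>z\<in>UHP. F_transform \<rho>' z = F_transform \<mu> (F_transform \<nu> z))" for \<rho> \<rho>'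
      using that by (intro F_transform_unique) auto
  qed
  from theI'[OF this] show "real_distribution (\<mu> \<rhd> \<nu>)"
    "Im z > 0 \<Longrightarrow> F_transform (\<mu> \<rhd> \<nu>) z = F_transform \<mu> (F_transform \<nu> z)"
    unfolding monotone_conv_def by auto
qed

section \<open>Iterated convolutions as compositions\<close>

definition F_comp :: "real measure list \<Rightarrow> complex \<Rightarrow> complex" where
  "F_comp ms = foldr (\<circ>) (map F_transform ms) id"

lemma F_comp_simps [simp]:
  "F_comp [] z = z" "F_comp (m # ms) z = F_transform m (F_comp ms z)"
  "F_comp (ms @ ns) z = F_comp ms (F_comp ns z)"
  by (simp_all add: F_comp_def foldr_comp_append del: foldr_append)

lemma Im_F_comp_ge:
  assumes "\<And>m. m \<in> set ms \<Longrightarrow> real_distribution m" "Im z > 0"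
  shows "Im z \<le> Im (F_comp ms z)"
  using assms
proof (induction ms)
  case (Cons m ms)
  have "Im z \<le> Im (F_comp ms z)" using Cons by simp
  moreover from this have "Im (F_comp ms z) \<le> Im (F_transform m (F_comp ms z))"
    using Cons.prems by (intro real_distribution.Im_F_ge) auto
  ultimately show ?case by simp
qed simp

lemma foldl_monotone_conv:
  assumes "real_distribution \<mu>" "\<And>m. m \<in> set ms \<Longrightarrow> real_distribution m"
  shows "real_distribution (foldl (\<rhd>) \<mu> ms) \<and>
    (\<forall>z\<in>UHP. F_transform (foldl (\<rhd>) \<mu> ms) z = F_transform \<mu> (F_comp ms z))"
  using assms
proof (induction ms arbitrary: \<mu>)
  case (Cons m ms)
  have m: "real_distribution m" using Cons.prems by simp
  have IH: "real_distribution (foldl (\<rhd>) (\<mu> \<rhd> m) ms) \<and>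
      (\<forall>z\<in>UHP. F_transform (foldl (\<rhd>) (\<mu> \<rhd> m) ms) z = F_transform (\<mu> \<rhd> m) (F_comp ms z))"
    using Cons.prems by (intro Cons.IH real_distribution_monotone_conv) auto
  have "F_transform (\<mu> \<rhd> m) (F_comp ms z) = F_transform \<mu> (F_comp (m # ms) z)" if "Im z > 0" for z
  proof -
    have "Im z \<le> Im (F_comp ms z)" using Cons.prems that by (intro Im_F_comp_ge) auto
    then show ?thesis using that by (simp add: F_monotone_conv[OF Cons.prems(1) m])
  qed
  then show ?case using IH by simp
qed simp

lemma monotone_conv_upto:
  assumes "k \<ge> 1" "\<And>j. j \<in> {1..k} \<Longrightarrow> real_distribution (M j)"
  shows real_distribution_monotone_conv_upto: "real_distribution (monotone_conv_upto M k)"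
    and F_monotone_conv_upto:
      "Im z > 0 \<Longrightarrow> F_transform (monotone_conv_upto M k) z = F_comp (map M [1..<Suc k]) z"
proof -
  have "map M [1..<Suc k] = M 1 # map M [2..<Suc k]"
    using assms(1) by (subst upt_conv_Cons) (auto simp: numeral_2_eq_2)
  moreover have "real_distribution (foldl (\<rhd>) (M 1) (map M [2..<Suc k])) \<and>
    (\<forall>z\<in>UHP. F_transform (foldl (\<rhd>) (M 1) (map M [2..<Suc k])) z = F_transform (M 1) (F_comp (map M [2..<Suc k]) z))"
    using assms by (intro foldl_monotone_conv) auto
  ultimately show "real_distribution (monotone_conv_upto M k)"
    "Im z > 0 \<Longrightarrow> F_transform (monotone_conv_upto M k) z = F_comp (map M [1..<Suc k]) z"
    unfolding monotone_conv_upto_def by auto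
qed

lemma return_borel:
  shows real_distribution_return: "real_distribution (return borel x)"
    and F_transform_return: "F_transform (return borel x) z = z - complex_of_real x"
proof -
  show "real_distribution (return borel x)"
    by (simp add: real_distribution_def real_distribution_axioms_def prob_space_return)
  have "cauchy_transform (return borel x) z = 1 / (z - complex_of_real x)"
    unfolding cauchy_transform_def by (rule integral_return) auto
  then show "F_transform (return borel x) z = z - complex_of_real x" by (simp add: F_transform_def)
qed

lemma F_comp_replicate_return:
  "F_comp (replicate n (return borel x)) z = z - of_nat n * complex_of_real x"
  by (induction n) (simp_all add: F_transform_return algebra_simps)

section \<open>Univalent transforms are limits of infinitesimal arrays\<close>

text \<open>With l the product of the angular derivatives to the right of h, the map h(l z) / (b l)
  has angular derivative 1, and the scalings of neighbours cancel in the composition. The fixed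
  point of h becomes the relation f(\<i> / l) = \<i> / (b l), so y = 1 / l, bounded by the total
  scaling of the row.\<close>

lemma rescaled_factors:
  assumes "\<And>h. h \<in> set hs \<Longrightarrow> selfmap h \<and> ang h = b" and b: "0 < b" "b \<le> 1"
  shows "\<exists>ms. length ms = length hs \<and>
    (\<forall>m\<in>set ms. real_distribution m \<and>
      (\<exists>y. 1 \<le> y \<and> y \<le> 1 / b ^ length hs \<and> F_transform m (\<i> * of_real y) = \<i> * of_real (y / b))) \<and>
    (\<forall>z\<in>UHP. F_comp ms z = foldr (\<circ>) hs id z / of_real (b ^ length hs))"
  using assms(1)
proof (induction hs)
  case Nil
  show ?case by (intro exI[of _ "[]"]) simp
next
  case (Cons h hs)
  define l where "l = b ^ length hs"
  have l: "0 < l" "l \<le> 1" using b by (simp_all add: l_def power_le_one)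
  have h: "selfmap h" "ang h = b" using Cons.prems by auto
  have "\<And>h. h \<in> set hs \<Longrightarrow> selfmap h \<and> ang h = b" using Cons.prems by simp
  from Cons.IH[OF this] obtain ms where ms': "length ms = length hs"
    "\<forall>m\<in>set ms. real_distribution m \<and>
      (\<exists>y. 1 \<le> y \<and> y \<le> 1 / l \<and> F_transform m (\<i> * of_real y) = \<i> * of_real (y / b))"
    "\<forall>z\<in>UHP. F_comp ms z = foldr (\<circ>) hs id z / of_real l"
    unfolding l_def by blast
  note ms = ms'(1) ms'(2)[rule_format] ms'(3)[rule_format, unfolded UHP_iff]
  define f where "f z = h (of_real l * z) / of_real (b * l)" for z
  have "(h \<circ> (\<lambda>z. of_real l * z)) holomorphic_on UHP"
    by (rule holomorphic_on_compose_gen[OF _ selfmapD(1)[OF h(1)]]) (use l in \<open>auto intro!: holomorphic_intros\<close>)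
  then have "(\<lambda>z. (h \<circ> (\<lambda>z. of_real l * z)) z / of_real (b * l)) holomorphic_on UHP"
    by (rule holomorphic_on_divide[OF _ holomorphic_on_const]) (use l b in simp)
  then have f_hol: "f holomorphic_on UHP" by (simp add: f_def[abs_def])
  have Im_f: "Im (f z) = Im (h (of_real l * z)) / (b * l)" for z
    unfolding f_def by (rule Im_divide_of_real)
  have f_ge: "Im z \<le> Im (f z)" if z: "Im z > 0" for z
  proof -
    have "b * Im (of_real l * z) \<le> Im (h (of_real l * z))"
      using selfmap_ang[OF h(1), of "of_real l * z"] h(2) z l by simp
    then show ?thesis using l b unfolding Im_f by (simp add: field_simps)
  qed
  \<comment> \<open>Scaling back, \<open>ang f * b\<close> is a lower bound for the angular
    derivative of h, which is b.\<close>
  have "ang f \<le> 1"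
  proof -
    have "ang f * b \<le> ang h"
    proof (rule ang_ge)
      fix z assume z: "Im z > 0"
      have "ang f * Im (z / of_real l) \<le> Im (f (z / of_real l))"
      proof (rule ang_mult_le)
        show "0 \<le> Im (f w)" if "Im w > 0" for w using f_ge[OF that] that by linarith
        show "0 < Im (z / of_real l)" using z l by (simp add: Im_divide_of_real)
      qed
      also have "f (z / of_real l) = h z / of_real (b * l)" using l by (simp add: f_def)
      finally show "ang f * b * Im z \<le> Im (h z)" using l b by (simp add: Im_divide_of_real field_simps del: of_real_mult)
    qed
    then show ?thesis using h(2) b by simp
  qed
  then obtain \<rho> where \<rho>: "real_distribution \<rho>" "\<And>z. Im z > 0 \<Longrightarrow> F_transform \<rho> z = f z"
    using F_representation[OF f_hol f_ge] by blast
  have bl: "b ^ length (h # hs) = b * l" by (simp add: l_def)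
  have mono: "1 / l \<le> 1 / (b * l)" using l b by (intro frac_le) (auto simp: mult_le_cancel_right1)
  show ?case
    unfolding bl
  proof (intro exI[of _ "\<rho> # ms"] conjI ballI)
    show "length (\<rho> # ms) = length (h # hs)" using ms by simp
    show "real_distribution m" if "m \<in> set (\<rho> # ms)" for m using that ms \<rho> by auto
    show "\<exists>y. 1 \<le> y \<and> y \<le> 1 / (b * l) \<and> F_transform m (\<i> * of_real y) = \<i> * of_real (y / b)"
      if m: "m \<in> set (\<rho> # ms)" for m
    proof (cases "m = \<rho>")
      case True
      have "f (\<i> * of_real (1 / l)) = \<i> * of_real (1 / l / b)"
        using l b selfmapD(4)[OF h(1)] by (simp add: f_def)
      then have "F_transform \<rho> (\<i> * of_real (1 / l)) = \<i> * of_real (1 / l / b)"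
        using l by (subst \<rho>(2)) simp_all
      then show ?thesis using l mono True by (intro exI[of _ "1 / l"]) simp
    next
      case False
      then have "m \<in> set ms" using m by simp
      then obtain y where "1 \<le> y" "y \<le> 1 / l" "F_transform m (\<i> * of_real y) = \<i> * of_real (y / b)"
        using ms(2) by blast
      then show ?thesis using mono by (intro exI[of _ y]) simp
    qed
    show "F_comp (\<rho> # ms) z = foldr (\<circ>) (h # hs) id z / of_real (b * l)" if "z \<in> UHP" for z
    proof -
      have "Im z \<le> Im (F_comp ms z)" using that ms(2) by (intro Im_F_comp_ge) auto
      then have "F_comp (\<rho> # ms) z = f (F_comp ms z)" using that \<rho>(2) by simp
      also have "F_comp ms z = foldr (\<circ>) hs id z / of_real l" using that by (simp add: ms(3))
      finally show ?thesis using l by (simp add: f_def)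
    qed
  qed
qed

lemma univalent_normalization:
  assumes \<mu>: "real_distribution \<mu>" and univ: "univalent (F_transform \<mu>)"
  defines "v \<equiv> Im (F_transform \<mu> \<i>)"
  defines "H \<equiv> (\<lambda>z. (F_transform \<mu> z - of_real (Re (F_transform \<mu> \<i>))) / of_real v)"
  shows "v > 0" "selfmap H" "ang H = 1 / v"
proof -
  interpret real_distribution \<mu> by fact
  show v: "v > 0" unfolding v_def by (rule Im_F_pos) simp
  have Im_H: "Im (H z) = Im (F_transform \<mu> z) / v" for z
    unfolding H_def by (simp add: Im_divide_of_real)
  show H: "selfmap H"
    unfolding selfmap_def
  proof (intro conjI ballI)
    show "H holomorphic_on UHP"
      unfolding H_def using v by (intro holomorphic_intros F_holomorphic) simp
    show "inj_on H UHP" using univ v unfolding univalent_def H_def by (auto simp: inj_on_def)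
    show "H z \<in> UHP" if "z \<in> UHP" for z using that v by (simp add: Im_H Im_F_pos)
    have "F_transform \<mu> \<i> - of_real (Re (F_transform \<mu> \<i>)) = \<i> * of_real v"
      by (simp add: complex_eq_iff v_def)
    then show "H \<i> = \<i>" using v by (simp add: H_def)
  qed
  show "ang H = 1 / v"
  proof (rule antisym)
    have "ang H * v \<le> ang (F_transform \<mu>)"
    proof (rule ang_ge)
      fix z assume z: "Im z > 0"
      show "ang H * v * Im z \<le> Im (F_transform \<mu> z)"
        using selfmap_ang[OF H z] v unfolding Im_H by (simp add: field_simps)
    qed
    then show "ang H \<le> 1 / v" using v by (simp add: ang_F_transform[OF \<mu>] field_simps)
    show "1 / v \<le> ang H" by (rule ang_ge) (use v Im_F_ge in \<open>simp add: Im_H divide_right_mono\<close>)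
  qed
qed

text \<open>At such a point G(\<i> y) = -\<i> b / y, so the integral in the Chebyshev bound is
  exactly 1 - b.\<close>

lemma (in real_distribution) tail_le_at_imaginary_point:
  assumes y: "1 \<le> y" "y \<le> B" and b: "0 < b" "b \<le> 1" and d: "d > 0"
    and F: "F_transform M (\<i> * of_real y) = \<i> * of_real (y / b)"
  shows "measure M (UNIV - {-d..d}) \<le> (1 + B\<^sup>2 / d\<^sup>2) * (1 - b)"
proof -
  have "cauchy_transform M (\<i> * of_real y) = 1 / (\<i> * of_real (y / b))"
    using F[symmetric] by (simp add: F_transform_def)
  also have "\<dots> = - \<i> * of_real (b / y)" using y b by (simp add: field_simps)
  finally have "1 + y * Im (cauchy_transform M (\<i> * of_real y)) = 1 - b" using y by simp
  then have "measure M (UNIV - {-d..d}) \<le> (1 + y\<^sup>2 / d\<^sup>2) * (1 - b)"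
    using tail_le[of y d] y d by simp
  also have "\<dots> \<le> (1 + B\<^sup>2 / d\<^sup>2) * (1 - b)"
    using y b by (intro mult_right_mono add_left_mono divide_right_mono power_mono) auto
  finally show ?thesis .
qed

lemma univalent_row:
  assumes \<mu>: "real_distribution \<mu>" and univ: "univalent (F_transform \<mu>)"
  defines "v \<equiv> Im (F_transform \<mu> \<i>)" and "c \<equiv> Re (F_transform \<mu> \<i>)"
  shows "\<exists>ms. length ms = 2 * 2 ^ n \<and> (\<forall>m\<in>set ms. real_distribution m) \<and>
    (\<forall>z\<in>UHP. F_comp ms z = F_transform \<mu> z) \<and>
    (\<forall>m\<in>set ms. \<forall>d>0. \<bar>c\<bar> / 2 ^ n \<le> d \<longrightarrow>
      measure m (UNIV - {-d..d}) \<le> (1 + v\<^sup>2 / d\<^sup>2) * (1 - (1 / v) powr (1 / 2 ^ n)))"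
proof -
  define H where "H = (\<lambda>z. (F_transform \<mu> z - of_real c) / of_real v)"
  have v: "v > 0" and H: "selfmap H" and ang_H: "ang H = 1 / v"
    using univalent_normalization[OF \<mu> univ] by (simp_all add: v_def c_def H_def)
  have v1: "v \<ge> 1" using ang_le_1[OF H] v by (simp add: ang_H)
  define b where "b = (1 / v) powr (1 / 2 ^ n)"
  have b: "0 < b" "b \<le> 1" using v v1 by (auto simp: b_def intro!: powr_le1)
  obtain hs where hs: "length hs = 2 ^ n" "\<And>h. h \<in> set hs \<Longrightarrow> selfmap h \<and> ang h = b"
    "\<And>z. Im z > 0 \<Longrightarrow> H z = foldr (\<circ>) hs id z"
    using power_two_factorization[OF H, of n] v unfolding ang_H b_def by auto
  have bK: "b ^ 2 ^ n = 1 / v"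
    using v by (simp add: b_def powr_power)
  obtain ms where ms': "length ms = 2 ^ n"
    "\<forall>m\<in>set ms. real_distribution m \<and>
      (\<exists>y. 1 \<le> y \<and> y \<le> 1 / (1 / v) \<and> F_transform m (\<i> * of_real y) = \<i> * of_real (y / b))"
    "\<forall>z\<in>UHP. F_comp ms z = foldr (\<circ>) hs id z / of_real (1 / v)"
    using rescaled_factors[of hs b] hs(2) b unfolding hs(1) bK by blast
  have ms: "length ms = 2 ^ n"
    "\<And>m. m \<in> set ms \<Longrightarrow> real_distribution m"
    "\<And>m. m \<in> set ms \<Longrightarrow> \<exists>y. 1 \<le> y \<and> y \<le> v \<and> F_transform m (\<i> * of_real y) = \<i> * of_real (y / b)"
    "\<And>z. Im z > 0 \<Longrightarrow> F_comp ms z = H z * of_real v"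
    using ms' by (simp_all add: hs(3))
  \<comment> \<open>The transform of a point mass at x is z - x, so \<open>2 ^ n\<close> of them
    restore the translation by c. Each sits at distance |c| / \<open>2 ^ n\<close> from 0 and so
    leaves any fixed interval about 0 uncharged outside for large n.\<close>
  define x where "x = - c / 2 ^ n"
  define row where "row = replicate (2 ^ n) (return borel x) @ ms"
  show ?thesis
  proof (intro exI[of _ row] conjI ballI allI impI)
    show "length row = 2 * 2 ^ n" by (simp add: row_def ms(1))
    show "real_distribution m" if "m \<in> set row" for m
      using that ms(2) real_distribution_return by (auto simp: row_def)
    show "F_comp row z = F_transform \<mu> z" if "z \<in> UHP" for z
      using that v by (simp add: row_def F_comp_replicate_return ms(4) x_def H_def)
    fix m d assume m: "m \<in> set row" and d: "d > 0" "\<bar>c\<bar> / 2 ^ n \<le> d"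
    have nonneg: "0 \<le> (1 + v\<^sup>2 / d\<^sup>2) * (1 - b)" using b by simp
    have "measure m (UNIV - {-d..d}) \<le> (1 + v\<^sup>2 / d\<^sup>2) * (1 - b)"
    proof (cases "m \<in> set ms")
      case True
      then obtain y where "1 \<le> y" "y \<le> v" "F_transform m (\<i> * of_real y) = \<i> * of_real (y / b)"
        using ms(3) by blast
      then show ?thesis
        using real_distribution.tail_le_at_imaginary_point[OF ms(2)[OF True]] b d by blast
    next
      case False
      then have m_eq: "m = return borel x" using m by (auto simp: row_def)
      have "\<bar>x\<bar> \<le> d" using d by (simp add: x_def)
      then have "x \<in> {-d..d}" by auto
      then have "measure m (UNIV - {-d..d}) = 0" unfolding m_eq by (subst measure_return) auto
      then show ?thesis using nonneg by simp
    qed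
    then show "measure m (UNIV - {-d..d}) \<le> (1 + v\<^sup>2 / d\<^sup>2) * (1 - (1 / v) powr (1 / 2 ^ n))"
      by (simp add: b_def)
  qed
qed

lemma univalent_imp_array_limit:
  assumes \<mu>: "real_distribution \<mu>" and univ: "univalent (F_transform \<mu>)"
  shows "\<exists>k M. infinitesimal_array k M \<and> weak_conv_m (\<lambda>n. monotone_conv_upto (M n) (k n)) \<mu>"
proof -
  define v c where "v = Im (F_transform \<mu> \<i>)" "c = Re (F_transform \<mu> \<i>)"
  have v: "v > 0" using univalent_normalization(1)[OF \<mu> univ] by (simp add: v_c_def)
  define bd where "bd n d = (1 + v\<^sup>2 / d\<^sup>2) * (1 - (1 / v) powr (1 / 2 ^ n))" for n :: nat and d
  define P where "P n ms \<longleftrightarrow> length ms = 2 * 2 ^ n \<and> (\<forall>m\<in>set ms. real_distribution m) \<and>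
    (\<forall>z\<in>UHP. F_comp ms z = F_transform \<mu> z) \<and>
    (\<forall>m\<in>set ms. \<forall>d>0. \<bar>c\<bar> / 2 ^ n \<le> d \<longrightarrow> measure m (UNIV - {-d..d}) \<le> bd n d)" for n ms
  have "\<exists>ms. P n ms" for n
    unfolding P_def bd_def v_c_def by (rule univalent_row[OF \<mu> univ])
  then obtain row where P: "\<And>n. P n (row n)" by metis
  have row: "\<And>n. length (row n) = 2 * 2 ^ n"
    "\<And>n m. m \<in> set (row n) \<Longrightarrow> real_distribution m"
    "\<And>n z. Im z > 0 \<Longrightarrow> F_comp (row n) z = F_transform \<mu> z"
    "\<And>n m d. m \<in> set (row n) \<Longrightarrow> d > 0 \<Longrightarrow> \<bar>c\<bar> / 2 ^ n \<le> d \<Longrightarrow> measure m (UNIV - {-d..d}) \<le> bd n d"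
    using P unfolding P_def by simp_all
  define k :: "nat \<Rightarrow> nat" where "k n = 2 * 2 ^ n" for n
  \<comment> \<open>Entries of a row are numbered from 1, list positions from 0.\<close>
  define M where "M n j = row n ! (j - 1)" for n j
  have M_in: "M n j \<in> set (row n)" if "j \<in> {1..k n}" for n j
    unfolding M_def by (rule nth_mem) (use that in \<open>auto simp: row(1) k_def\<close>)
  have k1: "k n \<ge> 1" for n by (simp add: k_def)
  have M_dist: "real_distribution (M n j)" if "j \<in> {1..k n}" for n j
    by (rule row(2)[OF M_in[OF that]])
  have map_M: "map (M n) [1..<Suc (k n)] = row n" for n
    by (rule nth_equalityI) (auto simp: row(1) k_def M_def simp del: upt_Suc)
  have conv_eq: "monotone_conv_upto (M n) (k n) = \<mu>" for n
  proof (rule F_transform_unique)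
    show "real_distribution (monotone_conv_upto (M n) (k n))"
      by (rule real_distribution_monotone_conv_upto[OF k1]) (rule M_dist)
    fix z :: complex assume z: "Im z > 0"
    have "F_transform (monotone_conv_upto (M n) (k n)) z = F_comp (map (M n) [1..<Suc (k n)]) z"
      by (rule F_monotone_conv_upto[OF k1 _ z]) (rule M_dist)
    also have "\<dots> = F_transform \<mu> z" by (simp only: map_M row(3)[OF z])
    finally show "F_transform (monotone_conv_upto (M n) (k n)) z = F_transform \<mu> z" .
  qed (rule \<mu>)
  have "weak_conv_m (\<lambda>n. monotone_conv_upto (M n) (k n)) \<mu>"
    by (simp add: conv_eq weak_conv_m_def weak_conv_def)
  moreover have "infinitesimal_array k M"
    unfolding infinitesimal_array_def
  proof (intro conjI allI impI ballI)
    have "filterlim (\<lambda>n. 2 * 2 ^ n :: real) at_top sequentially" by real_asymp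
    then show "filterlim k at_top sequentially"
      by (subst filterlim_sequentially_iff_filterlim_real) (simp add: k_def)
    fix d :: real assume d: "d > 0"
    show "(\<lambda>n. SUP j\<in>{1..k n}. measure (M n j) (UNIV - {-d..d})) \<longlonglongrightarrow> 0"
    proof (rule tendsto_sandwich[OF _ _ tendsto_const])
      show "(\<lambda>n. bd n d) \<longlonglongrightarrow> 0" unfolding bd_def using v by real_asymp
      have "(\<lambda>n. \<bar>c\<bar> / 2 ^ n) \<longlonglongrightarrow> 0" by real_asymp
      then have "\<forall>\<^sub>F n in sequentially. \<bar>c\<bar> / 2 ^ n < d" using d by (rule order_tendstoD(2))
      then show "\<forall>\<^sub>F n in sequentially. (SUP j\<in>{1..k n}. measure (M n j) (UNIV - {-d..d})) \<le> bd n d"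
      proof eventually_elim
        case (elim n)
        show ?case
        proof (rule cSUP_least)
          show "measure (M n j) (UNIV - {-d..d}) \<le> bd n d" if "j \<in> {1..k n}" for j
            using elim by (intro row(4)[OF M_in[OF that] d]) simp
        qed (use k1[of n] in simp)
      qed
      show "\<forall>\<^sub>F n in sequentially. 0 \<le> (SUP j\<in>{1..k n}. measure (M n j) (UNIV - {-d..d}))"
      proof (rule always_eventually, rule allI)
        fix n
        have "measure (M n 1) (UNIV - {-d..d}) \<le> (SUP j\<in>{1..k n}. measure (M n j) (UNIV - {-d..d}))"
          using k1[of n] by (intro cSUP_upper bdd_above_finite) auto
        then show "0 \<le> (SUP j\<in>{1..k n}. measure (M n j) (UNIV - {-d..d}))"
          using measure_nonneg[of "M n 1" "UNIV - {-d..d}"] by linarith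
      qed
    qed
  qed (rule k1, erule M_dist)
  ultimately show ?thesis by blast
qed

section \<open>Limits of arrays with vanishing variances\<close>

context real_distribution
begin

text \<open>u is the relative deviation of the Cauchy kernel from its mean; it is bounded, because
  the kernel is.\<close>

lemma centered_kernel:
  assumes z: "Im z > 0"
  defines "u \<equiv> (\<lambda>x. 1 / (z - complex_of_real x) / cauchy_transform M z - 1)"
  shows "integrable M u" "(\<integral>x. u x \<partial>M) = 0" "integrable M (\<lambda>x. (cmod (u x))\<^sup>2)"
proof -
  have k: "integrable M (\<lambda>x. 1 / (z - complex_of_real x) / cauchy_transform M z)"
    by (intro integrable_divide_zero integrable_kernel z)
  then show u: "integrable M u" unfolding u_def by (intro Bochner_Integration.integrable_diff integrable_const)
  have "(\<integral>x. 1 / (z - complex_of_real x) / cauchy_transform M z \<partial>M) = cauchy_transform M z / cauchy_transform M z"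
    by (simp only: integral_divide_zero cauchy_transform_def[symmetric])
  then show "(\<integral>x. u x \<partial>M) = 0"
    unfolding u_def using k cauchy_nonzero[OF z] by (subst Bochner_Integration.integral_diff) simp_all
  define B where "B = 1 / Im z / cmod (cauchy_transform M z) + 1"
  have u_le: "cmod (u x) \<le> B" for x
  proof -
    have "cmod (u x) \<le> cmod (1 / (z - complex_of_real x) / cauchy_transform M z) + 1"
      unfolding u_def using norm_triangle_ineq4[of "1 / (z - complex_of_real x) / cauchy_transform M z" 1] by simp
    also have "\<dots> \<le> B"
      unfolding B_def norm_divide[of _ "cauchy_transform M z"]
      by (intro add_right_mono divide_right_mono cmod_inverse_kernel_le z) simp
    finally show ?thesis .
  qed
  show "integrable M (\<lambda>x. (cmod (u x))\<^sup>2)"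
  proof (rule integrable_const_bound[where B="B\<^sup>2"])
    show "AE x in M. norm ((cmod (u x))\<^sup>2) \<le> B\<^sup>2"
      using u_le by (intro AE_I2) (simp add: power_mono)
    show "(\<lambda>x. (cmod (u x))\<^sup>2) \<in> borel_measurable M"
      using borel_measurable_integrable[OF u] by measurable
  qed
qed

text \<open>With f the Cauchy kernel and c its mean, u = f/c - 1 satisfies (z - x) (1 + u) = 1/c.
  Multiplying by the conjugate of u and integrating the imaginary part bounds the second moment of u.\<close>

lemma centered_kernel_second_moment:
  assumes z: "Im z > 0" and var: "integrable M (\<lambda>x. (x - m)\<^sup>2)" "(\<integral>x. (x - m)\<^sup>2 \<partial>M) \<le> V"
  shows "(\<integral>x. (cmod (1 / (z - complex_of_real x) / cauchy_transform M z - 1))\<^sup>2 \<partial>M) \<le> V / (Im z)\<^sup>2"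
proof -
  define c u where "c = cauchy_transform M z" "u x = 1 / (z - complex_of_real x) / c - 1" for x
  have u_int: "integrable M u" "(\<integral>x. u x \<partial>M) = 0" "integrable M (\<lambda>x. (cmod (u x))\<^sup>2)"
    using centered_kernel[OF z] unfolding c_u_def[abs_def] by auto
  have c: "c \<noteq> 0" unfolding c_u_def by (rule cauchy_nonzero[OF z])
  define y B where "y = Im z" "B = (\<integral>x. (cmod (u x))\<^sup>2 \<partial>M)"
  have y: "y > 0" using z by (simp add: y_B_def)
  \<comment> \<open>Both terms integrate to 0, since u has mean 0. The first recentres at m, so that
    x - m appears in the estimate instead of x.\<close>
  define w where "w x = (z - of_real m) * cnj (u x) - cnj (u x) / c" for x
  have cnj_int: "integrable M (\<lambda>x. cnj (u x))" "(\<integral>x. cnj (u x) \<partial>M) = 0"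
    using u_int by simp_all
  have w_int: "integrable M w"
    unfolding w_def[abs_def]
    by (intro Bochner_Integration.integrable_diff integrable_mult_right integrable_divide_zero cnj_int)
  have "(\<integral>x. w x \<partial>M) = (\<integral>x. (z - of_real m) * cnj (u x) \<partial>M) - (\<integral>x. cnj (u x) / c \<partial>M)"
    unfolding w_def[abs_def]
    by (intro Bochner_Integration.integral_diff integrable_mult_right integrable_divide_zero cnj_int)
  also have "\<dots> = 0" by (simp only: integral_mult_right_zero integral_divide_zero cnj_int(2)) simp
  finally have w_0: "(\<integral>x. Im (w x) \<partial>M) = 0" using integral_Im[OF w_int] by simp
  have ineq: "y * (cmod (u x))\<^sup>2 + Im (w x) \<le> (1 / (2 * y)) * (x - m)\<^sup>2 + (y / 2) * (cmod (u x))\<^sup>2" for x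
  proof -
    have "(z - complex_of_real x) * (1 + u x) = 1 / c"
      using kernel_nonzero[OF z, of x] by (simp add: c_u_def)
    then have "(z - complex_of_real x) * (1 + u x) * cnj (u x) = cnj (u x) / c" by simp
    then have "w x = (z - of_real m) * cnj (u x) - (z - complex_of_real x) * (1 + u x) * cnj (u x)"
      by (simp add: w_def)
    also have "\<dots> = of_real (x - m) * cnj (u x) - (z - complex_of_real x) * (u x * cnj (u x))"
      by (simp add: algebra_simps)
    finally have "Im (w x) = - (x - m) * Im (u x) - y * (cmod (u x))\<^sup>2"
      by (simp add: complex_norm_square[symmetric] y_B_def flip: of_real_power) (simp add: algebra_simps)
    \<comment> \<open>The arithmetic-geometric mean inequality, weighted by y so that half of y
      |u|^2 can be absorbed on the left after integration.\<close>
    moreover have "- (x - m) * Im (u x) \<le> (1 / (2 * y)) * (x - m)\<^sup>2 + (y / 2) * (cmod (u x))\<^sup>2"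
    proof -
      have "0 \<le> ((x - m) + y * Im (u x))\<^sup>2" by simp
      then have "- (x - m) * Im (u x) * (2 * y) \<le> (x - m)\<^sup>2 + y\<^sup>2 * (Im (u x))\<^sup>2"
        by (simp add: power2_eq_square algebra_simps)
      also have "\<dots> \<le> (x - m)\<^sup>2 + y\<^sup>2 * (cmod (u x))\<^sup>2"
        by (intro add_left_mono mult_left_mono) (auto simp: cmod_power2)
      also have "\<dots> = ((1 / (2 * y)) * (x - m)\<^sup>2 + (y / 2) * (cmod (u x))\<^sup>2) * (2 * y)"
        using y by (simp add: field_simps power2_eq_square)
      finally show ?thesis using y by (simp only: mult_le_cancel_right_pos)
    qed
    ultimately show ?thesis by linarith
  qed
  have "y * B = (\<integral>x. y * (cmod (u x))\<^sup>2 + Im (w x) \<partial>M)"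
    using u_int(3) w_int w_0 by (simp add: y_B_def(2))
  also have "\<dots> \<le> (\<integral>x. (1 / (2 * y)) * (x - m)\<^sup>2 + (y / 2) * (cmod (u x))\<^sup>2 \<partial>M)"
    by (intro integral_mono Bochner_Integration.integrable_add integrable_mult_right integrable_Im var u_int(3) w_int ineq)
  also have "\<dots> = (\<integral>x. (1 / (2 * y)) * (x - m)\<^sup>2 \<partial>M) + (\<integral>x. (y / 2) * (cmod (u x))\<^sup>2 \<partial>M)"
    by (intro Bochner_Integration.integral_add integrable_mult_right var u_int(3))
  also have "\<dots> = (1 / (2 * y)) * (\<integral>x. (x - m)\<^sup>2 \<partial>M) + (y / 2) * B"
    by (simp only: integral_mult_right_zero y_B_def(2))
  also have "\<dots> \<le> (1 / (2 * y)) * V + (y / 2) * B"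
    using var(2) y by (intro add_right_mono mult_left_mono) auto
  finally have "(y / 2) * B \<le> (1 / (2 * y)) * V" by simp
  then have "B \<le> V / y\<^sup>2" using y by (simp add: field_simps power2_eq_square)
  then show ?thesis unfolding y_B_def c_u_def .
qed

text \<open>A coincidence of values makes (w - z) times the integral of the two kernels vanish.
  Writing each kernel as its mean times 1 + U turns this integral into a nonzero multiple of 1 plus
  the integral of \<open>U z x * U w x\<close>, and above height s the second moments of U are below
  1.\<close>

lemma inj_on_F_if_variance_le:
  assumes s: "s > 0" and var: "variance_of M \<le> ennreal (s\<^sup>2)"
  shows "inj_on (F_transform M) {z. Im z > s}"
proof
  fix z w assume zw: "z \<in> {z. Im z > s}" "w \<in> {z. Im z > s}" and eq: "F_transform M z = F_transform M w"
  \<comment> \<open>\<open>centered_kernel_second_moment\<close> allows any real centre, so the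
    Bochner integral is taken as it stands, default value or not.\<close>
  define m where "m = (\<integral>x. x \<partial>M)"
  have nn: "(\<integral>\<^sup>+x. ennreal ((x - m)\<^sup>2) \<partial>M) \<le> ennreal (s\<^sup>2)"
    using var by (simp add: variance_of_def m_def)
  have sq_int: "integrable M (\<lambda>x. (x - m)\<^sup>2)"
    by (rule integrableI_nonneg) (use le_less_trans[OF nn ennreal_less_top] in auto)
  then have "ennreal (\<integral>x. (x - m)\<^sup>2 \<partial>M) \<le> ennreal (s\<^sup>2)"
    using nn by (subst (asm) nn_integral_eq_integral) auto
  then have sq_le: "(\<integral>x. (x - m)\<^sup>2 \<partial>M) \<le> s\<^sup>2" by (simp add: ennreal_le_iff)
  define U where "U z x = 1 / (z - complex_of_real x) / cauchy_transform M z - 1" for z x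
  have U_lt: "(\<integral>x. (cmod (U z x))\<^sup>2 \<partial>M) < 1" if z: "Im z > s" for z
  proof -
    have z0: "Im z > 0" using z s by simp
    have "(\<integral>x. (cmod (U z x))\<^sup>2 \<partial>M) \<le> s\<^sup>2 / (Im z)\<^sup>2"
      unfolding U_def by (rule centered_kernel_second_moment[OF z0 sq_int sq_le])
    also have "\<dots> < 1" using z s by (simp add: power_strict_mono)
    finally show ?thesis .
  qed
  have z: "Im z > s" "Im z > 0" and w: "Im w > s" "Im w > 0" using zw s by auto
  have U_int: "integrable M (U v)" "(\<integral>x. U v x \<partial>M) = 0" "integrable M (\<lambda>x. (cmod (U v x))\<^sup>2)"
    if "Im v > 0" for v
    unfolding U_def[abs_def] using centered_kernel[OF that] by auto
  have G: "cauchy_transform M z = cauchy_transform M w"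
    using eq by (simp add: F_transform_def divide_inverse)
  have UU_int: "integrable M (\<lambda>x. U z x * U w x)"
  proof (rule Bochner_Integration.integrable_bound)
    show "integrable M (\<lambda>x. (cmod (U z x))\<^sup>2 + (cmod (U w x))\<^sup>2)"
      by (intro Bochner_Integration.integrable_add U_int z w)
    show "AE x in M. norm (U z x * U w x) \<le> norm ((cmod (U z x))\<^sup>2 + (cmod (U w x))\<^sup>2)"
    proof (rule AE_I2)
      fix x
      have "2 * (cmod (U z x) * cmod (U w x)) \<le> (cmod (U z x))\<^sup>2 + (cmod (U w x))\<^sup>2"
        using sum_squares_bound[of "cmod (U z x)" "cmod (U w x)"] by simp
      moreover have "0 \<le> cmod (U z x) * cmod (U w x)" by simp
      ultimately show "norm (U z x * U w x) \<le> norm ((cmod (U z x))\<^sup>2 + (cmod (U w x))\<^sup>2)"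
        unfolding norm_mult by (simp del: mult_nonneg_nonneg)
    qed
    show "(\<lambda>x. U z x * U w x) \<in> borel_measurable M"
      using borel_measurable_integrable[OF U_int(1)[OF z(2)]] borel_measurable_integrable[OF U_int(1)[OF w(2)]]
      by (rule borel_measurable_times)
  qed
  have "cmod (\<integral>x. U z x * U w x \<partial>M) < 1"
  proof -
    have "cmod (\<integral>x. U z x * U w x \<partial>M) \<le> (\<integral>x. cmod (U z x * U w x) \<partial>M)" by (rule integral_norm_bound)
    also have "\<dots> \<le> (\<integral>x. (1 / 2) * (cmod (U z x))\<^sup>2 + (1 / 2) * (cmod (U w x))\<^sup>2 \<partial>M)"
    proof (intro integral_mono integrable_norm UU_int Bochner_Integration.integrable_add integrable_mult_right U_int z w)
      fix x
      show "cmod (U z x * U w x) \<le> (1 / 2) * (cmod (U z x))\<^sup>2 + (1 / 2) * (cmod (U w x))\<^sup>2"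
        using sum_squares_bound[of "cmod (U z x)" "cmod (U w x)"] by (simp add: norm_mult)
    qed
    also have "\<dots> = (\<integral>x. (1 / 2) * (cmod (U z x))\<^sup>2 \<partial>M) + (\<integral>x. (1 / 2) * (cmod (U w x))\<^sup>2 \<partial>M)"
      by (intro Bochner_Integration.integral_add integrable_mult_right U_int z w)
    also have "\<dots> = (1 / 2) * (\<integral>x. (cmod (U z x))\<^sup>2 \<partial>M) + (1 / 2) * (\<integral>x. (cmod (U w x))\<^sup>2 \<partial>M)"
      by (simp only: integral_mult_right_zero)
    also have "\<dots> < 1" using U_lt[OF z(1)] U_lt[OF w(1)] by simp
    finally show ?thesis .
  qed
  then have ne: "1 + (\<integral>x. U z x * U w x \<partial>M) \<noteq> 0"
    by (auto simp: add_eq_0_iff)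
  have "(\<integral>x. 1 / (z - complex_of_real x) * (1 / (w - complex_of_real x)) \<partial>M) =
      (\<integral>x. cauchy_transform M z * cauchy_transform M w * (1 + U z x + U w x + U z x * U w x) \<partial>M)"
  proof (intro Bochner_Integration.integral_cong refl)
    fix x
    have "1 / (v - complex_of_real x) = cauchy_transform M v * (1 + U v x)" if "Im v > 0" for v
      using cauchy_nonzero[OF that] by (simp add: U_def)
    then show "1 / (z - complex_of_real x) * (1 / (w - complex_of_real x)) =
        cauchy_transform M z * cauchy_transform M w * (1 + U z x + U w x + U z x * U w x)"
      using z w by (simp add: algebra_simps)
  qed
  also have "\<dots> = cauchy_transform M z * cauchy_transform M w * (\<integral>x. 1 + U z x + U w x + U z x * U w x \<partial>M)"
    by (rule integral_mult_right_zero)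
  also have "(\<integral>x. 1 + U z x + U w x + U z x * U w x \<partial>M) = 1 + (\<integral>x. U z x * U w x \<partial>M)"
    using U_int[OF z(2)] U_int[OF w(2)] UU_int by (simp add: prob_space)
  finally have "(\<integral>x. 1 / (z - complex_of_real x) * (1 / (w - complex_of_real x)) \<partial>M) \<noteq> 0"
    using ne cauchy_nonzero[OF z(2)] cauchy_nonzero[OF w(2)] by simp
  moreover have "(w - z) * (\<integral>x. 1 / (z - complex_of_real x) * (1 / (w - complex_of_real x)) \<partial>M) = 0"
    using cauchy_diff[OF z(2) w(2)] G by simp
  ultimately show "z = w" by simp
qed

end

lemma inj_on_F_comp:
  assumes "s > 0" "\<And>m. m \<in> set ms \<Longrightarrow> real_distribution m \<and> variance_of m \<le> ennreal (s\<^sup>2)"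
  shows "inj_on (F_comp ms) {z. Im z > s}"
  using assms(2)
proof (induction ms)
  case Nil
  show ?case by (simp add: inj_on_def)
next
  case (Cons m ms)
  have "F_comp ms ` {z. Im z > s} \<subseteq> {z. Im z > s}"
  proof clarsimp
    fix z assume z: "Im z > s"
    have "Im z \<le> Im (F_comp ms z)" by (rule Im_F_comp_ge) (use Cons.prems z assms(1) in auto)
    then show "s < Im (F_comp ms z)" using z by simp
  qed
  then have "inj_on (F_transform m) (F_comp ms ` {z. Im z > s})"
    using Cons.prems[of m] assms(1)
    by (intro inj_on_subset[OF real_distribution.inj_on_F_if_variance_le[of m s]]) auto
  moreover have "inj_on (F_comp ms) {z. Im z > s}" using Cons by simp
  ultimately have "inj_on (F_transform m \<circ> F_comp ms) {z. Im z > s}" by (intro comp_inj_on)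
  then show ?case by (simp add: comp_def inj_on_def)
qed

text \<open>Stated for G rather than 1/G because |G| \<le> 1/s on the half-plane gives Montel's
  bound at once. The limit is nonconstant: it tends to 0 along the imaginary axis but has no
  zero.\<close>

lemma inj_on_cauchy_limit:
  assumes \<nu>: "\<And>n. real_distribution (\<nu> n)" and \<mu>: "real_distribution \<mu>" and conv: "weak_conv_m \<nu> \<mu>"
    and s: "s > 0" and inj: "\<And>n. inj_on (cauchy_transform (\<nu> n)) {z. Im z > s}"
  shows "inj_on (cauchy_transform \<mu>) {z. Im z > s}"
proof -
  interpret m: real_distribution \<mu> by fact
  interpret n: real_distribution "\<nu> n" for n by (rule \<nu>)
  define S where "S = {z. Im z > s}"
  have S: "open S" "connected S" "S \<subseteq> UHP"
    unfolding S_def using s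
    by (auto simp: open_halfspace_Im_gt convex_connected convex_halfspace_Im_gt)
  have hol: "cauchy_transform (\<nu> n) holomorphic_on S" for n
    by (rule holomorphic_on_subset[OF n.cauchy_holomorphic S(3)])
  have bound: "cmod (cauchy_transform (\<nu> n) z) \<le> 1 / s" if "z \<in> S" for n z
  proof -
    have z: "Im z > s" "Im z > 0" using that s by (auto simp: S_def)
    have "cmod (cauchy_transform (\<nu> n) z) \<le> 1 / Im z" using n.cmod_cauchy_le[OF z(2)] by simp
    also have "\<dots> \<le> 1 / s" using z s by (intro frac_le) auto
    finally show ?thesis .
  qed
  obtain g r where g: "g holomorphic_on S" "strict_mono (r :: nat \<Rightarrow> nat)"
    "\<And>z. z \<in> S \<Longrightarrow> ((\<lambda>n. cauchy_transform (\<nu> (r n)) z) \<longlongrightarrow> g z) sequentially"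
    "\<And>K. compact K \<Longrightarrow> K \<subseteq> S \<Longrightarrow> uniform_limit K ((\<lambda>n. cauchy_transform (\<nu> n)) \<circ> r) g sequentially"
  proof (rule Montel[of S "range (\<lambda>n. cauchy_transform (\<nu> n))" "\<lambda>n. cauchy_transform (\<nu> n)"])
    show "\<exists>B. \<forall>h\<in>range (\<lambda>n. cauchy_transform (\<nu> n)). \<forall>z\<in>K. cmod (h z) \<le> B" if "K \<subseteq> S" for K
      using bound that by (intro exI[of _ "1 / s"]) auto
  qed (use hol S in auto)
  have g_eq: "g z = cauchy_transform \<mu> z" if "z \<in> S" for z
  proof (rule LIMSEQ_unique[OF g(3)[OF that]])
    have z: "Im z > 0" using that S by auto
    have "(\<lambda>n. cauchy_transform (\<nu> n) z) \<longlonglongrightarrow> cauchy_transform \<mu> z"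
      unfolding cauchy_transform_def
      using weak_conv_imp_integral_bdd_continuous_conv[of \<nu> \<mu> "\<lambda>x. 1 / (z - complex_of_real x)" "1 / Im z"]
        \<nu> \<mu> conv cmod_inverse_kernel_le[OF z] kernel_nonzero[OF z] by simp
    then show "(\<lambda>n. cauchy_transform (\<nu> (r n)) z) \<longlonglongrightarrow> cauchy_transform \<mu> z"
      using LIMSEQ_subseq_LIMSEQ[OF _ g(2)] by (auto simp: comp_def)
  qed
  have "\<not> g constant_on S"
  proof
    assume "g constant_on S"
    then obtain c where "\<And>z. z \<in> S \<Longrightarrow> g z = c" unfolding constant_on_def by blast
    then have c: "cauchy_transform \<mu> z = c" if "z \<in> S" for z using g_eq that by simp
    have "cmod c \<le> 1 / (s + real (Suc n))" for n
    proof -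
      have "Im (\<i> * of_real (s + real (Suc n))) > 0" "\<i> * of_real (s + real (Suc n)) \<in> S"
        using s by (simp_all add: S_def)
      then show ?thesis using m.cmod_cauchy_le[of "\<i> * of_real (s + real (Suc n))"] c by simp
    qed
    moreover have "(\<lambda>n. 1 / (s + real (Suc n))) \<longlonglongrightarrow> 0" by real_asymp
    ultimately have "cmod c \<le> 0" by (intro LIMSEQ_le_const) auto
    moreover have "\<i> * of_real (s + 1) \<in> S" by (simp add: S_def)
    ultimately show False using c m.cauchy_nonzero[of "\<i> * of_real (s + 1)"] s by auto
  qed
  then have "inj_on g S"
    using Hurwitz_injective[of S "(\<lambda>n. cauchy_transform (\<nu> n)) \<circ> r" g] S hol g inj
    by (simp add: S_def comp_def)
  then show ?thesis using g_eq by (simp add: inj_on_def S_def)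
qed

lemma array_limit_univalent:
  assumes arr: "infinitesimal_array k M"
    and var: "(\<lambda>n. SUP j\<in>{1..k n}. variance_of (M n j)) \<longlonglongrightarrow> 0"
    and \<mu>: "real_distribution \<mu>" and conv: "weak_conv_m (\<lambda>n. monotone_conv_upto (M n) (k n)) \<mu>"
  shows "univalent (F_transform \<mu>)"
proof -
  interpret m: real_distribution \<mu> by fact
  have k1: "k n \<ge> 1" and M_dist: "\<And>j. j \<in> {1..k n} \<Longrightarrow> real_distribution (M n j)" if "n \<ge> 1" for n
    using arr that unfolding infinitesimal_array_def by blast+
  have inj: "inj_on (cauchy_transform \<mu>) {z. Im z > s}" if s: "s > 0" for s
  proof -
    have "\<forall>\<^sub>F n in sequentially. (SUP j\<in>{1..k n}. variance_of (M n j)) < ennreal (s\<^sup>2)"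
      using s by (intro order_tendstoD(2)[OF var]) simp
    then obtain N where N: "\<And>n. n \<ge> N \<Longrightarrow> (SUP j\<in>{1..k n}. variance_of (M n j)) < ennreal (s\<^sup>2)"
      unfolding eventually_sequentially by blast
    \<comment> \<open>The offset \<open>Suc N\<close> puts every index beyond N and also at least 1,
      where rows begin.\<close>
    define \<nu> where "\<nu> n = monotone_conv_upto (M (n + Suc N)) (k (n + Suc N))" for n
    have "inj_on (cauchy_transform (\<nu> n)) {z. Im z > s}" for n
    proof -
      define n' where "n' = n + Suc N"
      have n': "n' \<ge> 1" "n' \<ge> N" by (simp_all add: n'_def)
      have "variance_of (M n' j) \<le> ennreal (s\<^sup>2)" if "j \<in> {1..k n'}" for j
        using SUP_upper[OF that, of "\<lambda>j. variance_of (M n' j)"] N[OF n'(2)] by simp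
      then have "inj_on (F_comp (map (M n') [1..<Suc (k n')])) {z. Im z > s}"
        using M_dist[OF n'(1)] by (intro inj_on_F_comp s) auto
      moreover have "F_transform (\<nu> n) z = F_comp (map (M n') [1..<Suc (k n')]) z" if "Im z > s" for z
        unfolding \<nu>_def n'_def[symmetric]
        by (rule F_monotone_conv_upto[OF k1[OF n'(1)] M_dist[OF n'(1)]]) (use that s in auto)
      ultimately have "inj_on (F_transform (\<nu> n)) {z. Im z > s}" by (simp add: inj_on_def)
      then show ?thesis by (simp add: inj_on_def F_transform_def)
    qed
    moreover have "real_distribution (\<nu> n)" for n
      unfolding \<nu>_def
      by (rule real_distribution_monotone_conv_upto[OF k1]) (simp, rule M_dist, simp_all)
    moreover have "weak_conv_m \<nu> \<mu>"
      unfolding weak_conv_m_def weak_conv_def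
    proof (intro allI impI)
      fix x assume "isCont (cdf \<mu>) x"
      then have "(\<lambda>n. cdf (monotone_conv_upto (M n) (k n)) x) \<longlonglongrightarrow> cdf \<mu> x"
        using conv unfolding weak_conv_m_def weak_conv_def by simp
      from LIMSEQ_ignore_initial_segment[OF this, of "Suc N"]
      show "(\<lambda>n. cdf (\<nu> n) x) \<longlonglongrightarrow> cdf \<mu> x" by (simp only: \<nu>_def)
    qed
    ultimately show ?thesis by (intro inj_on_cauchy_limit[OF _ \<mu> _ s])
  qed
  have "inj_on (F_transform \<mu>) UHP"
  proof
    fix z w assume zw: "z \<in> UHP" "w \<in> UHP" and "F_transform \<mu> z = F_transform \<mu> w"
    then have eq: "cauchy_transform \<mu> z = cauchy_transform \<mu> w" by (simp add: F_transform_def divide_inverse)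
    \<comment> \<open>Any two points of the half-plane lie above a common positive height.\<close>
    define s where "s = min (Im z) (Im w) / 2"
    have "s > 0" "z \<in> {z. Im z > s}" "w \<in> {z. Im z > s}" using zw by (auto simp: s_def min_def)
    then show "z = w" using inj_onD[OF inj eq] by blast
  qed
  then show ?thesis using m.F_holomorphic by (simp add: univalent_def)
qed

theorem theorem1p20:
  shows "(\<forall>\<mu>. real_distribution \<mu> \<and> univalent (F_transform \<mu>) \<longrightarrow>
            (\<exists>k M. infinitesimal_array k M \<and>
                   weak_conv_m (\<lambda>n. monotone_conv_upto (M n) (k n)) \<mu>))
       \<and> (\<forall>k M \<mu>. infinitesimal_array k M \<and>
            (\<lambda>n. SUP j\<in>{1..k n}. variance_of (M n j)) \<longlonglongrightarrow> 0 \<and>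
            real_distribution \<mu> \<and>
            weak_conv_m (\<lambda>n. monotone_conv_upto (M n) (k n)) \<mu> \<longrightarrow>
            univalent (F_transform \<mu>))"
proof (intro conjI allI impI; elim conjE)
  fix \<mu> assume "real_distribution \<mu>" "univalent (F_transform \<mu>)"
  then show "\<exists>k M. infinitesimal_array k M \<and> weak_conv_m (\<lambda>n. monotone_conv_upto (M n) (k n)) \<mu>"
    by (rule univalent_imp_array_limit)
qed (rule array_limit_univalent)

end
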